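(* Let $\nu\ge 3$ be an integer and let $R>r>0$, $R>1$ and $0<\omega<1$ be real numbers. Then there is a constant $\Gamma=\Gamma(R,r,\omega,\nu)$ such that the following holds. Let $P$ be a $k_1\times\cdots\times k_\nu$ multi-index transportation polytope, given by the overdetermined system $Ax=b$, $x\ge 0$, with $A$ having columns $a_1,\dots,a_n$, $n=k_1k_2\cdots k_\nu$. Let $z=(\zeta_1,\dots,\zeta_n)$ be the unique point of $P$ at which the strictly concave function $$g(x)=\sum_{j=1}^n \big((\xi_j+1)\ln(\xi_j+1)-\xi_j\ln \xi_j\big),\qquad x=(\xi_1,\dots,\xi_n),$$ attains its maximum on $P$. Let $$q(t)=\frac12\sum_{j=1}^n(\zeta_j+\zeta_j^2)\langle a_j,t\rangle^2,\qquad t\in\mathbb{R}^{k_1+\cdots+k_\nu}.$$ Suppose there is $k>0$ such that $$\omega k\le k_j\le k\ \ (j=1,\dots,\nu),\qquad r\le \zeta_j^2+\zeta_j\le R\ \ (j=1,\dots,n),\qquad \omega k\ge 2,$$ and $$\frac{8\pi^2 2^\nu\nu^2}{\omega^\nu\ln(1+\frac25\pi^2 r)}\left(\frac12\nu^2k\ln k+\frac12\nu k\ln R\right)k^{-\nu+1}\le\frac1{4\nu^2R},\qquad \frac{64\pi^2 2^\nu\nu^6R^2}{\omega^\nu r}\ln(k)\,k^{-\nu+2}\le\frac34 .$$ Then $|P\cap\mathbb{Z}^n|$ is approximated by $$\frac{e^{g(z)}}{(2\pi)^{(k_1+\cdots+k_\nu-\nu+1)/2}}\det(q|_{\mathcal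 L})^{-1/2}$$ to within relative error $\Gamma k^{-\nu+2.5}$. In particular, for fixed $r,R,\omega,\nu$ there exists $N=N(r,R,\omega,\nu)$ such that for all $k\ge N$ this holds with $$\Gamma=\frac{256R^2\pi^4 4^\nu\nu^8}{\omega^{2\nu}}.$$
   Context: A $k_1\times\cdots\times k_\nu$ multi-index ($\nu$-index) transportation polytope is the set of arrays $(\xi_{m_1,\dots,m_\nu})$, $1\le m_j\le k_j$, of non-negative real numbers such that for every $j\in\{1,\dots,\nu\}$ and every $m_j\in\{1,\dots,k_j\}$, $$\sum_{m_1,\dots,m_{j-1},m_{j+1},\dots,m_\nu}\xi_{m_1,\dots,m_\nu}=S^j_{m_j},$$ where the $S^j_{m_j}$ are constants, called the margins. Arrays are identified with vectors in $\mathbb{R}^n$, $n=k_1\cdots k_\nu$. The polytope is $\{x\in\mathbb{R}^n: Ax=b,\ x\ge0\}$, where the column $a_{m_1\ldots m_\nu}\in\mathbb{R}^{k_1+\cdots+k_\nu}$ of $A$ is zero except for a $1$ in positions $m_1,\ k_1+m_2,\ k_1+k_2+m_3,\dots,k_1+\cdots+k_{\nu-1}+m_\nu$, and the entry of $b$ in position $k_1+\cdots+k_{j-1}+m_j$ is $S^j_{m_j}$. The columns are also listed as $a_1,\dots,a_n$, with the same indexing as the coordinates of $x$. $\mathcal L=\{(\xi_1,\dots,\xi_{k_1+\cdots+k_\nu}):\ \xi_{k_1+\cdots+k_j}=0\text{ for all }2\le j\le\nu\}\subset\mathbb{R}^{k_1+\cdots+k_\nu}$, and $Q$ is the orthogonal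 projection of $\mathbb{R}^{k_1+\cdots+k_\nu}$ onto $\mathcal L$. If $q(t)=\frac12\langle t,Bt\rangle$ with $B$ symmetric positive semidefinite, then $\det(q|_{\mathcal L})$ is the product of the eigenvalues (with multiplicity) of $QBQ$ on eigenvectors lying in $\mathcal L$. Convention: $0\ln 0=0$. "$M$ is approximated by $E$ to within relative error $\varepsilon$" means $|M-E|\le\varepsilon E$.
   Formalization: The margins are assumed to be integers; for non-integer margins the polytope contains no integer points while the estimate is positive, so the claim as stated fails for large k. *)

theory Defs
  imports
    Complex_Main
    "HOL-Library.FuncSet"
    "Jordan_Normal_Form.VS_Connect"
    "Jordan_Normal_Form.Char_Poly"
begin

section \<open>Determinant of a quadratic form restricted to a subspace\<close>

definition quad_form_matrix :: "nat \<Rightarrow> (real vec \<Rightarrow> real) \<Rightarrow> real mat" where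
  "quad_form_matrix d q = (THE B. B \<in> carrier_mat d d \<and> transpose_mat B = B \<and>
     (\<forall>t\<in>carrier_vec d. q t = 1 / 2 * (t \<bullet> (B *\<^sub>v t))))"

definition orth_projection :: "nat \<Rightarrow> real vec set \<Rightarrow> real mat" where
  "orth_projection d L = (THE Q. Q \<in> carrier_mat d d \<and>
     (\<forall>t\<in>carrier_vec d. Q *\<^sub>v t \<in> L \<and> (\<forall>s\<in>L. (t - Q *\<^sub>v t) \<bullet> s = 0)))"

text \<open>The factor \<^term>\<open>l\<close> occurs as often as the dimension of the part of its eigenspace that lies
  in the subspace \<^term>\<open>L\<close>.\<close>

definition det_restrict :: "nat \<Rightarrow> (real vec \<Rightarrow> real) \<Rightarrow> real vec set \<Rightarrow> real" where
  "det_restrict d q L =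
     (let B = quad_form_matrix d q; Q = orth_projection d L; M = Q * B * Q
      in \<Prod>l\<in>{l. \<exists>v\<in>L. eigenvector M v l}.
           l ^ vectorspace.dim class_ring
                 ((module_vec TYPE(real) d)\<lparr>carrier := {v \<in> L. M *\<^sub>v v = l \<cdot>\<^sub>v v}\<rparr>))"

lemma quad_form_matrix_eqI:
  assumes B: "B \<in> carrier_mat d d" "transpose_mat B = B"
    and q: "\<And>t. t \<in> carrier_vec d \<Longrightarrow> q t = 1 / 2 * (t \<bullet> (B *\<^sub>v t))"
  shows "quad_form_matrix d q = B"
  unfolding quad_form_matrix_def
proof (rule the_equality, goal_cases)
  case 1
  then show ?case using assms by auto
next
  case (2 C)
  have polar: "2 * A $$ (i, j)
      = (unit_vec d i + unit_vec d j) \<bullet> (A *\<^sub>v (unit_vec d i + unit_vec d j))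
        - unit_vec d i \<bullet> (A *\<^sub>v unit_vec d i) - unit_vec d j \<bullet> (A *\<^sub>v unit_vec d j)"
    if A: "A \<in> carrier_mat d d" "transpose_mat A = A" and ij: "i < d" "j < d"
    for A :: "real mat" and i j
  proof -
    have e: "unit_vec d k \<bullet> (A *\<^sub>v unit_vec d l) = A $$ (k, l)" if "k < d" "l < d" for k l
      using A that by (simp add: scalar_prod_left_unit scalar_prod_right_unit)
    have "A $$ (j, i) = A $$ (i, j)"
      using A ij by (metis carrier_matD index_transpose_mat(1))
    then show ?thesis
      using A ij
      by (simp add: mult_add_distrib_mat_vec[OF A(1)] add_scalar_prod_distrib[of _ d]
          scalar_prod_add_distrib[of _ d] e)
  qed
  have same: "t \<bullet> (C *\<^sub>v t) = t \<bullet> (B *\<^sub>v t)" if "t \<in> carrier_vec d" for t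
    using 2 q[OF that] that by auto
  show ?case
  proof (rule eq_matI)
    fix i j assume "i < dim_row B" "j < dim_col B"
    then have ij: "i < d" "j < d" using B by auto
    have "2 * C $$ (i, j) = 2 * B $$ (i, j)"
      using polar[OF B ij] polar[of C, OF _ _ ij] 2 by (simp add: same)
    then show "C $$ (i, j) = B $$ (i, j)" by simp
  qed (use B 2 in auto)
qed

lemma orth_projection_eqI:
  assumes Q: "Q \<in> carrier_mat d d" and L: "L \<subseteq> carrier_vec d"
    and QL: "\<And>t. t \<in> carrier_vec d \<Longrightarrow> Q *\<^sub>v t \<in> L"
    and orth: "\<And>t s. t \<in> carrier_vec d \<Longrightarrow> s \<in> L \<Longrightarrow> (t - Q *\<^sub>v t) \<bullet> s = 0"
  shows "orth_projection d L = Q"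
  unfolding orth_projection_def
proof (rule the_equality, goal_cases)
  case 1
  then show ?case using assms by auto
next
  case (2 C)
  have sq0: "w = 0\<^sub>v d" if "w \<in> carrier_vec d" "w \<bullet> w = 0" for w :: "real vec"
  proof (rule eq_vecI)
    fix i assume "i < dim_vec (0\<^sub>v d :: real vec)"
    then show "w $ i = 0\<^sub>v d $ i"
      using that by (auto simp: scalar_prod_def sum_nonneg_eq_0_iff)
  qed (use that in auto)
  have eq: "C *\<^sub>v t = Q *\<^sub>v t" if t: "t \<in> carrier_vec d" for t
  proof -
    let ?u = "C *\<^sub>v t" and ?v = "Q *\<^sub>v t"
    have uv: "?u \<in> L" "?v \<in> L" "?u \<in> carrier_vec d" "?v \<in> carrier_vec d"
      using 2 t QL L by auto
    have diff: "(?u - ?v) \<bullet> s = 0" if s: "s \<in> L" for s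
    proof -
      have sc: "s \<in> carrier_vec d" using s L by auto
      have "(t - ?u) \<bullet> s = 0" "(t - ?v) \<bullet> s = 0" using 2 t s orth by auto
      then show ?thesis using uv t sc by (simp add: minus_scalar_prod_distrib[of _ d])
    qed
    have "(?u - ?v) \<bullet> (?u - ?v) = 0"
      using diff[OF uv(1)] diff[OF uv(2)] uv
      by (simp add: scalar_prod_minus_distrib[of _ d])
    then have "?u - ?v = 0\<^sub>v d"
      using uv sq0[of "?u - ?v"] by auto
    then show ?thesis
      using uv by (metis (no_types) add.right_neutral carrier_vecD eq_iff_diff_eq_0 eq_vecI
          index_minus_vec(1) index_zero_vec(1))
  qed
  show ?case
  proof (rule eq_matI)
    fix i j assume "i < dim_row Q" "j < dim_col Q"
    then have ij: "i < d" "j < d" using Q by auto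
    have "(C *\<^sub>v unit_vec d j) $ i = (Q *\<^sub>v unit_vec d j) $ i"
      using eq by simp
    then show "C $$ (i, j) = Q $$ (i, j)"
      using ij Q 2 by (auto simp: scalar_prod_right_unit)
  qed (use Q 2 in auto)
qed


section \<open>Multi-index transportation polytopes\<close>

text \<open>Arrays are extensional functions on the set of multi-indices \<^term>\<open>m\<close>, where
  \<open>m j \<in> {1..ks j}\<close> for \<open>j \<in> {1..\<nu>}\<close>. The multi-indices also serve as labels of the columns
  of the constraint matrix.\<close>

definition multi_indices :: "nat \<Rightarrow> (nat \<Rightarrow> nat) \<Rightarrow> (nat \<Rightarrow> nat) set" where
  "multi_indices \<nu> ks = (\<Pi>\<^sub>E j\<in>{1..\<nu>}. {1..ks j})"

definition transportation_polytope ::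
    "nat \<Rightarrow> (nat \<Rightarrow> nat) \<Rightarrow> (nat \<Rightarrow> nat \<Rightarrow> real) \<Rightarrow> ((nat \<Rightarrow> nat) \<Rightarrow> real) set" where
  "transportation_polytope \<nu> ks S =
     {x \<in> extensional (multi_indices \<nu> ks).
        (\<forall>m\<in>multi_indices \<nu> ks. 0 \<le> x m) \<and>
        (\<forall>j\<in>{1..\<nu>}. \<forall>l\<in>{1..ks j}. (\<Sum>m | m \<in> multi_indices \<nu> ks \<and> m j = l. x m) = S j l)}"

definition integer_points ::
    "nat \<Rightarrow> (nat \<Rightarrow> nat) \<Rightarrow> (nat \<Rightarrow> nat \<Rightarrow> real) \<Rightarrow> ((nat \<Rightarrow> nat) \<Rightarrow> real) set" where
  "integer_points \<nu> ks S =
     {x \<in> transportation_polytope \<nu> ks S. \<forall>m\<in>multi_indices \<nu> ks. x m \<in> \<int>}"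

definition total_size :: "nat \<Rightarrow> (nat \<Rightarrow> nat) \<Rightarrow> nat" where
  "total_size \<nu> ks = (\<Sum>j=1..\<nu>. ks j)"

text \<open>Position \<open>k\<^sub>1 + \<dots> + k\<^bsub>j-1\<^esub> + l\<close>, shifted by one because vector entries are
  numbered from 0; used only for \<open>l \<ge> 1\<close>.\<close>

definition row_index :: "(nat \<Rightarrow> nat) \<Rightarrow> nat \<Rightarrow> nat \<Rightarrow> nat" where
  "row_index ks j l = (\<Sum>i=1..<j. ks i) + l - 1"

definition column :: "nat \<Rightarrow> (nat \<Rightarrow> nat) \<Rightarrow> (nat \<Rightarrow> nat) \<Rightarrow> real vec" where
  "column \<nu> ks m =
     vec (total_size \<nu> ks) (\<lambda>i. if \<exists>j\<in>{1..\<nu>}. i = row_index ks j (m j) then 1 else 0)"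

definition slice_space :: "nat \<Rightarrow> (nat \<Rightarrow> nat) \<Rightarrow> real vec set" where
  "slice_space \<nu> ks =
     {t \<in> carrier_vec (total_size \<nu> ks). \<forall>j\<in>{2..\<nu>}. t $ row_index ks j (ks j) = 0}"

text \<open>With \<open>ln 0 = 0\<close>, the convention \<open>0 ln 0 = 0\<close> is respected.\<close>

definition entropy :: "nat \<Rightarrow> (nat \<Rightarrow> nat) \<Rightarrow> ((nat \<Rightarrow> nat) \<Rightarrow> real) \<Rightarrow> real" where
  "entropy \<nu> ks x = (\<Sum>m\<in>multi_indices \<nu> ks. (x m + 1) * ln (x m + 1) - x m * ln (x m))"

definition gauss_form ::
    "nat \<Rightarrow> (nat \<Rightarrow> nat) \<Rightarrow> ((nat \<Rightarrow> nat) \<Rightarrow> real) \<Rightarrow> real vec \<Rightarrow> real" where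
  "gauss_form \<nu> ks z t =
     1 / 2 * (\<Sum>m\<in>multi_indices \<nu> ks. (z m + (z m)\<^sup>2) * (column \<nu> ks m \<bullet> t)\<^sup>2)"

definition gauss_estimate :: "nat \<Rightarrow> (nat \<Rightarrow> nat) \<Rightarrow> ((nat \<Rightarrow> nat) \<Rightarrow> real) \<Rightarrow> real" where
  "gauss_estimate \<nu> ks z =
     exp (entropy \<nu> ks z) / (2 * pi) powr ((real (total_size \<nu> ks) - real \<nu> + 1) / 2) *
     det_restrict (total_size \<nu> ks) (gauss_form \<nu> ks z) (slice_space \<nu> ks) powr (- 1 / 2)"

definition approximated_within :: "real \<Rightarrow> real \<Rightarrow> real \<Rightarrow> bool" where
  "approximated_within M E \<epsilon> \<longleftrightarrow> \<bar>M - E\<bar> \<le> \<epsilon> * E"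

text \<open>The margins are required to be integers: otherwise the polytope contains no integer point,
  and no positive estimate can be good. The maximiser \<^term>\<open>z\<close> is unique by strict concavity.\<close>

definition admissible ::
    "nat \<Rightarrow> real \<Rightarrow> real \<Rightarrow> real \<Rightarrow> real \<Rightarrow> (nat \<Rightarrow> nat) \<Rightarrow> (nat \<Rightarrow> nat \<Rightarrow> real)
      \<Rightarrow> ((nat \<Rightarrow> nat) \<Rightarrow> real) \<Rightarrow> bool" where
  "admissible \<nu> r R \<omega> k ks S z \<longleftrightarrow>
     (\<forall>j\<in>{1..\<nu>}. \<forall>l\<in>{1..ks j}. S j l \<in> \<int>) \<and>
     is_arg_max (entropy \<nu> ks) (\<lambda>x. x \<in> transportation_polytope \<nu> ks S) z \<and>
     k > 0 \<and>
     (\<forall>j\<in>{1..\<nu>}. \<omega> * k \<le> real (ks j) \<and> real (ks j) \<le> k) \<and>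
     (\<forall>m\<in>multi_indices \<nu> ks. r \<le> (z m)\<^sup>2 + z m \<and> (z m)\<^sup>2 + z m \<le> R) \<and>
     \<omega> * k \<ge> 2 \<and>
     8 * pi\<^sup>2 * 2 ^ \<nu> * (real \<nu>)\<^sup>2 / (\<omega> ^ \<nu> * ln (1 + 2 / 5 * pi\<^sup>2 * r)) *
       (1 / 2 * (real \<nu>)\<^sup>2 * k * ln k + 1 / 2 * real \<nu> * k * ln R) * k powr (- real \<nu> + 1)
       \<le> 1 / (4 * (real \<nu>)\<^sup>2 * R) \<and>
     64 * pi\<^sup>2 * 2 ^ \<nu> * real \<nu> ^ 6 * R\<^sup>2 / (\<omega> ^ \<nu> * r) * ln k * k powr (- real \<nu> + 2)
       \<le> 3 / 4"

lemma row_index_less: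
  assumes "1 \<le> j" "j < j'" "l \<in> {1..ks j}" "l' \<in> {1..ks j'}"
  shows "row_index ks j l < row_index ks j' l'"
proof -
  have "(\<Sum>i=1..<j. ks i) + ks j = (\<Sum>i=1..<Suc j. ks i)"
    using assms by simp
  also have "\<dots> \<le> (\<Sum>i=1..<j'. ks i)"
    using assms by (intro sum_mono2) auto
  finally show ?thesis using assms unfolding row_index_def by auto
qed

lemma row_index_eq_iff:
  assumes "1 \<le> j" "1 \<le> j'" "l \<in> {1..ks j}" "l' \<in> {1..ks j'}"
  shows "row_index ks j l = row_index ks j' l' \<longleftrightarrow> j = j' \<and> l = l'"
proof (cases j j' rule: linorder_cases)
  case equal
  then show ?thesis using assms by (auto simp: row_index_def)
qed (use row_index_less[of j j' l ks l'] row_index_less[of j' j l' ks l] assms in auto)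

lemma row_index_bound:
  assumes "j \<in> {1..\<nu>}" "l \<in> {1..ks j}"
  shows "row_index ks j l < total_size \<nu> ks"
proof -
  have "(\<Sum>i=1..<j. ks i) + ks j = (\<Sum>i=1..<Suc j. ks i)"
    using assms by simp
  also have "\<dots> \<le> total_size \<nu> ks"
    unfolding total_size_def using assms by (intro sum_mono2) auto
  finally show ?thesis using assms unfolding row_index_def by auto
qed

lemma column_index:
  assumes "m \<in> multi_indices \<nu> ks" "j \<in> {1..\<nu>}" "l \<in> {1..ks j}"
  shows "column \<nu> ks m $ row_index ks j l = (if m j = l then 1 else 0)"
proof -
  have mem: "m i \<in> {1..ks i}" if "i \<in> {1..\<nu>}" for i
    using assms(1) that by (auto simp: multi_indices_def)
  have "(\<exists>i\<in>{1..\<nu>}. row_index ks j l = row_index ks i (m i)) \<longleftrightarrow> m j = l"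
    using row_index_eq_iff[of j _ l ks] mem assms by (metis atLeastAtMost_iff)
  then show ?thesis using row_index_bound[of j \<nu> l ks] assms by (simp add: column_def)
qed

lemma transportation_polytope_linear_system:
  "x \<in> transportation_polytope \<nu> ks S \<longleftrightarrow>
     x \<in> extensional (multi_indices \<nu> ks) \<and> (\<forall>m\<in>multi_indices \<nu> ks. 0 \<le> x m) \<and>
     (\<forall>j\<in>{1..\<nu>}. \<forall>l\<in>{1..ks j}.
        (\<Sum>m\<in>multi_indices \<nu> ks. x m * column \<nu> ks m $ row_index ks j l) = S j l)"
proof -
  have fin: "finite (multi_indices \<nu> ks)"
    unfolding multi_indices_def by (intro finite_PiE) auto
  have "(\<Sum>m\<in>multi_indices \<nu> ks. x m * column \<nu> ks m $ row_index ks j l)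
      = (\<Sum>m | m \<in> multi_indices \<nu> ks \<and> m j = l. x m)"
    if "j \<in> {1..\<nu>}" "l \<in> {1..ks j}" for j l
  proof -
    have "(\<Sum>m\<in>multi_indices \<nu> ks. x m * column \<nu> ks m $ row_index ks j l)
        = (\<Sum>m\<in>multi_indices \<nu> ks. if m j = l then x m else 0)"
      using that by (intro sum.cong) (auto simp: column_index)
    then show ?thesis using fin by (simp add: sum.inter_filter)
  qed
  then show ?thesis by (auto simp: transportation_polytope_def)
qed

lemma orth_projection_slice_space:
  assumes "\<And>j. j \<in> {1..\<nu>} \<Longrightarrow> ks j \<ge> 1"
  shows "orth_projection (total_size \<nu> ks) (slice_space \<nu> ks) =
    mat (total_size \<nu> ks) (total_size \<nu> ks)
      (\<lambda>(i, i'). if i = i' \<and> (\<forall>j\<in>{2..\<nu>}. i \<noteq> row_index ks j (ks j)) then 1 else 0)"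
    (is "_ = ?Q")
proof -
  let ?d = "total_size \<nu> ks"
  let ?P = "\<lambda>i. \<forall>j\<in>{2..\<nu>}. i \<noteq> row_index ks j (ks j)"
  have Qt: "(?Q *\<^sub>v t) $ i = (if ?P i then t $ i else 0)" if "t \<in> carrier_vec ?d" "i < ?d" for t i
  proof -
    have "(?Q *\<^sub>v t) $ i = (\<Sum>i'<?d. (if i = i' \<and> ?P i then 1 else 0) * t $ i')"
      using that by (auto simp: scalar_prod_def lessThan_atLeast0 intro!: sum.cong)
    also have "\<dots> = (\<Sum>i'<?d. if i = i' then (if ?P i then t $ i else 0) else 0)"
      by (intro sum.cong) auto
    finally show ?thesis using that by simp
  qed
  have bound: "row_index ks j (ks j) < ?d" if "j \<in> {2..\<nu>}" for j
    using row_index_bound[of j \<nu> "ks j" ks] assms[of j] that by auto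
  show ?thesis
  proof (rule orth_projection_eqI)
    fix t :: "real vec" assume t: "t \<in> carrier_vec ?d"
    show "?Q *\<^sub>v t \<in> slice_space \<nu> ks"
      unfolding slice_space_def using Qt[OF t] bound t
      by (auto intro: mult_mat_vec_carrier[of _ ?d ?d])
    fix s assume s: "s \<in> slice_space \<nu> ks"
    show "(t - ?Q *\<^sub>v t) \<bullet> s = 0"
      unfolding scalar_prod_def
    proof (rule sum.neutral, rule ballI)
      fix i assume "i \<in> {0..<dim_vec s}"
      then have i: "i < ?d" using s by (auto simp: slice_space_def)
      show "(t - ?Q *\<^sub>v t) $ i * s $ i = 0"
        using Qt[OF t i] i s by (auto simp: slice_space_def)
    qed
  qed (auto simp: slice_space_def)
qed

lemma quad_form_matrix_gauss_form:
  "quad_form_matrix (total_size \<nu> ks) (gauss_form \<nu> ks z) =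
    mat (total_size \<nu> ks) (total_size \<nu> ks)
      (\<lambda>(i, i'). \<Sum>m\<in>multi_indices \<nu> ks.
         (z m + (z m)\<^sup>2) * (column \<nu> ks m $ i * column \<nu> ks m $ i'))"
    (is "_ = ?B")
proof (rule quad_form_matrix_eqI)
  let ?d = "total_size \<nu> ks" and ?I = "multi_indices \<nu> ks"
  show "transpose_mat ?B = ?B"
    by (rule eq_matI) (auto simp: mult.commute)
  fix t :: "real vec" assume t: "t \<in> carrier_vec ?d"
  have "t \<bullet> (?B *\<^sub>v t) = (\<Sum>i<?d. t $ i * (\<Sum>i'<?d. (\<Sum>m\<in>?I.
      (z m + (z m)\<^sup>2) * (column \<nu> ks m $ i * column \<nu> ks m $ i')) * t $ i'))"
    using t by (auto simp: scalar_prod_def lessThan_atLeast0 intro!: sum.cong)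
  also have "\<dots> = (\<Sum>i<?d. \<Sum>i'<?d. \<Sum>m\<in>?I. (z m + (z m)\<^sup>2) *
      ((column \<nu> ks m $ i * t $ i) * (column \<nu> ks m $ i' * t $ i')))"
    by (simp add: sum_distrib_left sum_distrib_right mult_ac)
  also have "\<dots> = (\<Sum>i<?d. \<Sum>m\<in>?I. \<Sum>i'<?d. (z m + (z m)\<^sup>2) *
      ((column \<nu> ks m $ i * t $ i) * (column \<nu> ks m $ i' * t $ i')))"
    by (intro sum.cong refl sum.swap)
  also have "\<dots> = (\<Sum>m\<in>?I. \<Sum>i<?d. \<Sum>i'<?d. (z m + (z m)\<^sup>2) *
      ((column \<nu> ks m $ i * t $ i) * (column \<nu> ks m $ i' * t $ i')))"
    by (rule sum.swap)
  also have "\<dots> = (\<Sum>m\<in>?I. (z m + (z m)\<^sup>2) *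
      ((\<Sum>i<?d. column \<nu> ks m $ i * t $ i) * (\<Sum>i'<?d. column \<nu> ks m $ i' * t $ i')))"
    by (intro sum.cong refl, subst sum_product) (simp add: sum_distrib_left)
  also have "\<dots> = (\<Sum>m\<in>?I. (z m + (z m)\<^sup>2) * (column \<nu> ks m \<bullet> t)\<^sup>2)"
    using t by (simp add: scalar_prod_def lessThan_atLeast0 power2_eq_square)
  finally show "gauss_form \<nu> ks z t = 1 / 2 * (t \<bullet> (?B *\<^sub>v t))"
    by (simp add: gauss_form_def)
qed simp

end

theory Submission
  imports
    Defs
    "Jordan_Normal_Form.Jordan_Normal_Form_Existence"
    "Jordan_Normal_Form.Jordan_Normal_Form_Uniqueness"
    "HOL-Probability.Distributions"
    "HOL-Real_Asymp.Real_Asymp"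
begin

text \<open>Let \<open>X\<^sub>m\<close> be independent geometric variables with means \<open>\<zeta>\<^sub>m\<close>. Stationarity of the entropy at \<open>z\<close>
  makes \<open>P(X = x) = e\<^bsup>-g(z)\<^esup>\<close> for every integer point \<open>x\<close>, so the number of integer points is
  \<open>e\<^bsup>g(z)\<^esup> P(A X = b)\<close>, and Fourier inversion writes this probability as an integral over a torus of
  the product of the factors \<open>e\<^bsup>-i\<zeta>\<lambda>\<^esup> / (1 + \<zeta> - \<zeta> e\<^bsup>i\<lambda>\<^esup>)\<close> with \<open>\<lambda> = \<langle>a\<^sub>m, t\<rangle>\<close>.

  Everything rests on one inequality. Since \<open>\<lambda>\<^sub>m\<close> is a sum of one term per direction,
  \<open>\<lambda>\<^sub>m\<^sup>2 \<le> L (\<Sum>p. \<lambda>\<^sub>p\<^sup>2)\<close> with \<open>L\<close> of order \<open>k\<^bsup>1-\<nu>\<^esup>\<close>, and likewise for \<open>sin\<^sup>2(\<lambda>\<^sub>m / 2)\<close>. Thus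
  under the Gaussian density \<open>e\<^bsup>-q\<^esup>\<close> each \<open>\<lambda>\<^sub>m\<close> has variance of order \<open>k\<^bsup>1-\<nu>\<^esup>\<close>. Where all \<open>\<lambda>\<^sub>m\<close> are of
  the order of \<open>\<surd>(k\<^bsup>1-\<nu>\<^esup> ln k)\<close>, a Taylor expansion compares the real part of the integrand with
  \<open>e\<^bsup>-q\<^esup>\<close>: the cubic term has variance \<open>O(k\<^bsup>2-\<nu>\<^esup>)\<close>, and the quartic one is \<open>O(k\<^bsup>2-\<nu>\<^esup> ln\<^sup>2 k)\<close>. Up to the
  order of \<open>\<surd>(k\<^bsup>2-\<nu>\<^esup> ln k)\<close> the integrand is dominated by a slightly wider Gaussian, and Chernoff's
  bound applies. Beyond that the inequality for \<open>sin\<^sup>2\<close> makes it smaller than any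
  \<open>e\<^bsup>-C k ln k\<^esup>\<close>, while the Gaussian integral is at least \<open>e\<^bsup>-O(k ln k)\<^esup>\<close>.\<close>


section \<open>Symmetric matrices\<close>

text \<open>The margin equations have \<open>\<nu> - 1\<close> dependencies, so \<open>q\<close> is
  degenerate on the full space; it is definite on \<open>slice_space\<close>, and the torus carries
  just the coordinates in \<open>rows\<close>. The value \<open>det_restrict\<close> counts
  eigenvalues geometrically, whereas a Gaussian integral produces a determinant; a matrix padded by
  the identity joins the two.

  The exponent 5/2 rules out a termwise bound of the cubic phase. There are about k^\<nu> terms
  \<lambda>^3, each \<lambda> having variance of order k^(1-\<nu>), and the triangle inequality
  bounds the square of their sum only by k^(3-\<nu>). The exact covariances, whose matrix has
  bounded norm, give k^(2-\<nu>).

  The total error is O(k^(2-\<nu>) ln^2 k), and the spare factor sqrt k absorbs the logarithms and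
  every constant. Hence for large k any positive constant may be prescribed, in particular the
  explicit one. For the remaining, bounded k it suffices to compare the volume of the torus with a
  lower bound of the Gaussian integral.\<close>

lemma char_poly_symmetric_real_splits:
  fixes A :: "real mat"
  assumes A: "A \<in> carrier_mat n n" and sym: "transpose_mat A = A"
  shows "\<exists>as. char_poly A = (\<Prod>a\<leftarrow>as. [:- a, 1:])"
proof -
  let ?C = "map_mat complex_of_real A"
  interpret of_real: inj_comm_ring_hom complex_of_real ..
  interpret polyhom: map_poly_inj_comm_ring_hom complex_of_real ..
  have C: "?C \<in> carrier_mat n n" using A by auto
  obtain as where as: "char_poly ?C = (\<Prod>a\<leftarrow>as. [:- a, 1:])"
    using char_poly_factorized[OF C] by blast
  have real: "Im a = 0" if "a \<in> set as" for a
  proof -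
    have "poly (char_poly ?C) a = 0"
      unfolding as poly_prod_list using that by (force simp: prod_list_zero_iff)
    then have "eigenvalue ?C a" using eigenvalue_root_char_poly[OF C] by simp
    then obtain v where v: "v \<in> carrier_vec n" "v \<noteq> 0\<^sub>v n" "?C *\<^sub>v v = a \<cdot>\<^sub>v v"
      unfolding eigenvalue_def eigenvector_def using C by auto
    have conjC: "(?C *\<^sub>v conjugate v) = conjugate (?C *\<^sub>v v)"
      using A v(1) by (intro eq_vecI) (auto simp: scalar_prod_def)
    have swap: "(?C *\<^sub>v v) \<bullet> w = v \<bullet> (?C *\<^sub>v w)" if "w \<in> carrier_vec n" for w
      using transpose_vec_mult_scalar[OF C that v(1)] sym
      by (metis C comm_scalar_prod map_mat_transpose mult_mat_vec_carrier that v(1))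
    \<comment> \<open>The matrix is symmetric and real, so it can be moved onto
      \<open>conjugate v\<close>, where it produces \<open>cnj a\<close>. The product of
      \<open>v\<close> with its conjugate is nonzero, hence \<open>a = cnj a\<close>.\<close>
    have "a * (v \<bullet> conjugate v) = (?C *\<^sub>v v) \<bullet> conjugate v"
      using v by simp
    also have "\<dots> = v \<bullet> (?C *\<^sub>v conjugate v)" using v by (intro swap) auto
    also have "\<dots> = v \<bullet> conjugate (a \<cdot>\<^sub>v v)" unfolding conjC v(3) ..
    also have "\<dots> = cnj a * (v \<bullet> conjugate v)"
      using v by (simp add: conjugate_smult_vec)
    finally have "a = cnj a" using v by (simp add: conjugate_square_eq_0_vec)
    then show ?thesis by (metis Reals_cnj_iff complex_is_Real_iff)
  qed
  have "char_poly ?C = map_poly complex_of_real (char_poly A)"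
    by (rule of_real_hom.char_poly_hom[OF A])
  then have "map_poly complex_of_real (char_poly A) = (\<Prod>a\<leftarrow>as. [:- a, 1:])"
    using as by simp
  also have "\<dots> = map_poly complex_of_real (\<Prod>a\<leftarrow>map Re as. [:- a, 1:])"
  proof -
    have "map (\<lambda>a. [:- a, 1:]) as = map (\<lambda>a. [:- complex_of_real (Re a), 1:]) as"
      using real by (intro map_cong) (auto simp: complex_eq_iff)
    then have "(\<Prod>a\<leftarrow>as. [:- a, 1:]) = (\<Prod>a\<leftarrow>as. [:- complex_of_real (Re a), 1:])"
      by (simp only:)
    also have "\<dots> = map_poly complex_of_real (\<Prod>a\<leftarrow>map Re as. [:- a, 1:])"
      by (simp add: polyhom.hom_prod_list o_def)
    finally show ?thesis .
  qed
  finally show ?thesis by (intro exI[of _ "map Re as"]) simp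
qed

lemma prod_list_eq_prod_count:
  fixes xs :: "'a :: comm_monoid_mult list"
  assumes "finite S" "set xs \<subseteq> S"
  shows "prod_list xs = (\<Prod>x\<in>S. x ^ count_list xs x)"
  using assms(2)
proof (induction xs)
  case (Cons a xs)
  have "(\<Prod>x\<in>S. x ^ count_list (a # xs) x) = (\<Prod>x\<in>S. (if x = a then a else 1) * x ^ count_list xs x)"
    by (intro prod.cong) auto
  also have "\<dots> = a * (\<Prod>x\<in>S. x ^ count_list xs x)"
    using Cons.prems assms(1) by (simp add: prod.distrib)
  finally show ?case using Cons by simp
qed simp

text \<open>The determinant counts algebraic multiplicities, \<open>kernel_dim\<close> geometric
  ones. For a symmetric matrix the kernel of \<open>char_matrix A l\<close> does not grow under
  squaring, so every Jordan block has size 1 and the two counts agree.\<close>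

lemma det_symmetric_eq_prod_eigenvalues:
  fixes A :: "real mat"
  assumes A: "A \<in> carrier_mat n n" and sym: "transpose_mat A = A"
  shows "finite {l. eigenvalue A l}"
    and "Determinant.det A = (\<Prod>l | eigenvalue A l. l ^ kernel_dim (char_matrix A l))"
proof -
  obtain as where as: "char_poly A = (\<Prod>a\<leftarrow>as. [:- a, 1:])"
    using char_poly_symmetric_real_splits[OF A sym] by blast
  obtain na where jnf: "jordan_nf A na" using jordan_nf_exists[OF A as] by blast
  have cp: "char_poly A = (\<Prod>(n,a)\<leftarrow>na. [:- a, 1:] ^ n)" by (rule jordan_nf_char_poly[OF jnf])
  \<comment> \<open>For symmetric C, |C v|^2 = <C (C v), v>, so C (C v) = 0 forces C v = 0.\<close>
  have ker2: "mat_kernel (char_matrix A l ^\<^sub>m 2) = mat_kernel (char_matrix A l)" for l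
  proof -
    let ?C = "char_matrix A l"
    have C: "?C \<in> carrier_mat n n" using A by simp
    have symC: "transpose_mat ?C = ?C"
    proof (rule eq_matI)
      fix i j assume "i < dim_row ?C" "j < dim_col ?C"
      then have ij: "i < n" "j < n" using C by auto
      have "A $$ (j, i) = A $$ (i, j)"
        using A ij sym by (metis carrier_matD index_transpose_mat(1))
      then show "transpose_mat ?C $$ (i, j) = ?C $$ (i, j)"
        using A ij by (auto simp: char_matrix_def)
    qed (use C in auto)
    have sq: "?C ^\<^sub>m 2 = ?C * ?C" using C by (simp add: numeral_2_eq_2)
    show ?thesis
    proof (intro equalityI subsetI)
      fix v assume "v \<in> mat_kernel (?C ^\<^sub>m 2)"
      then have v: "v \<in> carrier_vec n" "?C *\<^sub>v (?C *\<^sub>v v) = 0\<^sub>v n"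
        using C by (auto simp: mat_kernel_def sq)
      have "(?C *\<^sub>v v) \<bullet> (?C *\<^sub>v v) = (transpose_mat ?C *\<^sub>v (?C *\<^sub>v v)) \<bullet> v"
        by (rule transpose_vec_mult_scalar[symmetric]) (use C v in auto)
      also have "\<dots> = 0" using v by (simp add: symC)
      finally have "?C *\<^sub>v v = 0\<^sub>v n"
        using conjugate_square_eq_0_vec[of "?C *\<^sub>v v" n] C v by simp
      then show "v \<in> mat_kernel ?C" using C v by (auto simp: mat_kernel_def)
    next
      fix v assume "v \<in> mat_kernel ?C"
      then show "v \<in> mat_kernel (?C ^\<^sub>m 2)"
        using C by (auto simp: mat_kernel_def sq)
    qed
  qed
  have dims: "dim_gen_eigenspace A l 1 = kernel_dim (char_matrix A l)" 
    "dim_gen_eigenspace A l 2 = kernel_dim (char_matrix A l)" for l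
  proof -
    have C: "char_matrix A l \<in> carrier_mat n n" using A by simp
    then have "char_matrix A l ^\<^sub>m 1 = char_matrix A l" by simp
    then show "dim_gen_eigenspace A l 1 = kernel_dim (char_matrix A l)"
      unfolding dim_gen_eigenspace_def by simp
    have "dim_col (char_matrix A l ^\<^sub>m 2) = dim_col (char_matrix A l)"
      using C by (metis carrier_matD(2) pow_carrier_mat)
    then show "dim_gen_eigenspace A l 2 = kernel_dim (char_matrix A l)"
      unfolding dim_gen_eigenspace_def kernel_dim_def ker2 by simp
  qed
  \<comment> \<open>A block of size at least 2 would make the second generalized eigenspace strictly
    larger than the first.\<close>
  have one: "n = 1" if mem: "(n, a) \<in> set na" for n a
  proof (rule ccontr)
    assume "n \<noteq> 1"
    moreover have "n \<noteq> 0" using jnf that unfolding jordan_nf_def by force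
    ultimately have n: "n \<ge> 2" by simp
    have le: "(\<Sum>n\<leftarrow>map fst [(n, e)\<leftarrow>xs. e = a]. min 1 n) \<le> (\<Sum>n\<leftarrow>map fst [(n, e)\<leftarrow>xs. e = a]. min 2 n)" for xs :: "(nat \<times> real) list"
      by (induction xs) auto
    obtain xs ys where na: "na = xs @ (n, a) # ys" using split_list[OF mem] by blast
    have "dim_gen_eigenspace A a 1 < dim_gen_eigenspace A a 2"
      unfolding dim_gen_eigenspace[OF jnf] na using le[of xs] le[of ys] n by simp
    then show False using dims[of a] by simp
  qed
  have na_map: "na = map (\<lambda>a. (1, a)) (map snd na)"
    using one by (induction na) auto
  define bs where "bs = map snd na"
  have cpb: "char_poly A = (\<Prod>a\<leftarrow>bs. [:- a, 1:])"
    unfolding cp bs_def by (subst na_map) (simp add: o_def)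
  have kd: "kernel_dim (char_matrix A l) = count_list bs l" for l
  proof -
    have "(\<Sum>n\<leftarrow>map fst [(n, e)\<leftarrow>map (\<lambda>a. (1, a)) bs. e = l]. min 1 n) = count_list bs l"
      by (induction bs) auto
    then show ?thesis
      unfolding dims(1)[symmetric] dim_gen_eigenspace[OF jnf] by (subst na_map, fold bs_def)
  qed
  have ev: "eigenvalue A l \<longleftrightarrow> l \<in> set bs" for l
    unfolding eigenvalue_root_char_poly[OF A] cpb poly_prod_list
    by (force simp: prod_list_zero_iff)
  then show "finite {l. eigenvalue A l}" by simp
  have len: "length bs = n"
  proof -
    have "degree (char_poly A) = length bs" unfolding cpb
    proof (induction bs)
      case (Cons a bs)
      have "(\<Prod>a\<leftarrow>bs. [:- a, 1:]) \<noteq> 0" by (auto simp: prod_list_zero_iff)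
      then show ?case using Cons by (simp add: degree_mult_eq del: mult_pCons_left)
    qed simp
    then show ?thesis using degree_monic_char_poly[OF A] by simp
  qed
  \<comment> \<open>The characteristic polynomial at 0 is det (- A); the resulting sign (-1)^n
    cancels against the values - a of its linear factors.\<close>
  have "Determinant.det A = Determinant.det (- (- A))" using A by simp
  also have "\<dots> = (-1) ^ n * Determinant.det (- A)"
  proof -
    have "- (- A) = (-1) \<cdot>\<^sub>m (- A)" using A by (intro eq_matI) auto
    then show ?thesis using A det_smult[of "-1::real" "- A"] by simp
  qed
  also have "Determinant.det (- A) = poly (char_poly A) 0"
  proof -
    have "char_matrix A 0 = A" using A by (intro eq_matI) (auto simp: char_matrix_def)
    then show ?thesis using char_poly_matrix[OF A, of 0] by simp
  qed
  also have "(-1) ^ n * poly (char_poly A) 0 = prod_list bs"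
    unfolding cpb len[symmetric] by (induction bs) auto
  also have "\<dots> = (\<Prod>l\<in>set bs. l ^ count_list bs l)"
    by (rule prod_list_eq_prod_count) auto
  finally show "Determinant.det A = (\<Prod>l | eigenvalue A l. l ^ kernel_dim (char_matrix A l))"
    by (simp add: kd ev)
qed


text \<open>Replacing the zero diagonal entries outside \<open>I\<close> by 1 only enlarges the eigenspace of the
  eigenvalue 1, which does not change the product.\<close>

lemma det_restrict_coordinates:
  fixes B :: "nat \<Rightarrow> nat \<Rightarrow> real" and I :: "nat set" and d :: nat
  assumes sym: "\<And>i j. B i j = B j i"
  defines "L \<equiv> {t \<in> carrier_vec d. \<forall>i<d. i \<notin> I \<longrightarrow> t $ i = 0}"
  defines "M \<equiv> Matrix.mat d d (\<lambda>(i, j). if i \<in> I \<and> j \<in> I then B i j else 0)"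
  shows "(\<Prod>l\<in>{l. \<exists>v\<in>L. eigenvector M v l}.
           l ^ vectorspace.dim class_ring
                 ((module_vec TYPE(real) d)\<lparr>carrier := {v \<in> L. M *\<^sub>v v = l \<cdot>\<^sub>v v}\<rparr>))
    = Determinant.det (Matrix.mat d d (\<lambda>(i, j). if i \<in> I \<and> j \<in> I then B i j else if i = j then 1 else 0))"
    (is "prod ?f ?E = Determinant.det ?M'")
proof -
  define N where "N = ?M'"
  have N: "N \<in> carrier_mat d d" and M: "M \<in> carrier_mat d d" by (auto simp: M_def N_def)
  have symN: "transpose_mat N = N" unfolding N_def by (rule eq_matI) (auto simp: sym)
  have Nv: "(N *\<^sub>v v) $ i = (if i \<in> I then (M *\<^sub>v v) $ i else v $ i)"
    if "v \<in> L" "i < d" for v i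
  proof (cases "i \<in> I")
    case True
    have "(\<Sum>j = 0..<d. (if j \<in> I then B i j else if i = j then 1 else 0) * v $ j)
        = (\<Sum>j = 0..<d. (if j \<in> I then B i j else 0) * v $ j)"
      using that True by (intro sum.cong) (auto simp: L_def)
    then show ?thesis using that True by (auto simp: scalar_prod_def M_def N_def L_def)
  next
    case False
    then have "(N *\<^sub>v v) $ i = (\<Sum>j = 0..<d. (if i = j then 1 else 0) * v $ j)"
      using that by (auto simp: scalar_prod_def N_def L_def intro!: sum.cong)
    also have "\<dots> = (\<Sum>j = 0..<d. if i = j then v $ j else 0)" by (intro sum.cong) auto
    finally show ?thesis using that False by simp
  qed
  have Noff: "(N *\<^sub>v v) $ i = v $ i" if "v \<in> carrier_vec d" "i < d" "i \<notin> I" for v i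
  proof -
    have "(N *\<^sub>v v) $ i = (\<Sum>j = 0..<d. (if i = j then 1 else 0) * v $ j)"
      using that by (auto simp: scalar_prod_def N_def intro!: sum.cong)
    also have "\<dots> = (\<Sum>j = 0..<d. if i = j then v $ j else 0)" by (intro sum.cong) auto
    finally show ?thesis using that by simp
  qed
  have Moff: "(M *\<^sub>v v) $ i = 0" if "v \<in> carrier_vec d" "i < d" "i \<notin> I" for v i
    using that by (auto simp: scalar_prod_def M_def intro!: sum.neutral)
  have NM: "N *\<^sub>v v = M *\<^sub>v v" if "v \<in> L" for v
  proof (rule eq_vecI)
    fix i assume "i < dim_vec (M *\<^sub>v v)"
    then have "i < d" using M by simp
    then show "(N *\<^sub>v v) $ i = (M *\<^sub>v v) $ i"
      using Nv[OF that] Moff[of v i] that by (auto simp: L_def)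
  qed (use N M in auto)
  have sub: "v \<in> L" if "v \<in> carrier_vec d" "N *\<^sub>v v = l \<cdot>\<^sub>v v" "l \<noteq> 1" for v l
  proof -
    have "v $ i = 0" if "i < d" "i \<notin> I" for i
    proof -
      have "v $ i = l * v $ i"
        using Noff[OF \<open>v \<in> carrier_vec d\<close> that] \<open>N *\<^sub>v v = l \<cdot>\<^sub>v v\<close> \<open>v \<in> carrier_vec d\<close> that
        by (metis carrier_vecD index_smult_vec(1))
      then show ?thesis using \<open>l \<noteq> 1\<close> by simp
    qed
    then show ?thesis using that by (auto simp: L_def)
  qed
  have ker: "mat_kernel (char_matrix N l) = {v \<in> carrier_vec d. N *\<^sub>v v = l \<cdot>\<^sub>v v}" for l
  proof -
    have "char_matrix N l *\<^sub>v v = 0\<^sub>v d \<longleftrightarrow> N *\<^sub>v v = l \<cdot>\<^sub>v v" if v: "v \<in> carrier_vec d" for v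
    proof -
      have "char_matrix N l *\<^sub>v v = N *\<^sub>v v - l \<cdot>\<^sub>v v"
        using v N by (auto simp: char_matrix_def add_mult_distrib_mat_vec[of _ d d] intro!: eq_vecI)
      moreover have "N *\<^sub>v v \<in> carrier_vec d" "l \<cdot>\<^sub>v v \<in> carrier_vec d"
        using mult_mat_vec_carrier[OF N v] v by auto
      moreover have "x - y = 0\<^sub>v d \<longleftrightarrow> x = y"
        if "x \<in> carrier_vec d" "y \<in> carrier_vec d" for x y :: "real Matrix.vec"
        using that by (auto simp: Matrix.vec_eq_iff)
      ultimately show ?thesis by simp
    qed
    then show ?thesis using mat_kernel[OF char_matrix_closed[OF N]] by auto
  qed
  have eig: "v \<in> L \<and> M *\<^sub>v v = l \<cdot>\<^sub>v v \<longleftrightarrow> v \<in> carrier_vec d \<and> N *\<^sub>v v = l \<cdot>\<^sub>v v"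
    if "l \<noteq> 1" for l v
  proof -
    have "v \<in> carrier_vec d" if "v \<in> L" using that by (simp add: L_def)
    then show ?thesis using NM[of v] sub[OF _ _ \<open>l \<noteq> 1\<close>] by metis
  qed
  have ker': "{v \<in> L. M *\<^sub>v v = l \<cdot>\<^sub>v v} = mat_kernel (char_matrix N l)" if "l \<noteq> 1" for l
    unfolding ker using eig[OF that] by simp
  have ev: "l \<in> ?E \<longleftrightarrow> eigenvalue N l" if "l \<noteq> 1" for l
    using eig[OF that] M N unfolding eigenvalue_def eigenvector_def by auto
  have fin: "finite {l. eigenvalue N l}" by (rule det_symmetric_eq_prod_eigenvalues(1)[OF N symN])
  have "?E \<subseteq> insert 1 {l. eigenvalue N l}" using ev by blast
  then have finE: "finite ?E" using fin finite_subset by blast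
  \<comment> \<open>The two index sets differ at most in l = 1, whose powers are 1 whatever the
    exponent.\<close>
  have "prod ?f ?E = (\<Prod>l | eigenvalue N l. l ^ kernel_dim (char_matrix N l))"
  proof (rule prod.mono_neutral_cong[OF fin finE])
    show "l ^ kernel_dim (char_matrix N l) = 1" if "l \<in> {l. eigenvalue N l} - ?E" for l
      using that ev[of l] by (cases "l = 1") auto
    show "?f l = 1" if "l \<in> ?E - {l. eigenvalue N l}" for l
      using that ev[of l] by (cases "l = 1") auto
    show "?f l = l ^ kernel_dim (char_matrix N l)" if "l \<in> ?E \<inter> {l. eigenvalue N l}" for l
      using ker'[of l] by (cases "l = 1") (use N in \<open>auto simp: kernel_dim_def char_matrix_def\<close>)
  qed
  then show ?thesis using det_symmetric_eq_prod_eigenvalues(2)[OF N symN] by (simp add: N_def)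
qed

section \<open>Block elimination and linear systems\<close>

lemma det_schur_complement:
  fixes B :: "nat \<Rightarrow> nat \<Rightarrow> real"
  assumes "B d d \<noteq> 0"
  shows "Determinant.det (Matrix.mat (Suc d) (Suc d) (\<lambda>(i, j). B i j))
    = B d d * Determinant.det (Matrix.mat d d (\<lambda>(i, j). B i j - B i d * B d j / B d d))"
proof -
  let ?A = "Matrix.mat (Suc d) (Suc d) (\<lambda>(i, j). B i j)"
  let ?A1 = "Matrix.mat d d (\<lambda>(i, j). B i j)" and ?A2 = "Matrix.mat d 1 (\<lambda>(i, j). B i d)"
    and ?A3 = "Matrix.mat 1 d (\<lambda>(i, j). B d j)" and ?A4 = "Matrix.mat 1 1 (\<lambda>(i, j). B d d)"
  \<comment> \<open>Right multiplication by the unipotent matrix \<open>?E\<close> clears the last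
    row to the left of the pivot. The Schur complement it leaves is also the quadratic form that
    remains when the last variable of a Gaussian is integrated out.\<close>
  let ?E3 = "Matrix.mat 1 d (\<lambda>(i, j). - B d j / B d d)"
  let ?E = "four_block_mat (1\<^sub>m d) (0\<^sub>m d 1) ?E3 (1\<^sub>m 1)"
  let ?S = "Matrix.mat d d (\<lambda>(i, j). B i j - B i d * B d j / B d d)"
  have A: "?A = four_block_mat ?A1 ?A2 ?A3 ?A4"
    by (rule eq_matI) (auto simp: less_Suc_eq)
  have "?A * ?E = four_block_mat (?A1 * 1\<^sub>m d + ?A2 * ?E3) (?A1 * 0\<^sub>m d 1 + ?A2 * 1\<^sub>m 1)
      (?A3 * 1\<^sub>m d + ?A4 * ?E3) (?A3 * 0\<^sub>m d 1 + ?A4 * 1\<^sub>m 1)"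
    unfolding A by (rule mult_four_block_mat) auto
  also have "?A1 * 1\<^sub>m d + ?A2 * ?E3 = ?S"
    by (rule eq_matI) (auto simp: scalar_prod_def)
  also have "?A3 * 1\<^sub>m d + ?A4 * ?E3 = 0\<^sub>m 1 d"
    using assms by (intro eq_matI) (auto simp: scalar_prod_def)
  finally have AE: "?A * ?E = four_block_mat ?S (?A1 * 0\<^sub>m d 1 + ?A2 * 1\<^sub>m 1) (0\<^sub>m 1 d)
      (?A3 * 0\<^sub>m d 1 + ?A4 * 1\<^sub>m 1)" .
  have A4: "?A3 * 0\<^sub>m d 1 + ?A4 * 1\<^sub>m 1 = ?A4" by (rule eq_matI) auto
  have "Determinant.det ?E = 1"
    by (subst det_four_block_mat_upper_right_zero[where n = d and m = 1]) auto
  moreover have "Determinant.det (?A * ?E) = Determinant.det ?A * Determinant.det ?E"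
    by (rule det_mult[of _ "Suc d"]) (auto simp: four_block_mat_def Let_def)
  moreover have "Determinant.det (?A * ?E) = Determinant.det ?S * Determinant.det ?A4"
    unfolding AE A4 by (rule det_four_block_mat_lower_left_zero) auto
  moreover have "Determinant.det ?A4 = B d d" by (simp add: det_single)
  ultimately show ?thesis by simp
qed

text \<open>Supplies the vectors that represent the forms \<lambda>_m in the inner product of
  \<open>q\<close>.\<close>

lemma det_nonzero_solve:
  fixes B :: "nat \<Rightarrow> nat \<Rightarrow> real"
  assumes "Determinant.det (Matrix.mat d d (\<lambda>(i, j). B i j)) \<noteq> 0"
  shows "\<exists>c. \<forall>i<d. (\<Sum>j<d. B i j * c j) = b i"
proof -
  let ?A = "Matrix.mat d d (\<lambda>(i, j). B i j)"
  obtain C where C: "C \<in> carrier_mat d d" "?A * C = 1\<^sub>m d"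
    using det_non_zero_imp_unit[OF _ assms, of d "()"] unfolding Units_def ring_mat_def by auto
  let ?v = "C *\<^sub>v Matrix.vec d b"
  have "?A *\<^sub>v ?v = (?A * C) *\<^sub>v Matrix.vec d b"
    by (rule assoc_mult_mat_vec[symmetric]) (use C in auto)
  then have Av: "?A *\<^sub>v ?v = Matrix.vec d b" using C by simp
  have "(\<Sum>j<d. B i j * ?v $ j) = b i" if "i < d" for i
  proof -
    have "(\<Sum>j<d. B i j * ?v $ j) = (?A *\<^sub>v ?v) $ i"
      using that C by (auto simp: scalar_prod_def lessThan_atLeast0 intro!: sum.cong)
    then show ?thesis using Av that by simp
  qed
  then show ?thesis by (intro exI[of _ "\<lambda>j. ?v $ j"]) auto
qed

section \<open>Gaussian integrals\<close>

abbreviation LB :: "'i set \<Rightarrow> ('i \<Rightarrow> real) measure" where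
  "LB I \<equiv> PiM I (\<lambda>_. lborel)"

interpretation lborel_prod: product_sigma_finite "\<lambda>_ :: 'i. lborel :: real measure"
  by standard

text \<open>A translation combined with a common dilation acts coordinate by coordinate, so the
  one-dimensional substitution rule and Fubini suffice. It is used to complete squares in several
  variables at once.\<close>

lemma nn_integral_LB_affine:
  fixes f :: "('i \<Rightarrow> real) \<Rightarrow> ennreal"
  assumes "finite I" "s \<noteq> 0" "f \<in> borel_measurable (LB I)"
  shows "(\<integral>\<^sup>+t. f t \<partial>LB I) = ennreal (\<bar>s\<bar> ^ card I) * (\<integral>\<^sup>+t. f (\<lambda>i\<in>I. b i + s * t i) \<partial>LB I)"
  using assms(1,3)
proof (induction I arbitrary: f rule: finite_induct)
  case empty
  then show ?case by (simp add: PiM_empty nn_integral_count_space_finite restrict_def)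
next
  case (insert i I)
  note [measurable] = insert.prems
  let ?g = "\<lambda>x. \<integral>\<^sup>+y. f (x(i := b i + s * y)) \<partial>lborel"
  have upd: "(\<lambda>(x, y). x(i := b i + s * y)) \<in> measurable (LB I \<Otimes>\<^sub>M lborel) (LB (insert i I))"
    unfolding split_def by (rule measurable_fun_upd[where J = I]) (auto intro: measurable_fst)
  have "(\<lambda>(x, y). f (x(i := b i + s * y))) \<in> borel_measurable (LB I \<Otimes>\<^sub>M lborel)"
    using measurable_compose[OF upd insert.prems] by (simp add: split_def)
  then have g[measurable]: "?g \<in> borel_measurable (LB I)"
    by (rule lborel.borel_measurable_nn_integral)
  have f1: "(\<lambda>y. f (x(i := y))) \<in> borel_measurable borel" if "x \<in> space (LB I)" for x
  proof -
    have "(\<lambda>y. x(i := y)) \<in> measurable borel (LB (insert i I))"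
      by (rule measurable_fun_upd[where J = I]) (use that in auto)
    then show ?thesis using insert.prems by (rule measurable_compose)
  qed
  have fr: "(\<lambda>t. f (\<lambda>j\<in>insert i I. b j + s * t j)) \<in> borel_measurable (LB (insert i I))"
  proof -
    have "(\<lambda>t. \<lambda>j\<in>insert i I. b j + s * t j) \<in> measurable (LB (insert i I)) (LB (insert i I))"
      by (rule measurable_restrict) measurable
    then show ?thesis using insert.prems by (rule measurable_compose)
  qed
  have eq: "(\<lambda>j\<in>insert i I. b j + s * (x(i := y)) j) = (\<lambda>j\<in>I. b j + s * x j)(i := b i + s * y)" for x y
    using insert.hyps by (auto simp: fun_eq_iff)
  have "(\<integral>\<^sup>+t. f t \<partial>LB (insert i I)) = (\<integral>\<^sup>+x. (\<integral>\<^sup>+y. f (x(i := y)) \<partial>lborel) \<partial>LB I)"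
    by (rule lborel_prod.product_nn_integral_insert) (use insert in auto)
  also have "\<dots> = (\<integral>\<^sup>+x. ennreal \<bar>s\<bar> * ?g x \<partial>LB I)"
    using f1 assms(2) by (intro nn_integral_cong nn_integral_real_affine) auto
  also have "\<dots> = ennreal \<bar>s\<bar> * (\<integral>\<^sup>+x. ?g x \<partial>LB I)"
    by (rule nn_integral_cmult) measurable
  also have "(\<integral>\<^sup>+x. ?g x \<partial>LB I) = ennreal (\<bar>s\<bar> ^ card I) * (\<integral>\<^sup>+x. ?g (\<lambda>j\<in>I. b j + s * x j) \<partial>LB I)"
    by (rule insert.IH[OF g])
  also have "(\<integral>\<^sup>+x. ?g (\<lambda>j\<in>I. b j + s * x j) \<partial>LB I)
      = (\<integral>\<^sup>+t. f (\<lambda>j\<in>insert i I. b j + s * t j) \<partial>LB (insert i I))"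
    by (subst lborel_prod.product_nn_integral_insert[OF insert.hyps(1,2) fr]) (simp only: eq)
  finally show ?case
    using insert.hyps by (simp only: ennreal_mult mult.assoc card_insert_disjoint power_Suc abs_ge_zero zero_le_power simp_thms)
qed

text \<open>Completing the square in one variable; the exponent has the shape of the terms of
  \<open>qform_Suc\<close> that contain the last coordinate.\<close>

lemma nn_integral_gaussian:
  assumes "\<beta> > 0"
  shows "(\<integral>\<^sup>+y. ennreal (exp (- (\<beta> * y\<^sup>2 + 2 * L * y) / 2)) \<partial>lborel)
    = ennreal (sqrt (2 * pi / \<beta>) * exp (L\<^sup>2 / (2 * \<beta>)))"
proof -
  let ?C = "sqrt (2 * pi / \<beta>) * exp (L\<^sup>2 / (2 * \<beta>))"
  let ?n = "normal_density (- L / \<beta>) (1 / sqrt \<beta>)"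
  have eq: "exp (- (\<beta> * y\<^sup>2 + 2 * L * y) / 2) = ?C * ?n y" for y
  proof -
    define A where "A = L\<^sup>2 / (2 * \<beta>)"
    define E where "E = - ((y - - L / \<beta>)\<^sup>2) / (2 * (1 / \<beta>))"
    have sq: "(1 / sqrt \<beta>)\<^sup>2 = 1 / \<beta>" using assms by (simp add: power_divide)
    have E: "E = - (\<beta> * y\<^sup>2 + 2 * L * y) / 2 - A"
      unfolding A_def E_def using assms by (simp add: field_simps power2_eq_square)
    have "?C * ?n y = (sqrt (2 * pi / \<beta>) * (1 / sqrt (2 * pi * (1 / \<beta>)))) * exp (A + E)"
      unfolding normal_density_def sq A_def[symmetric] E_def[symmetric] exp_add by (simp only: mult_ac)
    also have "sqrt (2 * pi / \<beta>) * (1 / sqrt (2 * pi * (1 / \<beta>))) = 1"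
      using assms by simp
    finally show ?thesis by (simp add: E)
  qed
  have "(\<integral>\<^sup>+y. ennreal (exp (- (\<beta> * y\<^sup>2 + 2 * L * y) / 2)) \<partial>lborel) = (\<integral>\<^sup>+y. ennreal ?C * ennreal (?n y) \<partial>lborel)"
    unfolding eq using assms by (intro nn_integral_cong ennreal_mult) auto
  also have "\<dots> = ennreal ?C * (\<integral>\<^sup>+y. ennreal (?n y) \<partial>lborel)"
    by (rule nn_integral_cmult) measurable
  also have "(\<integral>\<^sup>+y. ennreal (?n y) \<partial>lborel) = 1"
    using assms by (subst nn_integral_eq_integral) auto
  finally show ?thesis by simp
qed

definition qform :: "nat \<Rightarrow> (nat \<Rightarrow> nat \<Rightarrow> real) \<Rightarrow> (nat \<Rightarrow> real) \<Rightarrow> real" where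
  "qform d B t = (\<Sum>i<d. \<Sum>j<d. B i j * t i * t j)"

lemma qform_cong: "(\<And>i. i < d \<Longrightarrow> s i = t i) \<Longrightarrow> qform d B s = qform d B t"
  unfolding qform_def by (intro sum.cong) auto

lemma qform_Suc:
  assumes "\<And>i j. B i j = B j i"
  shows "qform (Suc d) B t = qform d B t + 2 * (\<Sum>j<d. B d j * t j) * t d + B d d * (t d)\<^sup>2"
proof -
  have "(\<Sum>i<d. B i d * t i * t d) = (\<Sum>j<d. B d j * t j) * t d"
    using assms by (simp add: sum_distrib_right)
  moreover have "(\<Sum>j<d. B d j * t d * t j) = (\<Sum>j<d. B d j * t j) * t d"
    by (simp add: sum_distrib_left mult_ac)
  ultimately show ?thesis
    unfolding qform_def by (simp add: sum.distrib power2_eq_square)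
qed

lemma qform_schur:
  assumes "\<And>i j. B i j = B j i" "B d d \<noteq> 0"
  shows "qform d (\<lambda>i j. B i j - B i d * B d j / B d d) t = qform d B t - (\<Sum>j<d. B d j * t j)\<^sup>2 / B d d"
proof -
  have "(\<Sum>j<d. B d j * t j)\<^sup>2 / B d d = (\<Sum>i<d. \<Sum>j<d. (B i d * B d j / B d d) * t i * t j)"
    unfolding power2_eq_square sum_product sum_divide_distrib using assms
    by (intro sum.cong refl) (simp add: mult_ac)
  then show ?thesis
    unfolding qform_def by (simp add: left_diff_distrib sum_subtractf)
qed

lemma qform_measurable [measurable]:
  "qform d B \<in> borel_measurable (LB {..<d})"
  unfolding qform_def by measurable

text \<open>Integrating out the last coordinate leaves the form of the Schur complement and a factor
  \<open>sqrt (2 * pi / B d d)\<close>; \<open>det_schur_complement\<close> multiplies the pivots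
  accordingly. Positivity of the determinant is carried along so that the square roots stay
  meaningful.\<close>

lemma nn_integral_exp_qform:
  assumes sym: "\<And>i j. B i j = B j i"
    and pos: "\<And>t. \<exists>i<d. t i \<noteq> 0 \<Longrightarrow> qform d B t > 0"
  shows "Determinant.det (Matrix.mat d d (\<lambda>(i, j). B i j)) > 0 \<and>
    (\<integral>\<^sup>+t. ennreal (exp (- qform d B t / 2)) \<partial>LB {..<d})
      = ennreal (sqrt (2 * pi) ^ d / sqrt (Determinant.det (Matrix.mat d d (\<lambda>(i, j). B i j))))"
  using assms
proof (induction d arbitrary: B)
  case 0
  then show ?case
    by (simp add: PiM_empty nn_integral_count_space_finite qform_def)
next
  case (Suc d)
  note sym = Suc.prems(1)
  have Bdd: "B d d > 0"
  proof -
    have "qform (Suc d) B (\<lambda>i. if i = d then 1 else 0) > 0"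
      by (rule Suc.prems(2)) auto
    then show ?thesis using qform_cong[of d "\<lambda>i. if i = d then 1 else 0" "\<lambda>_. 0" B]
      by (simp add: qform_Suc[OF sym]) (simp add: qform_def)
  qed
  define S where "S i j = B i j - B i d * B d j / B d d" for i j
  define l where "l t = (\<Sum>j<d. B d j * t j)" for t
  have S: "qform d S t = qform d B t - (l t)\<^sup>2 / B d d" for t
    using qform_schur[where B = B and d = d and t = t, OF sym] Bdd unfolding S_def l_def by simp
  have posS: "qform d S t > 0" if "\<exists>i<d. t i \<noteq> 0" for t
  proof -
    \<comment> \<open>The last coordinate that minimises the full form; the minimum is the value of
      the Schur complement form, which is therefore positive.\<close>
    let ?t = "t(d := - l t / B d d)"
    have "qform (Suc d) B ?t > 0" using that by (intro Suc.prems(2)) auto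
    moreover have "qform (Suc d) B ?t = qform d B t - (l t)\<^sup>2 / B d d"
    proof -
      have "(\<Sum>j<d. B d j * ?t j) = l t" "qform d B ?t = qform d B t"
        by (auto simp: l_def intro!: sum.cong qform_cong)
      moreover have "2 * L * (- L / \<beta>) + \<beta> * (- L / \<beta>)\<^sup>2 = - (L\<^sup>2 / \<beta>)" if "\<beta> > 0" for L \<beta> :: real
        using that by (simp add: power2_eq_square)
      from this[OF Bdd, of "l t"] show ?thesis
        using calculation unfolding qform_Suc[OF sym] by simp
    qed
    ultimately show ?thesis by (simp add: S)
  qed
  let ?D = "Determinant.det (Matrix.mat d d (\<lambda>(i, j). S i j))"
  have "S i j = S j i" for i j unfolding S_def using sym[of i j] sym[of i d] sym[of j d] by simp
  from Suc.IH[OF this posS] have D: "?D > 0"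
    and IH: "(\<integral>\<^sup>+t. ennreal (exp (- qform d S t / 2)) \<partial>LB {..<d}) = ennreal (sqrt (2 * pi) ^ d / sqrt ?D)"
    by auto
  have det: "Determinant.det (Matrix.mat (Suc d) (Suc d) (\<lambda>(i, j). B i j)) = B d d * ?D"
    using det_schur_complement[of B d] Bdd by (simp add: S_def)
  have "(\<integral>\<^sup>+t. ennreal (exp (- qform (Suc d) B t / 2)) \<partial>LB {..<Suc d})
      = (\<integral>\<^sup>+x. (\<integral>\<^sup>+y. ennreal (exp (- qform (Suc d) B (x(d := y)) / 2)) \<partial>lborel) \<partial>LB {..<d})"
    unfolding lessThan_Suc
    by (rule lborel_prod.product_nn_integral_insert)
       (auto intro!: measurable_compose[OF qform_measurable[of "Suc d" B, unfolded lessThan_Suc]])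
  also have "\<dots> = (\<integral>\<^sup>+x. ennreal (exp (- qform d S x / 2)) * ennreal (sqrt (2 * pi / B d d)) \<partial>LB {..<d})"
  proof (rule nn_integral_cong)
    fix x
    have "qform (Suc d) B (x(d := y)) = qform d B x + (B d d * y\<^sup>2 + 2 * l x * y)" for y
      unfolding qform_Suc[OF sym] by (auto simp: l_def intro!: sum.cong qform_cong)
    then have "(\<integral>\<^sup>+y. ennreal (exp (- qform (Suc d) B (x(d := y)) / 2)) \<partial>lborel)
       = (\<integral>\<^sup>+y. ennreal (exp (- qform d B x / 2)) * ennreal (exp (- (B d d * y\<^sup>2 + 2 * l x * y) / 2)) \<partial>lborel)"
      by (intro nn_integral_cong) (simp add: ennreal_mult[symmetric] exp_add[symmetric] add_divide_distrib diff_divide_distrib)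
    also have "\<dots> = ennreal (exp (- qform d B x / 2)) * (\<integral>\<^sup>+y. ennreal (exp (- (B d d * y\<^sup>2 + 2 * l x * y) / 2)) \<partial>lborel)"
      by (rule nn_integral_cmult) measurable
    also have "\<dots> = ennreal (exp (- qform d B x / 2)) * ennreal (sqrt (2 * pi / B d d) * exp ((l x)\<^sup>2 / (2 * B d d)))"
      unfolding nn_integral_gaussian[OF Bdd] ..
    also have "\<dots> = ennreal (exp (- qform d S x / 2) * sqrt (2 * pi / B d d))"
    proof -
      have "- qform d S x / 2 = - qform d B x / 2 + (l x)\<^sup>2 / (2 * B d d)"
        by (simp add: S diff_divide_distrib)
      then have "exp (- qform d B x / 2) * (sqrt (2 * pi / B d d) * exp ((l x)\<^sup>2 / (2 * B d d)))
          = exp (- qform d S x / 2) * sqrt (2 * pi / B d d)"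
        by (simp only: exp_add mult_ac)
      then show ?thesis by (subst ennreal_mult[symmetric]) (use Bdd in auto)
    qed
    finally show "(\<integral>\<^sup>+y. ennreal (exp (- qform (Suc d) B (x(d := y)) / 2)) \<partial>lborel)
        = ennreal (exp (- qform d S x / 2)) * ennreal (sqrt (2 * pi / B d d))"
      using Bdd by (simp add: ennreal_mult)
  qed
  also have "\<dots> = ennreal (sqrt (2 * pi) ^ d / sqrt ?D) * ennreal (sqrt (2 * pi / B d d))"
    unfolding IH[symmetric] by (rule nn_integral_multc) measurable
  also have "\<dots> = ennreal (sqrt (2 * pi) ^ Suc d / sqrt (B d d * ?D))"
  proof -
    have "sqrt (2 * pi) ^ Suc d / sqrt (B d d * ?D) = sqrt (2 * pi) ^ d / sqrt ?D * sqrt (2 * pi / B d d)"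
      by (simp add: real_sqrt_mult real_sqrt_divide mult_ac)
    then show ?thesis by (subst ennreal_mult[symmetric]) (use Bdd D in auto)
  qed
  finally show ?case unfolding det using Bdd D by simp
qed

section \<open>Moments from the moment generating function\<close>

lemma power_series_unique_real:
  fixes a b :: "nat \<Rightarrow> real"
  assumes "\<And>x. (\<lambda>n. a n * x ^ n) sums f x" "\<And>x. (\<lambda>n. b n * x ^ n) sums f x"
  shows "a = b"
proof
  fix n
  show "a n = b n"
  proof (induction n rule: less_induct)
    case (less n)
    define c where "c k = a k - b k" for k
    have c0: "(\<lambda>k. c k * x ^ k) sums 0" for x
      using sums_diff[OF assms(1)[of x] assms(2)[of x]] by (simp add: c_def left_diff_distrib)
    \<comment> \<open>With the lower terms removed and x^n divided out, the series represents a
      function that is \<open>c n\<close> at 0 and 0 elsewhere; continuity of power series gives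
      \<open>c n = 0\<close>.\<close>
    have shift: "(\<lambda>k. c (k + n) * x ^ k) sums (if x = 0 then c n else 0)" for x
    proof (cases "x = 0")
      case False
      have "(\<lambda>k. c (k + n) * x ^ (k + n)) sums (0 - (\<Sum>k<n. c k * x ^ k))"
        using c0[of x] sums_iff_shift[of "\<lambda>k. c k * x ^ k" n "0 - (\<Sum>k<n. c k * x ^ k)"] by simp
      moreover have "(\<Sum>k<n. c k * x ^ k) = 0" using less by (intro sum.neutral) (auto simp: c_def)
      ultimately have "(\<lambda>k. (c (k + n) * x ^ k) * x ^ n) sums 0" by (simp add: power_add mult_ac)
      then have "(\<lambda>k. (c (k + n) * x ^ k) * x ^ n / x ^ n) sums (0 / x ^ n)" by (rule sums_divide)
      then show ?thesis using False by simp
    qed (simp add: powser_sums_zero_iff)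
    from powser_limit_0[of 1 "\<lambda>k. c (k + n)" "\<lambda>x. if x = 0 then c n else 0"] shift
    have "((\<lambda>x::real. if x = 0 then c n else 0) \<longlongrightarrow> c n) (at 0)"
      by simp
    moreover have "((\<lambda>x::real. if x = 0 then c n else 0) \<longlongrightarrow> 0) (at 0)"
      by (rule Lim_transform_eventually[OF tendsto_const[of 0]]) (auto simp: eventually_at intro!: exI[of _ 1])
    ultimately have "c n = 0" using tendsto_unique[of "at (0::real)"] by simp
    then show ?case by (simp add: c_def)
  qed
qed

text \<open>Averaging the exponential series at x and - x leaves only its even terms. These are
  nonnegative, so sum and integral can be exchanged before any moment is known to be finite; the
  resulting power series in x is compared with that of exp (x^2 s / 2).\<close>

lemma gaussian_moments_of_mgf:
  assumes X: "X \<in> borel_measurable N"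
    and mgf: "\<And>x. (\<integral>\<^sup>+w. ennreal (exp (x * X w)) \<partial>N) = ennreal (exp (x\<^sup>2 * s / 2))"
  shows "(\<integral>\<^sup>+w. ennreal (X w ^ (2 * k)) \<partial>N) = ennreal (fact (2 * k) / fact k * (s / 2) ^ k)"
proof -
  note [measurable] = X
  define m where "m n = (\<integral>\<^sup>+w. ennreal (X w ^ n) \<partial>N)" for n
  define a where "a x n w = (if even n then (x * X w) ^ n / fact n else 0)" for x n w
  have a0: "a x n w \<ge> 0" for x n w by (auto simp: a_def zero_le_even_power)
  have int_a: "(\<integral>\<^sup>+w. ennreal (a x n w) \<partial>N) = (if even n then ennreal (x ^ n / fact n) * m n else 0)" for x n
  proof (cases "even n")
    case True
    have "(\<integral>\<^sup>+w. ennreal (a x n w) \<partial>N) = (\<integral>\<^sup>+w. ennreal (x ^ n / fact n) * ennreal (X w ^ n) \<partial>N)"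
      using True by (intro nn_integral_cong)
        (auto simp: a_def ennreal_mult[symmetric] zero_le_even_power power_mult_distrib)
    then show ?thesis using True by (simp add: nn_integral_cmult m_def)
  qed (simp add: a_def)
  have cosh: "(\<Sum>n. \<integral>\<^sup>+w. ennreal (a x n w) \<partial>N) = ennreal (exp (x\<^sup>2 * s / 2))" for x
  proof -
    have "(\<Sum>n. \<integral>\<^sup>+w. ennreal (a x n w) \<partial>N) = (\<integral>\<^sup>+w. (\<Sum>n. ennreal (a x n w)) \<partial>N)"
      by (rule nn_integral_suminf[symmetric]) (auto simp: a_def)
    also have "\<dots> = (\<integral>\<^sup>+w. ennreal (cosh (x * X w)) \<partial>N)"
    proof (rule nn_integral_cong)
      fix w
      have "(\<lambda>n. a x n w) sums cosh (x * X w)"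
      proof -
        have "(\<lambda>n. a x n w) = (\<lambda>n. if even n then (x * X w) ^ n /\<^sub>R fact n else 0)"
          unfolding a_def by (intro ext) (simp add: divide_inverse)
        then show ?thesis using cosh_converges[of "x * X w"] by simp
      qed
      then show "(\<Sum>n. ennreal (a x n w)) = ennreal (cosh (x * X w))"
        using a0 by (intro suminf_ennreal_eq) auto
    qed
    also have "\<dots> = (\<integral>\<^sup>+w. (ennreal (exp (x * X w)) + ennreal (exp (- x * X w))) * ennreal (1 / 2) \<partial>N)"
    proof (rule nn_integral_cong)
      fix w
      have "cosh (x * X w) = (exp (x * X w) + exp (- x * X w)) * (1 / 2)" by (simp add: cosh_def)
      then show "ennreal (cosh (x * X w)) = (ennreal (exp (x * X w)) + ennreal (exp (- x * X w))) * ennreal (1 / 2)"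
        by (simp only: ennreal_mult ennreal_plus exp_ge_zero add_nonneg_nonneg zero_le_divide_1_iff zero_le_numeral)
    qed
    also have "\<dots> = ((\<integral>\<^sup>+w. ennreal (exp (x * X w)) \<partial>N) + (\<integral>\<^sup>+w. ennreal (exp (- x * X w)) \<partial>N)) * ennreal (1 / 2)"
      by (subst nn_integral_multc) (auto simp: nn_integral_add)
    also have "\<dots> = ennreal (exp (x\<^sup>2 * s / 2))"
    proof -
      have "(ennreal a + ennreal a) * ennreal (1 / 2) = ennreal ((a + a) * (1 / 2))" if "a \<ge> 0" for a
        using that by (simp only: ennreal_mult ennreal_plus add_nonneg_nonneg zero_le_divide_1_iff zero_le_numeral)
      from this[of "exp (x\<^sup>2 * s / 2)"] show ?thesis
        unfolding mgf by simp
    qed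
    finally show ?thesis .
  qed
  \<comment> \<open>At x = 1 each even term is bounded by the whole sum, which is finite.\<close>
  have mfin: "m n < \<infinity>" if "even n" for n
  proof -
    have "(\<integral>\<^sup>+w. ennreal (a 1 n w) \<partial>N) \<le> (\<Sum>n. \<integral>\<^sup>+w. ennreal (a 1 n w) \<partial>N)"
      using sum_le_suminf[of "\<lambda>n. \<integral>\<^sup>+w. ennreal (a 1 n w) \<partial>N" "{n}"] by simp
    then have "ennreal (1 / fact n) * m n \<le> ennreal (exp (s / 2))"
      using that unfolding cosh[of 1] int_a[of 1 n] by simp
    then have "ennreal (1 / fact n) * m n < \<infinity>" by (rule le_less_trans) simp
    then show ?thesis by (auto simp: ennreal_mult_less_top ennreal_zero_less_divide)
  qed
  define b where "b n = (if even n then (s / 2) ^ (n div 2) / fact (n div 2) else 0)" for n :: nat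
  define r where "r n = (if even n then enn2real (m n) / fact n else 0)" for n
  have "(\<lambda>n. r n * x ^ n) sums exp (x\<^sup>2 * s / 2)" for x
  proof -
    have nonneg: "r n * x ^ n \<ge> 0" for n by (auto simp: r_def zero_le_even_power)
    have eq: "(\<integral>\<^sup>+w. ennreal (a x n w) \<partial>N) = ennreal (r n * x ^ n)" for n
    proof (cases "even n")
      case True
      define M where "M = enn2real (m n)"
      have M: "m n = ennreal M" "M \<ge> 0" using mfin[OF True] by (auto simp: M_def)
      have "ennreal (x ^ n / fact n) * ennreal M = ennreal (x ^ n / fact n * M)"
        using True M by (intro ennreal_mult[symmetric]) (auto simp: zero_le_even_power)
      then show ?thesis using True unfolding int_a r_def M_def[symmetric] M(1)
        using M(2) by (simp add: mult.commute)
    qed (simp add: int_a r_def)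
    have summ: "(\<Sum>n. ennreal (r n * x ^ n)) = ennreal (exp (x\<^sup>2 * s / 2))"
      using cosh[of x] unfolding eq .
    then have sm: "summable (\<lambda>n. r n * x ^ n)"
      using nonneg by (intro summable_suminf_not_top) (auto simp: ennreal_neq_top)
    have "ennreal (\<Sum>n. r n * x ^ n) = (\<Sum>n. ennreal (r n * x ^ n))"
      by (rule suminf_ennreal2[OF nonneg sm, symmetric])
    also note summ
    finally have "(\<Sum>n. r n * x ^ n) = exp (x\<^sup>2 * s / 2)"
      using suminf_nonneg[OF sm nonneg] by (simp only: ennreal_inj exp_ge_zero)
    then show ?thesis using sm by (simp only: sums_iff)
  qed
  moreover have "(\<lambda>n. b n * x ^ n) sums exp (x\<^sup>2 * s / 2)" for x
  proof -
    have b2: "b (2 * k) * x ^ (2 * k) = (x\<^sup>2 * s / 2) ^ k /\<^sub>R fact k" for k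
    proof -
      have "x\<^sup>2 * s / 2 = x\<^sup>2 * (s / 2)" by simp
      then have "(x\<^sup>2 * s / 2) ^ k = (x\<^sup>2) ^ k * (s / 2) ^ k" by (simp only: power_mult_distrib)
      moreover have "b (2 * k) = (s / 2) ^ k / fact k" by (simp add: b_def)
      moreover have "x ^ (2 * k) = (x\<^sup>2) ^ k" by (rule power_mult)
      ultimately show ?thesis by (simp only: divide_inverse real_scaleR_def mult_ac)
    qed
    have "(\<lambda>k. b (2 * k) * x ^ (2 * k)) sums exp (x\<^sup>2 * s / 2)"
      unfolding b2 by (rule exp_converges)
    moreover have "strict_mono (\<lambda>k::nat. 2 * k)" by (auto simp: strict_mono_def)
    moreover have "b n * x ^ n = 0" if "n \<notin> range (\<lambda>k::nat. 2 * k)" for n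
      using that by (auto simp: b_def elim!: evenE)
    ultimately show ?thesis
      by (subst (asm) sums_mono_reindex) auto
  qed
  ultimately have "r = b"
    by (rule power_series_unique_real)
  then have r2k: "r (2 * k) = (s / 2) ^ k / fact k" by (simp add: b_def)
  then have "enn2real (m (2 * k)) = fact (2 * k) / fact k * (s / 2) ^ k"
  proof -
    have "enn2real (m (2 * k)) / fact (2 * k) = (s / 2) ^ k / fact k"
      using r2k by (simp add: r_def)
    then have "enn2real (m (2 * k)) = (s / 2) ^ k / fact k * fact (2 * k)"
      by (metis fact_nonzero nonzero_divide_eq_eq)
    then show ?thesis by (simp add: mult_ac)
  qed
  moreover have "m (2 * k) = ennreal (enn2real (m (2 * k)))" using mfin[of "2 * k"] by simp
  ultimately show ?thesis unfolding m_def by simp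
qed

section \<open>Gaussian densities of definite quadratic forms\<close>

definition lin :: "nat set \<Rightarrow> (nat \<Rightarrow> real) \<Rightarrow> (nat \<Rightarrow> real) \<Rightarrow> real" where
  "lin I c t = (\<Sum>i\<in>I. c i * t i)"

lemma lin_affine: "lin I c (\<lambda>i\<in>I. b i + s * t i) = lin I c b + s * lin I c t"
  by (simp add: lin_def algebra_simps sum.distrib sum_distrib_left)

lemma lin_combination: "lin I c (\<lambda>i. x * s i + y * t i) = x * lin I c s + y * lin I c t"
  by (simp add: lin_def algebra_simps sum.distrib sum_distrib_left)

lemma lin_measurable [measurable]: "lin I c \<in> borel_measurable (LB I)"
  unfolding lin_def by measurable

text \<open>The vector \<open>a m\<close> holds the coefficients of the form \<lambda>_m and
  \<open>D m\<close> is its weight. The ambient size \<open>d\<close> allows matrices indexed from 0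
  although \<open>I\<close> may have gaps. Coercivity makes the integral finite and the matrix
  definite.\<close>

locale gaussian_form =
  fixes V :: "'m set" and I :: "nat set" and d :: nat and a :: "'m \<Rightarrow> nat \<Rightarrow> real"
    and D :: "'m \<Rightarrow> real" and c0 :: real
  assumes finite_V: "finite V" and I_subset: "I \<subseteq> {..<d}"
    and D_pos: "\<And>m. m \<in> V \<Longrightarrow> D m > 0"
    and c0_pos: "c0 > 0"
    and coercive: "\<And>t. c0 * (\<Sum>i\<in>I. (t i)\<^sup>2) \<le> (\<Sum>m\<in>V. D m * (lin I (a m) t)\<^sup>2)"
begin

definition bil :: "(nat \<Rightarrow> real) \<Rightarrow> (nat \<Rightarrow> real) \<Rightarrow> real" where
  "bil s t = (\<Sum>m\<in>V. D m * lin I (a m) s * lin I (a m) t)"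

definition q :: "(nat \<Rightarrow> real) \<Rightarrow> real" where
  "q t = bil t t / 2"

definition Z :: real where
  "Z = enn2real (\<integral>\<^sup>+t. ennreal (exp (- q t)) \<partial>LB I)"

lemma finite_I: "finite I"
  using I_subset finite_subset by blast

lemma bil_measurable [measurable]: "bil c \<in> borel_measurable (LB I)"
  unfolding bil_def by measurable

lemma q_measurable [measurable]: "q \<in> borel_measurable (LB I)"
  unfolding q_def bil_def by measurable

lemma bil_commute: "bil s t = bil t s"
  unfolding bil_def by (simp add: mult_ac)

lemma bil_self: "bil t t = (\<Sum>m\<in>V. D m * (lin I (a m) t)\<^sup>2)"
  unfolding bil_def by (simp add: power2_eq_square mult.assoc)

lemma bil_self_nonneg: "bil t t \<ge> 0"
  unfolding bil_self by (intro sum_nonneg mult_nonneg_nonneg less_imp_le[OF D_pos]) auto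

lemma bil_combination: "bil c (\<lambda>i. x * s i + y * t i) = x * bil c s + y * bil c t"
  unfolding bil_def lin_combination by (simp add: algebra_simps sum.distrib sum_distrib_left)

lemma bil_combination_left: "bil (\<lambda>i. x * s i + y * t i) c = x * bil s c + y * bil t c"
  using bil_combination bil_commute by simp

lemma bil_affine: "bil c (\<lambda>i\<in>I. b i + s * t i) = bil c b + s * bil c t"
  unfolding bil_def lin_affine by (simp add: algebra_simps sum.distrib sum_distrib_left)

lemma bil_scale: "bil (\<lambda>i. x * s i) c = x * bil s c"
  using bil_combination_left[of x s 0 s c] by simp

lemma q_affine: "q (\<lambda>i\<in>I. b i + s * t i) = q b + s * bil b t + s\<^sup>2 * q t"
  unfolding q_def bil_affine bil_commute[of "\<lambda>i\<in>I. b i + s * t i"]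
  by (simp add: bil_affine algebra_simps power2_eq_square bil_commute[of t b] add_divide_distrib)

text \<open>A weak form of Cauchy-Schwarz, from nonnegativity at s + t and s - t. It is just as good
  when both squared lengths have the same upper bound.\<close>

lemma bil_abs_le: "\<bar>bil s t\<bar> \<le> (bil s s + bil t t) / 2"
proof -
  have "bil (\<lambda>i. 1 * s i + x * t i) (\<lambda>i. 1 * s i + x * t i) = bil s s + 2 * x * bil s t + x\<^sup>2 * bil t t" for x
    unfolding bil_combination bil_combination_left
    by (simp add: bil_commute[of t s] power2_eq_square algebra_simps)
  from bil_self_nonneg[of "\<lambda>i. 1 * s i + 1 * t i"] bil_self_nonneg[of "\<lambda>i. 1 * s i + (- 1) * t i"]
    this[of 1] this[of "- 1"]
  show ?thesis by simp
qed

lemma nn_integral_exp_q_finite: "(\<integral>\<^sup>+t. ennreal (exp (- q t)) \<partial>LB I) < \<infinity>"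
proof -
  have "(\<integral>\<^sup>+t. ennreal (exp (- q t)) \<partial>LB I)
      \<le> (\<integral>\<^sup>+t. (\<Prod>i\<in>I. ennreal (exp (- (c0 * (t i)\<^sup>2 + 2 * 0 * t i) / 2))) \<partial>LB I)"
  proof (rule nn_integral_mono)
    fix t
    have "exp (- q t) \<le> exp (\<Sum>i\<in>I. - (c0 * (t i)\<^sup>2 + 2 * 0 * t i) / 2)"
      using coercive[of t] unfolding q_def bil_self
      by (simp add: sum_negf sum_divide_distrib[symmetric] sum_distrib_left)
    also have "\<dots> = (\<Prod>i\<in>I. exp (- (c0 * (t i)\<^sup>2 + 2 * 0 * t i) / 2))"
      by (rule exp_sum[OF finite_I])
    finally show "ennreal (exp (- q t)) \<le> (\<Prod>i\<in>I. ennreal (exp (- (c0 * (t i)\<^sup>2 + 2 * 0 * t i) / 2)))"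
      by (simp add: prod_ennreal ennreal_leI)
  qed
  also have "\<dots> = (\<Prod>i\<in>I. \<integral>\<^sup>+y. ennreal (exp (- (c0 * y\<^sup>2 + 2 * 0 * y) / 2)) \<partial>lborel)"
    by (rule lborel_prod.product_nn_integral_prod[OF finite_I]) measurable
  also have "\<dots> < \<infinity>"
    unfolding nn_integral_gaussian[OF c0_pos] using c0_pos by (simp add: prod_ennreal ennreal_power)
  finally show ?thesis .
qed

lemma nn_integral_exp_q: "(\<integral>\<^sup>+t. ennreal (exp (- q t)) \<partial>LB I) = ennreal Z"
  unfolding Z_def using nn_integral_exp_q_finite by simp

text \<open>Only a cube of half-width \<open>h\<close> is kept. A lower bound of \<open>Z\<close> is
  what turns an absolute error on the torus into a relative one.\<close>

lemma Z_lower_bound: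
  assumes h: "h > 0" and K: "\<And>t. (\<And>i. i \<in> I \<Longrightarrow> \<bar>t i\<bar> \<le> h) \<Longrightarrow> q t \<le> K"
  shows "(2 * h) ^ card I * exp (- K) \<le> Z"
proof -
  have "ennreal ((2 * h) ^ card I * exp (- K)) = ennreal (exp (- K)) * (\<Prod>i\<in>I. emeasure lborel {- h..h})"
    using h by (simp add: prod_ennreal ennreal_mult[symmetric] mult.commute ennreal_power)
  also have "\<dots> = ennreal (exp (- K)) * emeasure (LB I) (PiE I (\<lambda>_. {- h..h}))"
    by (subst lborel_prod.emeasure_PiM[OF finite_I]) auto
  also have "\<dots> = (\<integral>\<^sup>+t. ennreal (exp (- K)) * indicator (PiE I (\<lambda>_. {- h..h})) t \<partial>LB I)"
    using finite_I by (subst nn_integral_cmult_indicator) (auto intro: sets_PiM_I_finite)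
  also have "\<dots> \<le> (\<integral>\<^sup>+t. ennreal (exp (- q t)) \<partial>LB I)"
  proof (rule nn_integral_mono)
    fix t
    show "ennreal (exp (- K)) * indicator (PiE I (\<lambda>_. {- h..h})) t \<le> ennreal (exp (- q t))"
    proof (cases "t \<in> PiE I (\<lambda>_. {- h..h})")
      case True
      then have "q t \<le> K" by (intro K) (auto simp: PiE_iff abs_le_iff)
      then show ?thesis using True by (simp add: ennreal_leI)
    qed simp
  qed
  finally show ?thesis
    unfolding nn_integral_exp_q using ennreal_le_iff[of Z] by (simp add: Z_def)
qed

lemma Z_pos: "Z > 0"
proof -
  have "(2 * 1) ^ card I * exp (- ((\<Sum>m\<in>V. D m * (\<Sum>i\<in>I. \<bar>a m i\<bar>)\<^sup>2) / 2)) \<le> Z"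
  proof (rule Z_lower_bound)
    fix t :: "nat \<Rightarrow> real" assume t: "\<And>i. i \<in> I \<Longrightarrow> \<bar>t i\<bar> \<le> 1"
    have "\<bar>lin I (a m) t\<bar> \<le> (\<Sum>i\<in>I. \<bar>a m i\<bar>)" for m
      unfolding lin_def
      by (rule order_trans[OF sum_abs]) (use t in \<open>auto intro!: sum_mono mult_left_le simp: abs_mult\<close>)
    then have "(lin I (a m) t)\<^sup>2 \<le> (\<Sum>i\<in>I. \<bar>a m i\<bar>)\<^sup>2" for m
      by (metis abs_ge_zero power2_abs power_mono)
    then show "q t \<le> (\<Sum>m\<in>V. D m * (\<Sum>i\<in>I. \<bar>a m i\<bar>)\<^sup>2) / 2"
      unfolding q_def bil_self
      by (intro divide_right_mono sum_mono mult_left_mono less_imp_le[OF D_pos]) auto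
  qed simp
  moreover have "(2 * 1 :: real) ^ card I * exp (- ((\<Sum>m\<in>V. D m * (\<Sum>i\<in>I. \<bar>a m i\<bar>)\<^sup>2) / 2)) > 0" by simp
  ultimately show ?thesis by (rule less_le_trans[rotated])
qed

text \<open>The substitution t = c / s + u / sqrt s completes the square. For s = 1 this is the
  moment generating function of \<open>bil c\<close>; s < 1 gives the same for the widened
  Gaussian.\<close>

lemma nn_integral_exp_bil:
  assumes s: "s > 0"
  shows "(\<integral>\<^sup>+t. ennreal (exp (- s * q t + bil c t)) \<partial>LB I)
    = ennreal ((1 / sqrt s) ^ card I * (exp (q c / s) * Z))"
proof -
  let ?b = "\<lambda>i. c i / s"
  have "(\<integral>\<^sup>+t. ennreal (exp (- s * q t + bil c t)) \<partial>LB I)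
      = ennreal (\<bar>1 / sqrt s\<bar> ^ card I) *
        (\<integral>\<^sup>+t. ennreal (exp (- s * q (\<lambda>i\<in>I. ?b i + 1 / sqrt s * t i) + bil c (\<lambda>i\<in>I. ?b i + 1 / sqrt s * t i))) \<partial>LB I)"
    using s by (intro nn_integral_LB_affine[OF finite_I]) auto
  also have "(\<lambda>t. - s * q (\<lambda>i\<in>I. ?b i + 1 / sqrt s * t i) + bil c (\<lambda>i\<in>I. ?b i + 1 / sqrt s * t i))
      = (\<lambda>t. q c / s + - q t)"
  proof
    fix t
    define x where "x = 1 / sqrt s"
    have x: "x\<^sup>2 = 1 / s" using s by (simp add: x_def power_divide)
    have b: "bil ?b u = bil c u / s" "bil u ?b = bil u c / s" for u
      using bil_scale[of "1 / s" c u] bil_commute by (auto simp: mult.commute)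
    have "q ?b = q c / (s * s)" unfolding q_def b by simp
    then show "- s * q (\<lambda>i\<in>I. ?b i + 1 / sqrt s * t i) + bil c (\<lambda>i\<in>I. ?b i + 1 / sqrt s * t i) = q c / s + - q t"
      unfolding q_affine bil_affine b x_def[symmetric] x using s
      by (simp add: q_def field_simps)
  qed
  also have "(\<integral>\<^sup>+t. ennreal (exp (q c / s + - q t)) \<partial>LB I) = ennreal (exp (q c / s)) * ennreal Z"
    unfolding exp_add nn_integral_exp_q[symmetric]
    by (subst nn_integral_cmult[symmetric]) (auto simp: ennreal_mult)
  finally show ?thesis using s Z_pos by (simp add: ennreal_mult)
qed

text \<open>The matrix of \<open>2 q\<close>, extended by the identity to a matrix of the fixed size \<open>d\<close>.\<close>

definition B :: "nat \<Rightarrow> nat \<Rightarrow> real" where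
  "B i j = (if i \<in> I \<and> j \<in> I then \<Sum>m\<in>V. D m * (a m i * a m j) else if i = j then 1 else 0)"

lemma qform_B: "qform d B t = 2 * q t + (\<Sum>i\<in>{..<d} - I. (t i)\<^sup>2)"
proof -
  have row: "(\<Sum>j<d. B i j * t i * t j)
      = (if i \<in> I then \<Sum>m\<in>V. D m * (a m i * t i) * lin I (a m) t else (t i)\<^sup>2)" if "i < d" for i
  proof (cases "i \<in> I")
    case True
    have "(\<Sum>j<d. B i j * t i * t j) = (\<Sum>j\<in>I. B i j * t i * t j)"
      using I_subset True by (intro sum.mono_neutral_right) (auto simp: B_def)
    also have "\<dots> = (\<Sum>j\<in>I. \<Sum>m\<in>V. D m * (a m i * t i) * (a m j * t j))"
      using True by (intro sum.cong) (auto simp: B_def sum_distrib_left sum_distrib_right mult_ac)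
    also have "\<dots> = (\<Sum>m\<in>V. \<Sum>j\<in>I. D m * (a m i * t i) * (a m j * t j))" by (rule sum.swap)
    finally show ?thesis using True by (simp add: lin_def sum_distrib_left)
  next
    case False
    then have "(\<Sum>j<d. B i j * t i * t j) = (\<Sum>j<d. if j = i then (t i)\<^sup>2 else 0)"
      by (intro sum.cong) (auto simp: B_def power2_eq_square)
    then show ?thesis using that False by simp
  qed
  have "qform d B t = (\<Sum>i<d. if i \<in> I then \<Sum>m\<in>V. D m * (a m i * t i) * lin I (a m) t else (t i)\<^sup>2)"
    unfolding qform_def by (intro sum.cong row) auto
  also have "\<dots> = (\<Sum>i\<in>I. \<Sum>m\<in>V. D m * (a m i * t i) * lin I (a m) t) + (\<Sum>i\<in>{..<d} - I. (t i)\<^sup>2)"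
  proof -
    have "{..<d} = I \<union> ({..<d} - I)" using I_subset by auto
    then have "sum f {..<d} = sum f I + sum f ({..<d} - I)" for f :: "nat \<Rightarrow> real"
      by (metis Diff_disjoint finite_Diff finite_I finite_lessThan sum.union_disjoint)
    then show ?thesis by simp
  qed
  also have "(\<Sum>i\<in>I. \<Sum>m\<in>V. D m * (a m i * t i) * lin I (a m) t) = bil t t"
    unfolding bil_def by (subst sum.swap) (simp add: lin_def sum_distrib_left sum_distrib_right mult_ac)
  finally show ?thesis by (simp add: q_def)
qed

lemma B_sym: "B i j = B j i"
  by (simp add: B_def mult.commute)

lemma qform_B_pos:
  assumes "\<exists>i<d. t i \<noteq> 0"
  shows "qform d B t > 0"
proof -
  obtain i where i: "i < d" "t i \<noteq> 0" using assms by blast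
  have nonneg: "q t \<ge> 0" "(\<Sum>i\<in>{..<d} - I. (t i)\<^sup>2) \<ge> 0"
    using bil_self_nonneg by (auto simp: q_def intro: sum_nonneg)
  show ?thesis
  proof (cases "i \<in> I")
    case True
    have "0 < (t i)\<^sup>2" using i by simp
    also have "(t i)\<^sup>2 \<le> (\<Sum>i\<in>I. (t i)\<^sup>2)" using True finite_I by (intro member_le_sum) auto
    finally have "0 < c0 * (\<Sum>i\<in>I. (t i)\<^sup>2)" using c0_pos by simp
    then have "q t > 0" using coercive[of t] by (simp add: q_def bil_self)
    then show ?thesis using nonneg by (simp add: qform_B)
  next
    case False
    have "0 < (t i)\<^sup>2" using i by simp
    also have "(t i)\<^sup>2 \<le> (\<Sum>i\<in>{..<d} - I. (t i)\<^sup>2)" using False i by (intro member_le_sum) auto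
    finally show ?thesis using nonneg by (simp add: qform_B)
  qed
qed

lemma det_B_pos: "Determinant.det (Matrix.mat d d (\<lambda>(i, j). B i j)) > 0"
  using nn_integral_exp_qform[of B d, OF B_sym qform_B_pos] by simp

text \<open>The identity block decouples, so each coordinate outside \<open>I\<close> contributes an
  independent factor \<open>sqrt (2 * pi)\<close>.\<close>

lemma Z_eq: "Z * sqrt (2 * pi) ^ (d - card I)
  = sqrt (2 * pi) ^ d / sqrt (Determinant.det (Matrix.mat d d (\<lambda>(i, j). B i j)))"
proof -
  let ?J = "{..<d} - I"
  have cJ: "card ?J = d - card I" using I_subset finite_I by (simp add: card_Diff_subset)
  have UJ: "{..<d} = I \<union> ?J" using I_subset by auto
  have meas: "(\<lambda>t. ennreal (exp (- qform d B t / 2))) \<in> borel_measurable (LB (I \<union> ?J))"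
    unfolding UJ[symmetric] by measurable
  have "(\<integral>\<^sup>+t. ennreal (exp (- qform d B t / 2)) \<partial>LB {..<d})
      = (\<integral>\<^sup>+x. (\<integral>\<^sup>+y. ennreal (exp (- qform d B (merge I ?J (x, y)) / 2)) \<partial>LB ?J) \<partial>LB I)"
    by (subst UJ, rule lborel_prod.product_nn_integral_fold) (use finite_I meas in auto)
  also have "\<dots> = (\<integral>\<^sup>+x. ennreal (exp (- q x)) * (\<integral>\<^sup>+y. (\<Prod>j\<in>?J. ennreal (exp (- (1 * (y j)\<^sup>2 + 2 * 0 * y j) / 2))) \<partial>LB ?J) \<partial>LB I)"
  proof (rule nn_integral_cong)
    fix x
    have lin: "lin I (a m) (merge I ?J (x, y)) = lin I (a m) x" for m y
      unfolding lin_def by (intro sum.cong) (auto simp: merge_def)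
    have "qform d B (merge I ?J (x, y)) = 2 * q x + (\<Sum>j\<in>?J. (y j)\<^sup>2)" for y
    proof -
      have "q (merge I ?J (x, y)) = q x" unfolding q_def bil_def lin ..
      moreover have "(\<Sum>j\<in>?J. (merge I ?J (x, y) j)\<^sup>2) = (\<Sum>j\<in>?J. (y j)\<^sup>2)"
        by (intro sum.cong) (auto simp: merge_def)
      ultimately show ?thesis by (simp add: qform_B)
    qed
    then have "exp (- qform d B (merge I ?J (x, y)) / 2) = exp (- q x) * (\<Prod>j\<in>?J. exp (- (1 * (y j)\<^sup>2 + 2 * 0 * y j) / 2))" for y
      by (simp add: exp_sum[symmetric] exp_add[symmetric] sum_negf sum_divide_distrib[symmetric] diff_divide_distrib)
    then have "(\<integral>\<^sup>+y. ennreal (exp (- qform d B (merge I ?J (x, y)) / 2)) \<partial>LB ?J)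
       = (\<integral>\<^sup>+y. ennreal (exp (- q x)) * (\<Prod>j\<in>?J. ennreal (exp (- (1 * (y j)\<^sup>2 + 2 * 0 * y j) / 2))) \<partial>LB ?J)"
      by (simp add: prod_ennreal ennreal_mult prod_nonneg)
    also have "\<dots> = ennreal (exp (- q x)) * (\<integral>\<^sup>+y. (\<Prod>j\<in>?J. ennreal (exp (- (1 * (y j)\<^sup>2 + 2 * 0 * y j) / 2))) \<partial>LB ?J)"
      by (rule nn_integral_cmult) measurable
    finally show "(\<integral>\<^sup>+y. ennreal (exp (- qform d B (merge I ?J (x, y)) / 2)) \<partial>LB ?J) = \<dots>" .
  qed
  also have "(\<integral>\<^sup>+y. (\<Prod>j\<in>?J. ennreal (exp (- (1 * (y j)\<^sup>2 + 2 * 0 * y j) / 2))) \<partial>LB ?J)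
      = (\<Prod>j\<in>?J. \<integral>\<^sup>+y. ennreal (exp (- (1 * y\<^sup>2 + 2 * 0 * y) / 2)) \<partial>lborel)"
    by (rule lborel_prod.product_nn_integral_prod) measurable
  also have "\<dots> = ennreal (sqrt (2 * pi) ^ (d - card I))"
  proof -
    have "(\<integral>\<^sup>+y. ennreal (exp (- (1 * y\<^sup>2 + 2 * 0 * y) / 2)) \<partial>lborel) = ennreal (sqrt (2 * pi))"
      using nn_integral_gaussian[of 1 0] by simp
    then show ?thesis unfolding prod_constant cJ by (simp only: ennreal_power real_sqrt_ge_zero pi_ge_zero mult_nonneg_nonneg zero_le_numeral)
  qed
  also have "(\<integral>\<^sup>+x. ennreal (exp (- q x)) * ennreal (sqrt (2 * pi) ^ (d - card I)) \<partial>LB I)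
      = ennreal (Z * sqrt (2 * pi) ^ (d - card I))"
    using Z_pos by (subst nn_integral_multc) (auto simp: nn_integral_exp_q ennreal_mult)
  finally have "ennreal (Z * sqrt (2 * pi) ^ (d - card I))
      = ennreal (sqrt (2 * pi) ^ d / sqrt (Determinant.det (Matrix.mat d d (\<lambda>(i, j). B i j))))"
    using nn_integral_exp_qform[of B d, OF B_sym qform_B_pos] by simp
  then show ?thesis using Z_pos det_B_pos
    by (subst (asm) ennreal_inj) auto
qed

text \<open>Riesz representation in the inner product \<open>bil\<close>, by solving a linear system
  with matrix \<open>B\<close>. The squared length of the representer is the variance of \<lambda>_m
  under the density exp (- q) / Z.\<close>

lemma dual_exists:
  assumes "m \<in> V"
  shows "\<exists>c. \<forall>t. bil c t = lin I (a m) t"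
proof -
  obtain c where c: "\<And>i. i < d \<Longrightarrow> (\<Sum>j<d. B i j * c j) = a m i"
    using det_nonzero_solve[of d B "a m"] det_B_pos by auto
  have "(\<Sum>p\<in>V. D p * lin I (a p) c * a p i) = a m i" if i: "i \<in> I" for i
  proof -
    have "(\<Sum>j<d. B i j * c j) = (\<Sum>j\<in>I. B i j * c j)"
      using I_subset i by (intro sum.mono_neutral_right) (auto simp: B_def)
    also have "\<dots> = (\<Sum>j\<in>I. \<Sum>p\<in>V. D p * (a p j * c j) * a p i)"
      using i by (intro sum.cong) (auto simp: B_def sum_distrib_left sum_distrib_right mult_ac)
    also have "\<dots> = (\<Sum>p\<in>V. \<Sum>j\<in>I. D p * (a p j * c j) * a p i)" by (rule sum.swap)
    also have "\<dots> = (\<Sum>p\<in>V. D p * lin I (a p) c * a p i)"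
      by (simp add: lin_def sum_distrib_left sum_distrib_right)
    finally show ?thesis using c[of i] i I_subset by auto
  qed
  then have "(\<Sum>i\<in>I. (\<Sum>p\<in>V. D p * lin I (a p) c * a p i) * t i) = lin I (a m) t" for t
    unfolding lin_def by (intro sum.cong) auto
  moreover have "bil c t = (\<Sum>i\<in>I. (\<Sum>p\<in>V. D p * lin I (a p) c * a p i) * t i)" for t
  proof -
    have "bil c t = (\<Sum>p\<in>V. \<Sum>i\<in>I. D p * lin I (a p) c * a p i * t i)"
      unfolding bil_def by (simp add: lin_def[of I _ t] sum_distrib_left mult_ac)
    also have "\<dots> = (\<Sum>i\<in>I. \<Sum>p\<in>V. D p * lin I (a p) c * a p i * t i)" by (rule sum.swap)
    finally show ?thesis by (simp add: sum_distrib_right)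
  qed
  ultimately show ?thesis by auto
qed

definition dual :: "'m \<Rightarrow> nat \<Rightarrow> real" where
  "dual m = (SOME c. \<forall>t. bil c t = lin I (a m) t)"

lemma bil_dual: "m \<in> V \<Longrightarrow> bil (dual m) t = lin I (a m) t"
  using someI_ex[OF dual_exists[of m]] unfolding dual_def by blast

end

section \<open>Moments and tails of Gaussian linear forms\<close>

text \<open>Interpolation takes the place of comparing coefficients: the odd parts at y = 1, 2, 3
  are three linear equations for the coefficients of y, y^3 and y^5.\<close>

lemma sextic_polarization:
  fixes m1 m3 m5 A B C :: real
  assumes P: "\<And>y :: real. m0 + 6 * y * m1 + 15 * y ^ 2 * m2 + 20 * y ^ 3 * m3 + 15 * y ^ 4 * m4 + 6 * y ^ 5 * m5 + y ^ 6 * m6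
      = 15 * (A + 2 * y * C + y ^ 2 * B) ^ 3"
  shows "m3 = 9 * A * B * C + 6 * C ^ 3"
proof -
  define k0 k1 k2 k3 k4 k5 k6 where k: "k0 = A ^ 3" "k1 = 6 * A\<^sup>2 * C" "k2 = 3 * A\<^sup>2 * B + 12 * A * C\<^sup>2"
    "k3 = 8 * C ^ 3 + 12 * A * B * C" "k4 = 12 * C\<^sup>2 * B + 3 * A * B\<^sup>2" "k5 = 6 * C * B\<^sup>2" "k6 = B ^ 3"
  have "(A + 2 * y * C + y ^ 2 * B) ^ 3 = k0 + y * k1 + y ^ 2 * k2 + y ^ 3 * k3 + y ^ 4 * k4 + y ^ 5 * k5 + y ^ 6 * k6" for y
    unfolding k by (simp add: algebra_simps eval_nat_numeral)
  then have Q: "m0 + 6 * y * m1 + 15 * y ^ 2 * m2 + 20 * y ^ 3 * m3 + 15 * y ^ 4 * m4 + 6 * y ^ 5 * m5 + y ^ 6 * m6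
      = 15 * (k0 + y * k1 + y ^ 2 * k2 + y ^ 3 * k3 + y ^ 4 * k4 + y ^ 5 * k5 + y ^ 6 * k6)" for y
    using P[of y] by simp
  have "6 * m1 + 20 * m3 + 6 * m5 = 15 * (k1 + k3 + k5)"
    using Q[of 1] Q[of "-1"] by simp
  moreover have "12 * m1 + 160 * m3 + 192 * m5 = 15 * (2 * k1 + 8 * k3 + 32 * k5)"
    using Q[of 2] Q[of "-2"] by simp
  moreover have "18 * m1 + 540 * m3 + 1458 * m5 = 15 * (3 * k1 + 27 * k3 + 243 * k5)"
    using Q[of 3] Q[of "-3"] by simp
  ultimately have "4 * m3 = 3 * k3" by simp
  then show ?thesis by (simp add: k)
qed

context gaussian_form
begin

lemma q_scale: "q (\<lambda>i. x * c i) = x\<^sup>2 * bil c c / 2"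
  unfolding q_def bil_scale bil_commute[of c "\<lambda>i. x * c i"] by (simp add: power2_eq_square)

definition N :: "(nat \<Rightarrow> real) measure" where
  "N = density (LB I) (\<lambda>t. ennreal (exp (- q t) / Z))"

lemma borel_measurable_N [simp]: "f \<in> borel_measurable N \<longleftrightarrow> f \<in> borel_measurable (LB I)"
  by (simp add: N_def)

lemma nn_integral_N:
  assumes [measurable]: "f \<in> borel_measurable (LB I)"
  shows "(\<integral>\<^sup>+t. ennreal (exp (- q t)) * f t \<partial>LB I) = ennreal Z * (\<integral>\<^sup>+t. f t \<partial>N)"
proof -
  have "ennreal Z * (\<integral>\<^sup>+t. f t \<partial>N) = ennreal Z * (\<integral>\<^sup>+t. ennreal (exp (- q t) / Z) * f t \<partial>LB I)"
    unfolding N_def by (subst nn_integral_density) auto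
  also have "\<dots> = (\<integral>\<^sup>+t. ennreal Z * (ennreal (exp (- q t) / Z) * f t) \<partial>LB I)"
    by (rule nn_integral_cmult[symmetric]) measurable
  also have "\<dots> = (\<integral>\<^sup>+t. ennreal (exp (- q t)) * f t \<partial>LB I)"
    using Z_pos by (intro nn_integral_cong) (simp add: mult.assoc[symmetric] ennreal_mult[symmetric])
  finally show ?thesis by simp
qed

text \<open>Identifies \<open>bil c\<close> as a centred Gaussian variable of variance
  \<open>bil c c\<close>; its moments are derived from this formula.\<close>

lemma mgf_N: "(\<integral>\<^sup>+t. ennreal (exp (x * bil c t)) \<partial>N) = ennreal (exp (x\<^sup>2 * bil c c / 2))"
proof -
  have "ennreal Z * (\<integral>\<^sup>+t. ennreal (exp (x * bil c t)) \<partial>N)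
      = (\<integral>\<^sup>+t. ennreal (exp (- q t)) * ennreal (exp (x * bil c t)) \<partial>LB I)"
    by (rule nn_integral_N[symmetric]) measurable
  also have "\<dots> = (\<integral>\<^sup>+t. ennreal (exp (- 1 * q t + bil (\<lambda>i. x * c i) t)) \<partial>LB I)"
    by (simp add: ennreal_mult[symmetric] exp_add[symmetric] bil_scale)
  also have "\<dots> = ennreal (exp (q (\<lambda>i. x * c i)) * Z)"
    by (subst nn_integral_exp_bil) auto
  also have "q (\<lambda>i. x * c i) = x\<^sup>2 * bil c c / 2"
    by (rule q_scale)
  also have "ennreal (exp (x\<^sup>2 * bil c c / 2) * Z) = ennreal Z * ennreal (exp (x\<^sup>2 * bil c c / 2))"
    using Z_pos by (simp add: ennreal_mult mult.commute)
  finally show ?thesis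
    using Z_pos by (subst (asm) ennreal_mult_cancel_left) auto
qed

lemma moment6_N:
  shows "integrable N (\<lambda>t. bil c t ^ 6)" "(\<integral>t. bil c t ^ 6 \<partial>N) = 15 * bil c c ^ 3"
proof -
  have "(\<integral>\<^sup>+t. ennreal (bil c t ^ (2 * 3)) \<partial>N) = ennreal (fact (2 * 3) / fact 3 * (bil c c / 2) ^ 3)"
    by (rule gaussian_moments_of_mgf[OF _ mgf_N]) simp
  also have "fact (2 * 3) / fact 3 * (bil c c / 2) ^ 3 = 15 * bil c c ^ 3"
    by (simp add: fact_numeral power_divide)
  finally have *: "(\<integral>\<^sup>+t. ennreal (bil c t ^ 6) \<partial>N) = ennreal (15 * bil c c ^ 3)" by simp
  show "integrable N (\<lambda>t. bil c t ^ 6)"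
    by (rule integrableI_nonneg) (auto simp: * zero_le_even_power)
  show "(\<integral>t. bil c t ^ 6 \<partial>N) = 15 * bil c c ^ 3"
    by (rule integral_eq_nn_integral[of _ N, THEN trans]) (auto simp: * zero_le_even_power bil_self_nonneg)
qed

text \<open>Polarization: the sixth moment of \<open>bil (c + y e)\<close> is known for every real \<open>y\<close>, and the mixed
  moment is its coefficient at \<open>y\<^sup>3\<close>.\<close>

lemma moment33_N:
  shows "integrable N (\<lambda>t. bil c t ^ 3 * bil e t ^ 3)"
    and "(\<integral>t. bil c t ^ 3 * bil e t ^ 3 \<partial>N) = 9 * bil c c * bil e e * bil c e + 6 * bil c e ^ 3"
proof -
  have bound: "\<bar>x ^ i * y ^ j\<bar> \<le> x ^ 6 + y ^ 6" if "i + j = 6" for x y :: real and i j :: nat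
  proof -
    let ?M = "max \<bar>x\<bar> \<bar>y\<bar>"
    have "\<bar>x ^ i * y ^ j\<bar> = \<bar>x\<bar> ^ i * \<bar>y\<bar> ^ j" by (simp add: abs_mult power_abs)
    also have "\<dots> \<le> ?M ^ i * ?M ^ j" by (intro mult_mono power_mono) auto
    also have "\<dots> = ?M ^ 6" by (simp add: power_add[symmetric] that)
    also have "\<dots> \<le> \<bar>x\<bar> ^ 6 + \<bar>y\<bar> ^ 6" by (auto simp: max_def)
    also have "\<dots> = x ^ 6 + y ^ 6" by (simp add: power_even_abs)
    finally show ?thesis .
  qed
  have int: "integrable N (\<lambda>t. bil c t ^ i * bil e t ^ j)" if "i + j = 6" for i j :: nat
  proof (rule Bochner_Integration.integrable_bound)
    show "integrable N (\<lambda>t. bil c t ^ 6 + bil e t ^ 6)" by (intro Bochner_Integration.integrable_add moment6_N)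
    show "AE t in N. norm (bil c t ^ i * bil e t ^ j) \<le> norm (bil c t ^ 6 + bil e t ^ 6)"
      using bound[OF that] by (intro AE_I2) (simp add: order_trans[OF _ abs_ge_self])
  qed simp
  show "integrable N (\<lambda>t. bil c t ^ 3 * bil e t ^ 3)" by (rule int) simp
  define m where "m j = (\<integral>t. bil c t ^ (6 - j) * bil e t ^ j \<partial>N)" for j :: nat
  have hb: "has_bochner_integral N (\<lambda>t. bil c t ^ (6 - j) * bil e t ^ j) (m j)" if "j \<le> 6" for j
    unfolding m_def using that by (intro has_bochner_integral_integrable int) simp
  have "m 0 + 6 * y * m 1 + 15 * y ^ 2 * m 2 + 20 * y ^ 3 * m 3 + 15 * y ^ 4 * m 4 + 6 * y ^ 5 * m 5 + y ^ 6 * m 6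
      = 15 * (bil c c + 2 * y * bil c e + y ^ 2 * bil e e) ^ 3" for y :: real
  proof -
    let ?v = "\<lambda>i. 1 * c i + y * e i"
    have "(bil c t + y * bil e t) ^ 6 = (\<Sum>j\<le>6. of_nat (6 choose j) * y ^ j * (bil c t ^ (6 - j) * bil e t ^ j))" for t
      unfolding add.commute[of "bil c t"] binomial_ring by (simp add: power_mult_distrib mult_ac)
    then have eq: "(\<lambda>t. bil ?v t ^ 6) = (\<lambda>t. \<Sum>j\<le>6. of_nat (6 choose j) * y ^ j * (bil c t ^ (6 - j) * bil e t ^ j))"
      unfolding bil_combination_left by (intro ext) simp
    have hb6: "has_bochner_integral N (\<lambda>t. bil ?v t ^ 6) (\<Sum>j\<le>6. of_nat (6 choose j) * y ^ j * m j)"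
      unfolding eq by (intro has_bochner_integral_sum has_bochner_integral_mult_right hb) auto
    have "(\<Sum>j\<le>6. of_nat (6 choose j) * y ^ j * m j) = (\<integral>t. bil ?v t ^ 6 \<partial>N)"
      by (rule has_bochner_integral_integral_eq[OF hb6, symmetric])
    also have "\<dots> = 15 * bil ?v ?v ^ 3" by (rule moment6_N(2))
    also have "bil ?v ?v = bil c c + 2 * y * bil c e + y ^ 2 * bil e e"
      unfolding bil_combination bil_combination_left
      using bil_commute[of e c] by (simp add: power2_eq_square algebra_simps)
    finally have sum_eq: "(\<Sum>j\<le>6. of_nat (6 choose j) * y ^ j * m j)
        = 15 * (bil c c + 2 * y * bil c e + y ^ 2 * bil e e) ^ 3" .
    show ?thesis
    proof -
      have six: "{..6::nat} = {0, 1, 2, 3, 4, 5, 6}" by auto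
      have ch: "(6::nat) choose 2 = 15" "(6::nat) choose 3 = 20" "(6::nat) choose 4 = 15"
        "(6::nat) choose 5 = 6" by (simp_all add: numeral_eq_Suc)
      have "(\<Sum>j\<le>6. of_nat (6 choose j) * y ^ j * m j)
          = m 0 + 6 * y * m 1 + 15 * y ^ 2 * m 2 + 20 * y ^ 3 * m 3 + 15 * y ^ 4 * m 4 + 6 * y ^ 5 * m 5 + y ^ 6 * m 6"
        unfolding six by (simp add: ch)
      with sum_eq show ?thesis by (simp only:)
    qed
  qed
  then have "m 3 = 9 * bil c c * bil e e * bil c e + 6 * bil c e ^ 3" by (rule sextic_polarization)
  then show "(\<integral>t. bil c t ^ 3 * bil e t ^ 3 \<partial>N) = 9 * bil c c * bil e e * bil c e + 6 * bil c e ^ 3"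
    by (simp add: m_def)
qed

text \<open>Leverage is applied to the representer t = \<open>dual m\<close> itself: there
  \<lambda>_m equals the variance v, and the sum of squares is at most v / r, so v^2 \<le> L v /
  r.\<close>

lemma variance_le:
  assumes r: "r > 0" "\<And>m. m \<in> V \<Longrightarrow> r \<le> D m" and L: "L \<ge> 0"
    and lev: "\<And>t. (lin I (a m) t)\<^sup>2 \<le> L * (\<Sum>p\<in>V. (lin I (a p) t)\<^sup>2)" and m: "m \<in> V"
  shows "bil (dual m) (dual m) \<le> L / r"
proof -
  let ?s = "bil (dual m) (dual m)"
  have "?s\<^sup>2 \<le> L * (\<Sum>p\<in>V. (lin I (a p) (dual m))\<^sup>2)"
    using lev[of "dual m"] bil_dual[OF m] by simp
  also have "r * \<dots> \<le> L * ?s"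
  proof -
    have "r * (\<Sum>p\<in>V. (lin I (a p) (dual m))\<^sup>2) \<le> ?s"
      unfolding bil_self sum_distrib_left using r by (intro sum_mono mult_right_mono) auto
    then show ?thesis using L by (simp add: mult_left_mono mult.left_commute)
  qed
  finally have "r * ?s\<^sup>2 \<le> L * ?s" using r by simp
  then have "(r * ?s) * ?s \<le> L * ?s" by (simp only: power2_eq_square mult.assoc)
  then have "?s = 0 \<or> r * ?s \<le> L" using bil_self_nonneg[of "dual m"]
    using mult_right_le_imp_le[of "r * ?s" ?s L] by linarith
  then show ?thesis using r L by (auto simp: field_simps)
qed

lemma gaussian_tail:
  assumes m: "m \<in> V" and S: "bil (dual m) (dual m) \<le> S" "S > 0" and s: "s > 0" and \<delta>: "\<delta> \<ge> 0"
  shows "(\<integral>\<^sup>+t. ennreal (exp (- s * q t)) * indicator {t. \<bar>lin I (a m) t\<bar> > \<delta>} t \<partial>LB I)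
    \<le> ennreal (2 * (1 / sqrt s) ^ card I * exp (- s * \<delta>\<^sup>2 / (2 * S)) * Z)"
proof -
  \<comment> \<open>Under exp (- s q) the variance is at most S / s, and this x minimises the
    Chernoff exponent - x \<delta> + x^2 S / (2 s).\<close>
  define x where "x = s * \<delta> / S"
  have x: "x \<ge> 0" using s \<delta> S by (simp add: x_def)
  define K where "K = (1 / sqrt s) ^ card I * (exp (x\<^sup>2 * bil (dual m) (dual m) / 2 / s) * Z)"
  have K0: "K \<ge> 0" using s Z_pos by (simp add: K_def)
  have int: "(\<integral>\<^sup>+t. ennreal (exp (- s * q t + y * lin I (a m) t)) \<partial>LB I) = ennreal K" if "y\<^sup>2 = x\<^sup>2" for y
  proof -
    have qy: "q (\<lambda>i. y * dual m i) = x\<^sup>2 * bil (dual m) (dual m) / 2"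
      unfolding q_scale that ..
    have "(\<integral>\<^sup>+t. ennreal (exp (- s * q t + y * lin I (a m) t)) \<partial>LB I)
        = (\<integral>\<^sup>+t. ennreal (exp (- s * q t + bil (\<lambda>i. y * dual m i) t)) \<partial>LB I)"
      by (simp only: bil_scale bil_dual[OF m])
    then show ?thesis unfolding nn_integral_exp_bil[OF s] by (simp only: qy K_def)
  qed
  have "(\<integral>\<^sup>+t. ennreal (exp (- s * q t)) * indicator {t. \<bar>lin I (a m) t\<bar> > \<delta>} t \<partial>LB I)
    \<le> (\<integral>\<^sup>+t. ennreal (exp (- (x * \<delta>))) * (ennreal (exp (- s * q t + x * lin I (a m) t)) + ennreal (exp (- s * q t + (- x) * lin I (a m) t))) \<partial>LB I)"
  proof (rule nn_integral_mono)
    fix t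
    let ?l = "lin I (a m) t"
    show "ennreal (exp (- s * q t)) * indicator {t. \<bar>lin I (a m) t\<bar> > \<delta>} t
      \<le> ennreal (exp (- (x * \<delta>))) * (ennreal (exp (- s * q t + x * ?l)) + ennreal (exp (- s * q t + (- x) * ?l)))"
    proof (cases "\<bar>?l\<bar> > \<delta>")
      case True
      have "exp (- s * q t) \<le> exp (- (x * \<delta>)) * exp (- s * q t + x * \<bar>?l\<bar>)"
        using mult_left_mono[OF less_imp_le[OF True] x] by (simp add: exp_add[symmetric])
      also have "\<dots> \<le> exp (- (x * \<delta>)) * (exp (- s * q t + x * ?l) + exp (- s * q t + (- x) * ?l))"
        by (intro mult_left_mono) (auto simp: abs_if add_increasing add_increasing2)
      finally show ?thesis using True
        by (simp add: ennreal_mult[symmetric] ennreal_plus[symmetric] ennreal_leI del: ennreal_plus)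
    qed simp
  qed
  also have "\<dots> = ennreal (exp (- (x * \<delta>))) * (ennreal K + ennreal K)"
  proof -
    let ?f = "\<lambda>y t. ennreal (exp (- s * q t + y * lin I (a m) t))"
    have "(\<integral>\<^sup>+t. ennreal (exp (- (x * \<delta>))) * (?f x t + ?f (- x) t) \<partial>LB I)
        = ennreal (exp (- (x * \<delta>))) * (\<integral>\<^sup>+t. ?f x t + ?f (- x) t \<partial>LB I)"
      by (rule nn_integral_cmult) measurable
    also have "(\<integral>\<^sup>+t. ?f x t + ?f (- x) t \<partial>LB I) = (\<integral>\<^sup>+t. ?f x t \<partial>LB I) + (\<integral>\<^sup>+t. ?f (- x) t \<partial>LB I)"
      by (rule nn_integral_add) measurable
    also have "(\<integral>\<^sup>+t. ?f x t \<partial>LB I) = ennreal K" by (rule int) simp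
    also have "(\<integral>\<^sup>+t. ?f (- x) t \<partial>LB I) = ennreal K" by (rule int) simp
    finally show ?thesis .
  qed
  also have "\<dots> = ennreal (2 * (exp (- (x * \<delta>)) * K))"
    using K0 by (simp add: ennreal_mult[symmetric] ennreal_plus[symmetric] del: ennreal_plus)
  also have "\<dots> \<le> ennreal (2 * (1 / sqrt s) ^ card I * exp (- s * \<delta>\<^sup>2 / (2 * S)) * Z)"
  proof (rule ennreal_leI)
    have "x\<^sup>2 * bil (dual m) (dual m) / 2 / s \<le> x\<^sup>2 * S / 2 / s"
      using S s by (intro divide_right_mono mult_left_mono) auto
    also have "\<dots> = s * \<delta>\<^sup>2 / (2 * S)" using S s by (simp add: x_def power2_eq_square mult_ac)
    finally have "x\<^sup>2 * bil (dual m) (dual m) / 2 / s \<le> s * \<delta>\<^sup>2 / (2 * S)" .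
    then have "- (x * \<delta>) + x\<^sup>2 * bil (dual m) (dual m) / 2 / s \<le> - s * \<delta>\<^sup>2 / (2 * S)"
    proof -
      define w where "w = s * \<delta>\<^sup>2 / (2 * S)"
      have "x * \<delta> = 2 * w" "- s * \<delta>\<^sup>2 / (2 * S) = - w"
        using S by (simp_all add: x_def w_def power2_eq_square mult_ac)
      then show ?thesis using \<open>_ \<le> s * \<delta>\<^sup>2 / (2 * S)\<close> unfolding w_def[symmetric] by linarith
    qed
    then have "exp (- (x * \<delta>)) * exp (x\<^sup>2 * bil (dual m) (dual m) / 2 / s) \<le> exp (- s * \<delta>\<^sup>2 / (2 * S))"
      by (simp add: exp_add[symmetric])
    then have "(1 / sqrt s) ^ card I * Z * (exp (- (x * \<delta>)) * exp (x\<^sup>2 * bil (dual m) (dual m) / 2 / s))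
        \<le> (1 / sqrt s) ^ card I * Z * exp (- s * \<delta>\<^sup>2 / (2 * S))"
      using s Z_pos by (intro mult_left_mono) auto
    then show "2 * (exp (- (x * \<delta>)) * K) \<le> 2 * (1 / sqrt s) ^ card I * exp (- s * \<delta>\<^sup>2 / (2 * S)) * Z"
      by (simp add: K_def mult_ac)
  qed
  finally show ?thesis .
qed

text \<open>The mixed moment of two cubes is 9 v v C + 6 C^3; both parts obey the same bound, whence
  15 = 9 + 6. Summing |C| over all pairs would cost n^2, but square-sum bounds for the covariances
  \<open>C\<close> keep the cost linear in n.\<close>

lemma cubic_second_moment:
  assumes r: "r > 0" "\<And>m. m \<in> V \<Longrightarrow> r \<le> D m" and S: "\<And>m. m \<in> V \<Longrightarrow> bil (dual m) (dual m) \<le> S"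
    and G: "\<And>m. m \<in> V \<Longrightarrow> \<bar>g m\<bar> \<le> G"
  shows "(\<integral>\<^sup>+t. ennreal (exp (- q t)) * ennreal ((\<Sum>m\<in>V. g m * lin I (a m) t ^ 3)\<^sup>2) \<partial>LB I)
    \<le> ennreal (15 * (real (card V) * G\<^sup>2 * S\<^sup>2 / r) * Z)"
proof (cases "V = {}")
  case False
  define v where "v m = bil (dual m) (dual m)" for m
  define C where "C m p = bil (dual m) (dual p)" for m p
  have v: "0 \<le> v m" for m unfolding v_def by (rule bil_self_nonneg)
  have vS: "v m \<le> S" if "m \<in> V" for m unfolding v_def by (rule S[OF that])
  obtain m0 where m0: "m0 \<in> V" using False by blast
  have S0: "S \<ge> 0" using v[of m0] vS[OF m0] by simp
  have G0: "G \<ge> 0" using G[OF m0] by simp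
  have CS: "\<bar>C m p\<bar> \<le> S" if "m \<in> V" "p \<in> V" for m p
    using bil_abs_le[of "dual m" "dual p"] vS[OF that(1)] vS[OF that(2)] by (simp add: C_def v_def)
  let ?f = "\<lambda>t. \<Sum>m\<in>V. g m * lin I (a m) t ^ 3"
  have f2: "(?f t)\<^sup>2 = (\<Sum>m\<in>V. \<Sum>p\<in>V. (g m * g p) * (bil (dual m) t ^ 3 * bil (dual p) t ^ 3))" for t
    unfolding power2_eq_square sum_product
    by (intro sum.cong refl) (simp add: bil_dual mult_ac)
  have hb: "has_bochner_integral N (\<lambda>t. (?f t)\<^sup>2)
      (\<Sum>m\<in>V. \<Sum>p\<in>V. (g m * g p) * (9 * v m * v p * C m p + 6 * C m p ^ 3))"
    unfolding f2 v_def C_def moment33_N(2)[symmetric]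
    by (intro has_bochner_integral_sum has_bochner_integral_mult_right has_bochner_integral_integrable moment33_N(1))
  let ?n = "real (card V)"
  \<comment> \<open>The form of the covariance matrix at w is \<open>bil u u\<close>, with u the
    combination of representers with coefficients w. Splitting each product by the
    arithmetic-geometric mean inequality and absorbing half of \<open>bil u u\<close> shows that
    this matrix has norm at most 1 / r.\<close>
  have first: "(\<Sum>m\<in>V. \<Sum>p\<in>V. (g m * v m) * (g p * v p) * C m p) \<le> ?n * G\<^sup>2 * S\<^sup>2 / r"
  proof -
    define w where "w m = g m * v m" for m
    define u where "u i = (\<Sum>m\<in>V. w m * dual m i)" for i
    have lin_u: "lin I (a p) u = (\<Sum>m\<in>V. w m * lin I (a p) (dual m))" for p
    proof -
      have "lin I (a p) u = (\<Sum>i\<in>I. \<Sum>m\<in>V. w m * (a p i * dual m i))"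
        unfolding lin_def u_def by (simp add: sum_distrib_left mult_ac)
      then show ?thesis unfolding lin_def by (subst (asm) sum.swap) (simp add: sum_distrib_left)
    qed
    have lin_C: "lin I (a p) (dual m) = C m p" if "p \<in> V" for m p
      using bil_dual[OF that, of "dual m"] bil_commute[of "dual p" "dual m"] by (simp add: C_def)
    have uu: "bil u u = (\<Sum>m\<in>V. w m * lin I (a m) u)"
    proof -
      have "bil u u = (\<Sum>p\<in>V. \<Sum>m\<in>V. w m * (D p * lin I (a p) (dual m) * lin I (a p) u))"
        unfolding bil_def by (subst (2) lin_u) (simp add: sum_distrib_left sum_distrib_right mult_ac)
      also have "\<dots> = (\<Sum>m\<in>V. w m * bil (dual m) u)"
        unfolding bil_def by (subst sum.swap) (simp add: sum_distrib_left)
      finally show ?thesis by (simp add: bil_dual)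
    qed
    have "w m * lin I (a m) u \<le> w m ^ 2 / (2 * r) + D m * (lin I (a m) u)\<^sup>2 / 2" if "m \<in> V" for m
    proof -
      have "0 \<le> (w m - r * lin I (a m) u)\<^sup>2 / (2 * r)" using r by simp
      also have "\<dots> = w m ^ 2 / (2 * r) + r * (lin I (a m) u)\<^sup>2 / 2 - w m * lin I (a m) u"
        using r by (simp add: power2_eq_square field_simps)
      also have "r * (lin I (a m) u)\<^sup>2 \<le> D m * (lin I (a m) u)\<^sup>2"
        using r(2)[OF that] by (intro mult_right_mono) auto
      finally show ?thesis by simp
    qed
    then have "bil u u \<le> (\<Sum>m\<in>V. w m ^ 2 / (2 * r) + D m * (lin I (a m) u)\<^sup>2 / 2)"
      unfolding uu by (rule sum_mono)
    also have "\<dots> = (\<Sum>m\<in>V. w m ^ 2) / (2 * r) + bil u u / 2"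
      unfolding bil_self by (simp add: sum.distrib sum_divide_distrib)
    finally have "bil u u \<le> (\<Sum>m\<in>V. w m ^ 2) / r" by simp
    also have "(\<Sum>m\<in>V. w m ^ 2) \<le> (\<Sum>m\<in>V. (G * S)\<^sup>2)"
    proof (rule sum_mono)
      fix m assume "m \<in> V"
      then have "\<bar>w m\<bar> \<le> G * S" unfolding w_def abs_mult
        using v[of m] vS[of m] G[of m] by (intro mult_mono) auto
      then show "(w m)\<^sup>2 \<le> (G * S)\<^sup>2" by (metis abs_ge_zero power2_abs power_mono)
    qed
    also have "\<dots> = ?n * G\<^sup>2 * S\<^sup>2" by (simp add: power_mult_distrib)
    finally have "bil u u \<le> ?n * G\<^sup>2 * S\<^sup>2 / r" using r by (simp add: divide_right_mono)
    moreover have "bil u u = (\<Sum>m\<in>V. \<Sum>p\<in>V. (g m * v m) * (g p * v p) * C m p)"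
      unfolding uu lin_u sum_distrib_left
    proof (intro sum.cong refl)
      fix m p assume "m \<in> V" "p \<in> V"
      then have "lin I (a m) (dual p) = C m p"
        using bil_dual[of m "dual p"] by (simp add: C_def)
      then show "w m * (w p * lin I (a m) (dual p)) = g m * v m * (g p * v p) * C m p"
        by (simp add: w_def mult_ac)
    qed
    ultimately show ?thesis by simp
  qed
  have second: "(\<Sum>m\<in>V. \<Sum>p\<in>V. (g m * g p) * C m p ^ 3) \<le> ?n * G\<^sup>2 * S\<^sup>2 / r"
  proof -
    \<comment> \<open>A Parseval identity: the variance of \<lambda>_m is the weighted sum over p of
      its squared covariances with \<lambda>_p.\<close>
    have row: "r * (\<Sum>p\<in>V. (C m p)\<^sup>2) \<le> S" if "m \<in> V" for m
    proof -
      have "r * (\<Sum>p\<in>V. (C m p)\<^sup>2) \<le> (\<Sum>p\<in>V. D p * (C m p)\<^sup>2)"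
        unfolding sum_distrib_left using r by (intro sum_mono mult_right_mono) auto
      also have "\<dots> = v m"
        unfolding v_def bil_self
      proof (intro sum.cong refl)
        fix p assume "p \<in> V"
        then show "D p * (C m p)\<^sup>2 = D p * (lin I (a p) (dual m))\<^sup>2"
          using bil_dual[of p "dual m"] bil_commute[of "dual p" "dual m"] by (simp add: C_def)
      qed
      finally show ?thesis using vS[OF that] by simp
    qed
    have "(g m * g p) * C m p ^ 3 \<le> G\<^sup>2 * S * (C m p)\<^sup>2" if "m \<in> V" "p \<in> V" for m p
    proof -
      have "(g m * g p) * C m p ^ 3 \<le> \<bar>g m\<bar> * \<bar>g p\<bar> * \<bar>C m p\<bar> * (C m p)\<^sup>2"
        using abs_ge_self[of "(g m * g p) * C m p ^ 3"]
        by (simp add: abs_mult power3_eq_cube power2_eq_square mult_ac)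
      also have "\<dots> \<le> G * G * S * (C m p)\<^sup>2"
        using that G CS G0 S0 by (intro mult_right_mono mult_mono) auto
      finally show ?thesis by (simp add: power2_eq_square)
    qed
    then have "(\<Sum>m\<in>V. \<Sum>p\<in>V. (g m * g p) * C m p ^ 3) \<le> (\<Sum>m\<in>V. \<Sum>p\<in>V. G\<^sup>2 * S * (C m p)\<^sup>2)"
      by (intro sum_mono)
    also have "\<dots> = (\<Sum>m\<in>V. G\<^sup>2 * S * (\<Sum>p\<in>V. (C m p)\<^sup>2))" by (simp add: sum_distrib_left)
    also have "\<dots> \<le> (\<Sum>m\<in>V. G\<^sup>2 * S * (S / r))"
      using row r G0 S0 by (intro sum_mono mult_left_mono) (auto simp: pos_le_divide_eq mult.commute)
    also have "\<dots> = ?n * G\<^sup>2 * S\<^sup>2 / r" by (simp add: power2_eq_square)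
    finally show ?thesis .
  qed
  have E: "(\<integral>t. (?f t)\<^sup>2 \<partial>N) \<le> 15 * (?n * G\<^sup>2 * S\<^sup>2 / r)"
  proof -
    have "(\<integral>t. (?f t)\<^sup>2 \<partial>N) = 9 * (\<Sum>m\<in>V. \<Sum>p\<in>V. (g m * v m) * (g p * v p) * C m p) + 6 * (\<Sum>m\<in>V. \<Sum>p\<in>V. (g m * g p) * C m p ^ 3)"
    proof -
      have "(g m * g p) * (9 * v m * v p * C m p + 6 * C m p ^ 3)
          = 9 * ((g m * v m) * (g p * v p) * C m p) + 6 * ((g m * g p) * C m p ^ 3)" for m p
        by (simp add: algebra_simps)
      then show ?thesis unfolding has_bochner_integral_integral_eq[OF hb]
        by (simp only: sum.distrib sum_distrib_left)
    qed
    also have "\<dots> \<le> 9 * (?n * G\<^sup>2 * S\<^sup>2 / r) + 6 * (?n * G\<^sup>2 * S\<^sup>2 / r)"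
      by (intro add_mono mult_left_mono first second) auto
    finally show ?thesis by simp
  qed
  have "(\<integral>\<^sup>+t. ennreal (exp (- q t)) * ennreal ((?f t)\<^sup>2) \<partial>LB I) = ennreal Z * (\<integral>\<^sup>+t. ennreal ((?f t)\<^sup>2) \<partial>N)"
    by (rule nn_integral_N) measurable
  also have "(\<integral>\<^sup>+t. ennreal ((?f t)\<^sup>2) \<partial>N) = ennreal (\<integral>t. (?f t)\<^sup>2 \<partial>N)"
    by (rule nn_integral_eq_integral) (use hb in \<open>auto simp: has_bochner_integral_iff\<close>)
  also have "ennreal Z * \<dots> \<le> ennreal Z * ennreal (15 * (?n * G\<^sup>2 * S\<^sup>2 / r))"
    by (intro mult_left_mono ennreal_leI E) auto
  also have "\<dots> = ennreal (15 * (?n * G\<^sup>2 * S\<^sup>2 / r) * Z)"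
    using Z_pos r by (subst ennreal_mult[symmetric]) (auto simp: mult.commute)
  finally show ?thesis .
qed simp

end

section \<open>The characteristic factor of a geometric distribution\<close>

definition geom_factor :: "real \<Rightarrow> real \<Rightarrow> complex" where
  "geom_factor z x = cis (- z * x) / (1 + of_real z - of_real z * cis x)"

lemma norm_geom_denominator_sq:
  "(norm (1 + of_real z - of_real z * cis x))\<^sup>2 = 1 + 4 * (z + z\<^sup>2) * (sin (x / 2))\<^sup>2"
proof -
  have "cos x = 1 - 2 * (sin (x / 2))\<^sup>2" using cos_double_sin[of "x / 2"] by simp
  moreover have "(norm (1 + of_real z - of_real z * cis x))\<^sup>2 = (1 + z - z * cos x)\<^sup>2 + (z * sin x)\<^sup>2"
    by (simp add: cmod_power2)
  moreover have "(1 + z - z * cos x)\<^sup>2 + (z * sin x)\<^sup>2 = 1 + 2 * (z + z\<^sup>2) * (1 - cos x)"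
  proof -
    have "(sin x)\<^sup>2 = 1 - (cos x)\<^sup>2" by (simp add: sin_squared_eq)
    then show ?thesis by (simp add: power_mult_distrib) (simp add: power2_eq_square algebra_simps)
  qed
  ultimately show ?thesis by simp
qed

text \<open>The cap c \<le> 1 permits exp (c s / 2) \<le> 1 + c s for s in [0, 1], to be compared
  with the squared denominator; its square root leaves c / 4. The choice c = 0 gives the trivial
  bound 1.\<close>

lemma norm_geom_factor_bound:
  assumes "0 \<le> c" "c \<le> 1" "c \<le> 4 * (z + z\<^sup>2)"
  shows "norm (geom_factor z x) \<le> exp (- (c / 4) * (sin (x / 2))\<^sup>2)"
proof -
  define s where "s = (sin (x / 2))\<^sup>2"
  define n where "n = norm (1 + of_real z - of_real z * cis x)"
  have s: "0 \<le> s" "s \<le> 1" by (auto simp: s_def abs_square_le_1)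
  have cs: "0 \<le> c * s" "c * s \<le> 1" using s assms by (auto intro: mult_le_one)
  have "exp (c * s / 2) \<le> 1 + c * s / 2 + (c * s / 2)\<^sup>2" using cs by (intro exp_bound) auto
  also have "\<dots> \<le> 1 + c * s"
    using cs mult_left_le[of "c * s" "c * s"] by (simp add: power2_eq_square)
  also have "\<dots> \<le> 1 + 4 * (z + z\<^sup>2) * s" using assms s by (intro add_left_mono mult_right_mono) auto
  also have "\<dots> = n\<^sup>2" unfolding n_def s_def norm_geom_denominator_sq by simp
  finally have "(exp (c * s / 4))\<^sup>2 \<le> n\<^sup>2" by (simp add: exp_of_nat_mult[symmetric] power2_eq_square exp_add[symmetric])
  then have "exp (c * s / 4) \<le> n" by (rule power2_le_imp_le) (simp add: n_def)
  then have "1 / n \<le> 1 / exp (c * s / 4)" by (intro divide_left_mono) (auto intro: mult_pos_pos less_le_trans[OF exp_gt_zero])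
  moreover have "norm (geom_factor z x) = 1 / n" unfolding geom_factor_def n_def by (simp add: norm_divide)
  moreover have "- (c / 4) * s = - (c * s / 4)" by simp
  then have "exp (- (c / 4) * s) = 1 / exp (c * s / 4)"
    by (simp only: exp_minus divide_inverse mult_1_left)
  ultimately show ?thesis unfolding s_def[symmetric] by (simp only:)
qed

lemma norm_geom_factor_le_1: "0 \<le> z \<Longrightarrow> norm (geom_factor z x) \<le> 1"
  using norm_geom_factor_bound[of 0 z x] by simp

lemma geom_factor_measurable [measurable]: "geom_factor z \<in> borel_measurable borel"
  unfolding geom_factor_def cis_conv_exp by measurable

text \<open>With \<open>y = z e\<^bsup>iw\<^esup> / (1 + z - z e\<^bsup>iw\<^esup>)\<close> one has \<open>y' = i (y + y\<^sup>2)\<close>, so all derivatives of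
  \<open>ln (1 + z - z e\<^bsup>iw\<^esup>)\<close> are polynomials in \<open>y\<close>.\<close>

lemma geom_factor_taylor:
  assumes z: "0 \<le> z"
  defines "D \<equiv> z + z\<^sup>2"
  obtains \<rho> where "geom_factor z x
      = exp (of_real (- D * x\<^sup>2 / 2) + \<i> * of_real (- (D * (1 + 2 * z) / 6) * x ^ 3) + \<rho>)"
    and "norm \<rho> \<le> D * (1 + 6 * D) / 6 * x ^ 4"
proof -
  define p where "p w = 1 + of_real z - of_real z * exp (\<i> * w)" for w :: complex
  define y where "y w = of_real z * exp (\<i> * w) / p w" for w
  \<comment> \<open>\<open>f j\<close> is the j-th derivative of \<open>Ln (p w)\<close>, for j up
    to 4, written in terms of y.\<close>
  define f where "f j w = (if j = 0 then Ln (p w) else if j = 1 then - \<i> * y w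
     else if j = 2 then y w + (y w)\<^sup>2 else if j = 3 then \<i> * ((1 + 2 * y w) * (y w + (y w)\<^sup>2))
     else - ((y w + (y w)\<^sup>2) * (1 + 6 * (y w + (y w)\<^sup>2))))" for j :: nat and w
  have pcis: "p (of_real t) = 1 + of_real z - of_real z * cis t" for t
    by (simp add: p_def cis_conv_exp)
  \<comment> \<open>On the real line the denominator stays away both from 0 and from the branch cut
    of the logarithm.\<close>
  have Re_p: "Re (p w) \<ge> 1" and norm_p: "norm (p w) \<ge> 1" if wR: "w \<in> \<real>" for w
  proof -
    obtain t where w: "w = of_real t" using Reals_cases[OF wR] by blast
    have "z * cos t \<le> z" using z by (intro mult_left_le) auto
    then show "Re (p w) \<ge> 1" by (simp add: w pcis)
    then show "norm (p w) \<ge> 1" using complex_Re_le_cmod order_trans by blast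
  qed
  have dp: "(p has_field_derivative - \<i> * (of_real z * exp (\<i> * w))) (at w)" for w
    unfolding p_def by (auto intro!: derivative_eq_intros)
  have dy: "(y has_field_derivative \<i> * (y w + (y w)\<^sup>2)) (at w)" if "w \<in> \<real>" for w
  proof -
    have p0: "p w \<noteq> 0" using norm_p[OF that] by auto
    have "(y has_field_derivative (\<i> * (of_real z * exp (\<i> * w)) * p w - of_real z * exp (\<i> * w) * (- \<i> * (of_real z * exp (\<i> * w)))) / (p w * p w)) (at w)"
      unfolding y_def by (rule DERIV_divide[OF _ dp p0]) (auto intro!: derivative_eq_intros)
    moreover have "(\<i> * (of_real z * exp (\<i> * w)) * p w - of_real z * exp (\<i> * w) * (- \<i> * (of_real z * exp (\<i> * w)))) / (p w * p w) = \<i> * (y w + (y w)\<^sup>2)"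
    proof -
      have "(\<i> * E * P - E * (- \<i> * E)) / (P * P) = \<i> * (E / P + (E / P)\<^sup>2)" if "P \<noteq> 0" for E P :: complex
        using that by (simp add: field_simps power2_eq_square)
      from this[OF p0] show ?thesis unfolding y_def .
    qed
    ultimately show ?thesis by simp
  qed
  have df: "(f j has_field_derivative f (Suc j) w) (at w within \<real>)" if w: "w \<in> \<real>" and j: "j \<le> 3" for j w
  proof -
    note dy' = has_field_derivative_at_within[OF dy[OF w], of "\<real>"]
    consider "j = 0" | "j = 1" | "j = 2" | "j = 3" using j by linarith
    then show ?thesis
    proof cases
      case 1
      have "p w \<notin> \<real>\<^sub>\<le>\<^sub>0" using Re_p[OF w] by (auto simp: complex_nonpos_Reals_iff)
      then have "((\<lambda>w. Ln (p w)) has_field_derivative inverse (p w) * (- \<i> * (of_real z * exp (\<i> * w)))) (at w)"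
        by (rule DERIV_chain2[OF has_field_derivative_Ln dp])
      also have "inverse (p w) * (- \<i> * (of_real z * exp (\<i> * w))) = - \<i> * y w"
        by (simp add: y_def divide_inverse mult_ac)
      finally have "((\<lambda>w. Ln (p w)) has_field_derivative - \<i> * y w) (at w within \<real>)"
        by (rule has_field_derivative_at_within)
      then show ?thesis using 1 unfolding f_def by simp
    next
      case 2
      have "((\<lambda>w. - \<i> * y w) has_field_derivative - \<i> * (\<i> * (y w + (y w)\<^sup>2))) (at w within \<real>)"
        by (rule DERIV_cmult[OF dy'])
      then show ?thesis using 2 unfolding f_def by (simp add: add.commute)
    next
      case 3
      have "((\<lambda>w. y w + (y w)\<^sup>2) has_field_derivative \<i> * (y w + (y w)\<^sup>2) + 2 * y w * (\<i> * (y w + (y w)\<^sup>2))) (at w within \<real>)"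
        using dy' by (auto intro!: derivative_eq_intros)
      moreover have "\<i> * (y w + (y w)\<^sup>2) + 2 * y w * (\<i> * (y w + (y w)\<^sup>2)) = \<i> * ((1 + 2 * y w) * (y w + (y w)\<^sup>2))"
        by (simp add: algebra_simps)
      ultimately show ?thesis using 3 unfolding f_def by simp
    next
      case 4
      let ?e = "\<i> * (y w + (y w)\<^sup>2)"
      have "((\<lambda>w. \<i> * ((1 + 2 * y w) * (y w + (y w)\<^sup>2))) has_field_derivative
          \<i> * (2 * ?e * (y w + (y w)\<^sup>2) + (1 + 2 * y w) * (?e + 2 * y w * ?e))) (at w within \<real>)"
        using dy' by (auto intro!: derivative_eq_intros)
      moreover have "\<i> * (2 * (\<i> * e) * e + (1 + 2 * u) * (\<i> * e + 2 * u * (\<i> * e)))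
          = - (e * (1 + 6 * e))" if "e = u + u\<^sup>2" for u e :: complex
      proof -
        have "\<i> * (2 * (\<i> * e) * e + (1 + 2 * u) * (\<i> * e + 2 * u * (\<i> * e))) = (\<i> * \<i>) * (2 * e * e + (1 + 2 * u) * (1 + 2 * u) * e)"
          by (simp only: algebra_simps mult_1_left mult_1_right)
        also have "(1 + 2 * u) * (1 + 2 * u) = 1 + 4 * e" unfolding that by (simp add: power2_eq_square algebra_simps)
        finally show ?thesis by (simp add: algebra_simps)
      qed
      ultimately show ?thesis using 4 unfolding f_def by simp
    qed
  qed
  have bound: "norm (f (Suc 3) w) \<le> D * (1 + 6 * D)" if wR: "w \<in> \<real>" for w
  proof -
    obtain t where w: "w = of_real t" using Reals_cases[OF wR] by blast
    have "norm (y w) = z / norm (p w)" using z by (simp add: y_def w norm_divide norm_mult)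
    also have "\<dots> \<le> z / 1" using norm_p[OF wR] z by (intro divide_left_mono) auto
    finally have "norm (y w) \<le> z" by simp
    then have e: "norm (y w + (y w)\<^sup>2) \<le> D"
      unfolding D_def by (intro order_trans[OF norm_triangle_ineq] add_mono) (auto simp: norm_power power_mono)
    have "norm (1 + 6 * (y w + (y w)\<^sup>2)) \<le> norm (1 :: complex) + norm (6 * (y w + (y w)\<^sup>2))"
      by (rule norm_triangle_ineq)
    also have "\<dots> = 1 + 6 * norm (y w + (y w)\<^sup>2)" unfolding norm_mult by simp
    also have "\<dots> \<le> 1 + 6 * D" using e by simp
    finally have "norm (1 + 6 * (y w + (y w)\<^sup>2)) \<le> 1 + 6 * D" .
    then have "norm (y w + (y w)\<^sup>2) * norm (1 + 6 * (y w + (y w)\<^sup>2)) \<le> D * (1 + 6 * D)"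
      using e order_trans[OF norm_ge_zero e] by (intro mult_mono) auto
    then show ?thesis by (simp add: f_def norm_mult)
  qed
  have p0: "p 0 = 1" and y0: "y 0 = of_real z" by (simp_all add: p_def y_def)
  \<comment> \<open>Taylor's formula along the convex set of reals inside the complex plane. This
    form of the remainder has \<open>fact 3\<close> in the denominator, hence the 6 in the final
    constant.\<close>
  have "norm (f 0 (of_real x) - (\<Sum>i\<le>3. f i 0 * (of_real x - 0) ^ i / fact i)) \<le> D * (1 + 6 * D) * norm (of_real x - 0 :: complex) ^ Suc 3 / fact 3"
  proof (rule field_Taylor[where S = "\<real>" and n = 3 and f = f])
    show "convex (\<real> :: complex set)" by (rule convex_Reals)
  qed (use df bound in auto)
  moreover have "(\<Sum>i\<le>3. f i 0 * (of_real x - 0) ^ i / fact i)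
      = - \<i> * of_real (z * x) + of_real (D * x\<^sup>2 / 2) + \<i> * of_real (D * (1 + 2 * z) / 6 * x ^ 3)"
  proof -
    have "{..3::nat} = {0, 1, 2, 3}" by auto
    then show ?thesis
      by (simp add: f_def p0 y0 D_def fact_numeral)
  qed
  ultimately have le: "norm (Ln (p x) - (- \<i> * of_real (z * x) + of_real (D * x\<^sup>2 / 2) + \<i> * of_real (D * (1 + 2 * z) / 6 * x ^ 3)))
      \<le> D * (1 + 6 * D) / 6 * x ^ 4"
    by (simp add: f_def fact_numeral norm_power)
  define \<rho> where "\<rho> = - (Ln (p x) - (- \<i> * of_real (z * x) + of_real (D * x\<^sup>2 / 2) + \<i> * of_real (D * (1 + 2 * z) / 6 * x ^ 3)))"
  show thesis
  proof (rule that)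
    show "norm \<rho> \<le> D * (1 + 6 * D) / 6 * x ^ 4" unfolding \<rho>_def norm_minus_cancel by (rule le)
    have px: "p x \<noteq> 0" using norm_p[of "of_real x"] by auto
    have "geom_factor z x = exp (- \<i> * of_real (z * x)) / exp (Ln (p x))"
      using px by (simp add: geom_factor_def pcis cis_conv_exp mult_ac)
    also have "\<dots> = exp (- \<i> * of_real (z * x) - Ln (p x))" by (simp add: exp_diff)
    also have "- \<i> * of_real (z * x) - Ln (p x)
      = of_real (- D * x\<^sup>2 / 2) + \<i> * of_real (- (D * (1 + 2 * z) / 6) * x ^ 3) + \<rho>"
      unfolding \<rho>_def by (simp add: algebra_simps)
    finally show "geom_factor z x = exp (of_real (- D * x\<^sup>2 / 2) + \<i> * of_real (- (D * (1 + 2 * z) / 6) * x ^ 3) + \<rho>)" .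
  qed
qed

lemma norm_exp_minus_1_le:
  fixes w :: complex
  assumes "norm w \<le> 1"
  shows "norm (exp w - 1) \<le> 3 * norm w"
proof -
  have "norm (exp w - (\<Sum>i\<le>0. exp 0 * (w - 0) ^ i / fact i)) \<le> 3 * norm (w - 0) ^ Suc 0 / fact 0"
  proof (rule field_Taylor[where S = "cball 0 1" and f = "\<lambda>_. exp"])
    fix x :: complex assume x: "x \<in> cball 0 1"
    show "(exp has_field_derivative exp x) (at x within cball 0 1)"
      by (rule has_field_derivative_at_within[OF DERIV_exp])
    have "norm (exp x) \<le> exp (norm x)" by (simp add: complex_Re_le_cmod)
    also have "\<dots> \<le> exp 1" using x by simp
    also have "\<dots> \<le> 3" by (rule exp_le)
    finally show "norm (exp x) \<le> 3" .
  qed (use assms in auto)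
  then show ?thesis by simp
qed

text \<open>A weak Jordan inequality: since x \<le> 2, the Taylor error x^3 / 6 is at most 2 x /
  3.\<close>

lemma sin_ge_third:
  assumes "0 \<le> x" "x \<le> pi / 2"
  shows "x / 3 \<le> sin x"
proof -
  have x2: "x \<le> 2" using assms pi_less_4 by simp
  have "\<bar>sin x - (\<Sum>m<3. sin_coeff m * x ^ m)\<bar> \<le> inverse (fact 3) * \<bar>x\<bar> ^ 3"
    by (rule Maclaurin_sin_bound)
  moreover have "(\<Sum>m<3. sin_coeff m * x ^ m) = x"
    by (simp add: eval_nat_numeral sin_coeff_def)
  ultimately have "\<bar>sin x - x\<bar> \<le> x ^ 3 / 6" using assms by (simp add: fact_numeral)
  then have "x - x ^ 3 / 6 \<le> sin x" by linarith
  moreover have "x ^ 3 \<le> 4 * x"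
    using mult_mono[of "x * x" "2 * 2" x x] mult_mono[OF x2 x2] assms by (simp add: power3_eq_cube)
  ultimately show ?thesis by simp
qed

section \<open>Fourier inversion\<close>

abbreviation torus_box :: "nat set \<Rightarrow> (nat \<Rightarrow> real) set" where
  "torus_box I \<equiv> PiE I (\<lambda>_. {- pi..pi})"

lemma emeasure_torus_box: "finite I \<Longrightarrow> emeasure (LB I) (torus_box I) = ennreal ((2 * pi) ^ card I)"
  by (subst lborel_prod.emeasure_PiM) (auto simp: ennreal_power)

lemma has_bochner_integral_cis_period:
  fixes c :: int
  shows "has_bochner_integral lborel (\<lambda>y. indicator {- pi..pi} y *\<^sub>R cis (of_int c * y)) (if c = 0 then of_real (2 * pi) else 0)"
proof (cases "c = 0")
  case True
  have "has_bochner_integral lborel (\<lambda>y. indicator {- pi..pi} y *\<^sub>R (1 :: complex)) (of_real pi - of_real (- pi))"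
    by (rule has_bochner_integral_FTC_Icc) (auto intro!: derivative_eq_intros continuous_intros)
  then show ?thesis using True by (simp add: algebra_simps)
next
  case False
  let ?F = "\<lambda>y. cis (of_int c * y) / (\<i> * of_int c)"
  have "has_bochner_integral lborel (\<lambda>y. indicator {- pi..pi} y *\<^sub>R cis (of_int c * y)) (?F pi - ?F (- pi))"
  proof (rule has_bochner_integral_FTC_Icc)
    fix x :: real
    have "((\<lambda>w. exp (\<i> * of_int c * w) / (\<i> * of_int c)) has_field_derivative exp (\<i> * of_int c * of_real x)) (at (of_real x))"
      using False by (auto intro!: derivative_eq_intros)
    then have "((\<lambda>y. exp (\<i> * of_int c * of_real y) / (\<i> * of_int c)) has_vector_derivative exp (\<i> * of_int c * of_real x)) (at x within {- pi..pi})"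
      by (rule has_vector_derivative_real_field)
    then show "(?F has_vector_derivative cis (of_int c * x)) (at x within {- pi..pi})"
      by (simp add: cis_conv_exp mult_ac)
  next
    show "continuous_on {- pi..pi} (\<lambda>y. cis (of_int c * y))" unfolding cis_conv_exp by (intro continuous_intros)
  qed simp
  moreover have "cis (of_int c * pi) = cis (of_int c * (- pi))"
  proof -
    have "cis (of_int c * pi) = cis (of_int c * (- pi)) * cis (2 * pi * of_int c)"
      by (simp add: cis_mult algebra_simps)
    then show ?thesis by (simp add: cis_multiple_2pi)
  qed
  ultimately show ?thesis using False by simp
qed

lemma integral_torus_character:
  fixes c :: "nat \<Rightarrow> real"
  assumes I: "finite I" and c: "\<And>i. i \<in> I \<Longrightarrow> c i \<in> \<int>"
  shows "has_bochner_integral (LB I) (\<lambda>t. indicator (torus_box I) t *\<^sub>R cis (lin I c t))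
    (if \<forall>i\<in>I. c i = 0 then of_real ((2 * pi) ^ card I) else 0)"
proof -
  let ?f = "\<lambda>i y. indicator {- pi..pi} y *\<^sub>R cis (c i * y)"
  have f: "has_bochner_integral lborel (?f i) (if c i = 0 then of_real (2 * pi) else 0)" if "i \<in> I" for i
  proof -
    obtain k :: int where "c i = of_int k" using c[OF \<open>i \<in> I\<close>] by (rule Ints_cases)
    then show ?thesis using has_bochner_integral_cis_period[of k] by simp
  qed
  have cis_sum: "cis (\<Sum>i\<in>J. x i) = (\<Prod>i\<in>J. cis (x i))" if "finite J" for J and x :: "nat \<Rightarrow> real"
    using that by (induction J rule: finite_induct) (auto simp: cis_mult[symmetric])
  have eq: "indicator (torus_box I) t *\<^sub>R cis (lin I c t) = (\<Prod>i\<in>I. ?f i (t i))" if sp: "t \<in> space (LB I)" for t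
  proof (cases "t \<in> torus_box I")
    case True
    then show ?thesis by (simp add: lin_def cis_sum[OF I] PiE_iff)
  next
    case False
    then obtain i where "i \<in> I" "t i \<notin> {- pi..pi}" using sp by (auto simp: space_PiM PiE_iff)
    then have "(\<Prod>i\<in>I. ?f i (t i)) = 0" using I by (intro prod_zero bexI[of _ i]) auto
    then show ?thesis using False by simp
  qed
  have int: "integrable (LB I) (\<lambda>t. \<Prod>i\<in>I. ?f i (t i))"
    by (rule lborel_prod.product_integrable_prod[OF I]) (use f in \<open>auto simp: has_bochner_integral_iff\<close>)
  moreover have "(\<integral>t. (\<Prod>i\<in>I. ?f i (t i)) \<partial>LB I) = (\<Prod>i\<in>I. if c i = 0 then of_real (2 * pi) else 0)"
    by (subst lborel_prod.product_integral_prod[OF I])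
       (use f in \<open>auto simp: has_bochner_integral_iff intro!: prod.cong\<close>)
  moreover have "(\<Prod>i\<in>I. if c i = 0 then of_real (2 * pi) else 0) = (if \<forall>i\<in>I. c i = 0 then of_real ((2 * pi) ^ card I) else (0::complex))"
    using I by (auto simp: prod_constant intro!: prod_zero)
  ultimately have "has_bochner_integral (LB I) (\<lambda>t. \<Prod>i\<in>I. ?f i (t i)) (if \<forall>i\<in>I. c i = 0 then of_real ((2 * pi) ^ card I) else 0)"
    by (simp add: has_bochner_integral_iff)
  then show ?thesis by (subst has_bochner_integral_cong[OF refl eq refl])
qed

text \<open>The probability of n under the geometric law on the naturals with mean z.\<close>

definition geom_weight :: "real \<Rightarrow> nat \<Rightarrow> real" where
  "geom_weight z n = 1 / (1 + z) * (z / (1 + z)) ^ n"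

text \<open>Truncations of the characteristic function of the centred geometric law. The bound 1,
  uniform in M and x, serves dominated convergence.\<close>

lemma geometric_partial_sums:
  assumes z: "0 \<le> z"
  shows "(\<lambda>M. \<Sum>n\<le>M. of_real (geom_weight z n) * cis ((real n - z) * x)) \<longlonglongrightarrow> geom_factor z x"
    and "norm (\<Sum>n\<le>M. of_real (geom_weight z n) * cis ((real n - z) * x)) \<le> 1"
proof -
  define u where "u = of_real (z / (1 + z)) * cis x"
  define p where "p = 1 / (1 + z)"
  have nu: "norm u = z / (1 + z)" using z unfolding u_def norm_mult norm_of_real norm_cis by simp
  then have u1: "norm u < 1" using z by simp
  have trm: "of_real (geom_weight z n) * cis ((real n - z) * x) = of_real p * cis (- z * x) * u ^ n" for n
  proof -
    have "cis ((real n - z) * x) = cis (- z * x) * cis x ^ n"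
      unfolding Complex.DeMoivre cis_mult by (rule arg_cong[of _ _ cis]) (simp add: algebra_simps)
    then show ?thesis unfolding geom_weight_def p_def[symmetric] u_def power_mult_distrib of_real_mult of_real_power by (simp only: mult_ac)
  qed
  have "(\<lambda>n. u ^ n) sums (1 / (1 - u))" by (rule geometric_sums[OF u1])
  then have "(\<lambda>n. of_real p * cis (- z * x) * u ^ n) sums (of_real p * cis (- z * x) * (1 / (1 - u)))"
    by (rule sums_mult)
  moreover have "of_real p * cis (- z * x) * (1 / (1 - u)) = geom_factor z x"
  proof -
    have z1: "1 + of_real z \<noteq> (0 :: complex)" using z by (simp add: complex_eq_iff)
    have "(1 + of_real z) * (1 - u) = 1 + of_real z - of_real z * cis x"
      unfolding u_def using z1 by (simp add: right_diff_distrib)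
    then have "geom_factor z x = cis (- z * x) / ((1 + of_real z) * (1 - u))" by (simp add: geom_factor_def)
    then show ?thesis by (simp add: p_def)
  qed
  ultimately show "(\<lambda>M. \<Sum>n\<le>M. of_real (geom_weight z n) * cis ((real n - z) * x)) \<longlonglongrightarrow> geom_factor z x"
    unfolding trm by (simp add: sums_def_le)
  have "norm (\<Sum>n\<le>M. of_real p * cis (- z * x) * u ^ n) \<le> (\<Sum>n\<le>M. p * (z / (1 + z)) ^ n)"
    proof (intro sum_norm_le)
    fix n
    have "p \<ge> 0" using z by (simp add: p_def)
    then have "norm (of_real p :: complex) = p" by simp
    then show "norm (of_real p * cis (- z * x) * u ^ n) \<le> p * (z / (1 + z)) ^ n"
      by (simp only: norm_mult norm_power nu norm_cis mult_1_right order_refl)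
  qed
  also have "\<dots> \<le> 1"
  proof -
    let ?q = "z / (1 + z)"
    have q: "0 \<le> ?q" "?q < 1" "p = 1 - ?q" using z by (auto simp: p_def field_simps)
    have "(\<Sum>n\<le>M. p * ?q ^ n) = p * (\<Sum>n<Suc M. ?q ^ n)" by (simp add: sum_distrib_left lessThan_Suc_atMost)
    also have "\<dots> = 1 - ?q ^ Suc M" unfolding q(3) by (rule one_diff_power_eq[symmetric])
    also have "\<dots> \<le> 1" using zero_le_power[OF q(1), of "Suc M"] by linarith
    finally show ?thesis .
  qed
  finally show "norm (\<Sum>n\<le>M. of_real (geom_weight z n) * cis ((real n - z) * x)) \<le> 1"
    unfolding trm .
qed

text \<open>Truncation at M makes the product a finite trigonometric sum with integer frequencies,
  and integration over the torus keeps exactly the solutions. All solutions have the same weight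
  \<open>W\<close>, so their total weight is a count.\<close>

theorem fourier_count:
  fixes V :: "'m set" and I :: "nat set" and a :: "'m \<Rightarrow> nat \<Rightarrow> real" and z :: "'m \<Rightarrow> real"
  assumes V: "finite V" and I: "finite I" and z: "\<And>m. m \<in> V \<Longrightarrow> 0 \<le> z m"
    and a: "\<And>m i. m \<in> V \<Longrightarrow> i \<in> I \<Longrightarrow> a m i \<in> \<int>"
    and b: "\<And>i. i \<in> I \<Longrightarrow> (\<Sum>m\<in>V. z m * a m i) \<in> \<int>"
  defines "X \<equiv> {x \<in> V \<rightarrow>\<^sub>E (UNIV :: nat set). \<forall>i\<in>I. (\<Sum>m\<in>V. real (x m) * a m i) = (\<Sum>m\<in>V. z m * a m i)}"
  assumes X: "finite X"
    and W: "\<And>x. x \<in> X \<Longrightarrow> (\<Prod>m\<in>V. geom_weight (z m) (x m)) = W"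
  defines "F \<equiv> \<lambda>t. \<Prod>m\<in>V. geom_factor (z m) (lin I (a m) t)"
  shows "(\<integral>t. indicator (torus_box I) t *\<^sub>R F t \<partial>LB I) = of_real (real (card X) * W * (2 * pi) ^ card I)"
    and "integrable (LB I) (\<lambda>t. indicator (torus_box I) t *\<^sub>R F t)"
proof -
  define s where "s M t = (\<Prod>m\<in>V. \<Sum>n\<le>M. of_real (geom_weight (z m) n) * cis ((real n - z m) * lin I (a m) t))"
    for M :: nat and t
  define w where "w x = (\<Prod>m\<in>V. geom_weight (z m) (x m))" for x :: "'m \<Rightarrow> nat"
  define c where "c x i = (\<Sum>m\<in>V. (real (x m) - z m) * a m i)" for x :: "'m \<Rightarrow> nat" and i
  have cis_sum: "cis (\<Sum>m\<in>J. y m) = (\<Prod>m\<in>J. cis (y m))" if "finite J" for J and y :: "'m \<Rightarrow> real"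
    using that by (induction J rule: finite_induct) (auto simp: cis_mult[symmetric])
  have lin_c: "(\<Sum>m\<in>V. (real (x m) - z m) * lin I (a m) t) = lin I (c x) t" for x t
  proof -
    have "(\<Sum>m\<in>V. (real (x m) - z m) * lin I (a m) t) = (\<Sum>m\<in>V. \<Sum>i\<in>I. (real (x m) - z m) * a m i * t i)"
      by (simp add: lin_def sum_distrib_left mult_ac)
    also have "\<dots> = (\<Sum>i\<in>I. \<Sum>m\<in>V. (real (x m) - z m) * a m i * t i)" by (rule sum.swap)
    finally show ?thesis by (simp add: lin_def c_def sum_distrib_right)
  qed
  have s_eq: "s M t = (\<Sum>x\<in>V \<rightarrow>\<^sub>E {..M}. of_real (w x) * cis (lin I (c x) t))" for M t
    unfolding s_def w_def
    by (subst prod_sum_PiE[OF V]) (auto simp: prod.distrib lin_c[symmetric] cis_sum[OF V] intro!: sum.cong)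
  have c_int: "c x i \<in> \<int>" if "i \<in> I" for x i
  proof -
    have "c x i = (\<Sum>m\<in>V. real (x m) * a m i) - (\<Sum>m\<in>V. z m * a m i)"
      by (simp add: c_def left_diff_distrib sum_subtractf)
    then show ?thesis using a b that by (auto intro!: Ints_diff Ints_sum Ints_mult)
  qed
  have inX: "x \<in> X \<longleftrightarrow> (\<forall>i\<in>I. c x i = 0)" if "x \<in> V \<rightarrow>\<^sub>E {..M}" for x M
    using that by (auto simp: X_def c_def left_diff_distrib sum_subtractf PiE_iff)
  have int_s: "has_bochner_integral (LB I) (\<lambda>t. indicator (torus_box I) t *\<^sub>R s M t)
      (of_real (real (card (X \<inter> (V \<rightarrow>\<^sub>E {..M}))) * W * (2 * pi) ^ card I))" for M
  proof -
    have finP: "finite (V \<rightarrow>\<^sub>E {..M})" using V by (intro finite_PiE) auto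
    have "has_bochner_integral (LB I) (\<lambda>t. \<Sum>x\<in>V \<rightarrow>\<^sub>E {..M}. of_real (w x) * (indicator (torus_box I) t *\<^sub>R cis (lin I (c x) t)))
      (\<Sum>x\<in>V \<rightarrow>\<^sub>E {..M}. of_real (w x) * (if \<forall>i\<in>I. c x i = 0 then of_real ((2 * pi) ^ card I) else 0))"
      by (intro has_bochner_integral_sum has_bochner_integral_mult_right integral_torus_character[OF I] c_int)
    moreover have "(\<lambda>t. \<Sum>x\<in>V \<rightarrow>\<^sub>E {..M}. of_real (w x) * (indicator (torus_box I) t *\<^sub>R cis (lin I (c x) t)))
        = (\<lambda>t. indicator (torus_box I) t *\<^sub>R s M t)"
      by (auto simp: s_eq scaleR_sum_right)
    moreover have "(\<Sum>x\<in>V \<rightarrow>\<^sub>E {..M}. of_real (w x) * (if \<forall>i\<in>I. c x i = 0 then of_real ((2 * pi) ^ card I) else 0))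
        = (of_real (real (card (X \<inter> (V \<rightarrow>\<^sub>E {..M}))) * W * (2 * pi) ^ card I) :: complex)"
    proof -
      have "(\<Sum>x\<in>V \<rightarrow>\<^sub>E {..M}. of_real (w x) * (if \<forall>i\<in>I. c x i = 0 then of_real ((2 * pi) ^ card I) else 0))
         = (\<Sum>x\<in>V \<rightarrow>\<^sub>E {..M}. if x \<in> X then of_real (W * (2 * pi) ^ card I) else (0 :: complex))"
        using inX W by (intro sum.cong) (auto simp: w_def simp del: of_real_prod)
      also have "\<dots> = (\<Sum>x\<in>X \<inter> (V \<rightarrow>\<^sub>E {..M}). of_real (W * (2 * pi) ^ card I))"
        using finP by (subst sum.inter_restrict[symmetric]) (auto simp: Int_commute)
      finally show ?thesis by simp
    qed
    ultimately show ?thesis by simp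
  qed
  have lim: "(\<lambda>M. indicator (torus_box I) t *\<^sub>R s M t) \<longlonglongrightarrow> indicator (torus_box I) t *\<^sub>R F t" for t
    unfolding s_def F_def by (intro tendsto_scaleR tendsto_const tendsto_prod geometric_partial_sums z)
  have bound: "norm (indicator (torus_box I) t *\<^sub>R s M t) \<le> indicator (torus_box I) t" for t M
  proof -
    have "norm (s M t) \<le> (\<Prod>m\<in>V. 1)"
      unfolding s_def prod_norm[symmetric]
      by (intro prod_mono conjI norm_ge_zero geometric_partial_sums(2) z)
    then show ?thesis by (auto simp: indicator_def)
  qed
  have Fm: "(\<lambda>t. indicator (torus_box I) t *\<^sub>R F t) \<in> borel_measurable (LB I)"
    using I unfolding F_def by measurable
  have int1: "integrable (LB I) (indicator (torus_box I) :: _ \<Rightarrow> real)"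
    using I by (simp add: emeasure_torus_box less_top[symmetric])
  note dct = int1 Fm lim bound
  have sm: "(\<lambda>t. indicator (torus_box I) t *\<^sub>R s M t) \<in> borel_measurable (LB I)" for M
    using int_s[of M] by (rule borel_measurable_has_bochner_integral)
  show "integrable (LB I) (\<lambda>t. indicator (torus_box I) t *\<^sub>R F t)"
    by (rule integrable_dominated_convergence[where s = "\<lambda>M t. indicator (torus_box I) t *\<^sub>R s M t", OF Fm sm int1]) (use lim bound in auto)
  have conv: "(\<lambda>M. \<integral>t. indicator (torus_box I) t *\<^sub>R s M t \<partial>LB I) \<longlonglongrightarrow> (\<integral>t. indicator (torus_box I) t *\<^sub>R F t \<partial>LB I)"
    by (rule integral_dominated_convergence[where s = "\<lambda>M t. indicator (torus_box I) t *\<^sub>R s M t", OF Fm sm int1]) (use lim bound in auto)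
  \<comment> \<open>As \<open>X\<close> is finite, truncation eventually captures all of it, and the
    sequence of integrals becomes constant.\<close>
  obtain M0 where M0: "\<And>x m. x \<in> X \<Longrightarrow> m \<in> V \<Longrightarrow> x m \<le> M0"
  proof -
    have "finite ((\<lambda>(x, m). x m) ` (X \<times> V))" using X V by blast
    then obtain M0 where "\<forall>y\<in>(\<lambda>(x, m). x m) ` (X \<times> V). y \<le> M0" using finite_nat_set_iff_bounded_le by blast
    then show thesis by (intro that[of M0]) auto
  qed
  have "(\<integral>t. indicator (torus_box I) t *\<^sub>R s M t \<partial>LB I) = of_real (real (card X) * W * (2 * pi) ^ card I)" if "M \<ge> M0" for M
  proof -
    have "X \<inter> (V \<rightarrow>\<^sub>E {..M}) = X"
    proof (rule Int_absorb2, rule subsetI)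
      fix x assume x: "x \<in> X"
      then have "x \<in> extensional V" by (simp add: X_def PiE_iff)
      moreover have "x m \<le> M" if "m \<in> V" for m using M0[OF x that] \<open>M \<ge> M0\<close> by simp
      ultimately show "x \<in> V \<rightarrow>\<^sub>E {..M}" by (simp add: PiE_iff)
    qed
    then show ?thesis using has_bochner_integral_integral_eq[OF int_s[of M]] by simp
  qed
  then have "eventually (\<lambda>M. (\<integral>t. indicator (torus_box I) t *\<^sub>R s M t \<partial>LB I) = of_real (real (card X) * W * (2 * pi) ^ card I)) sequentially"
    unfolding eventually_sequentially by blast
  then have "(\<lambda>M. \<integral>t. indicator (torus_box I) t *\<^sub>R s M t \<partial>LB I) \<longlonglongrightarrow> of_real (real (card X) * W * (2 * pi) ^ card I)"
    by (rule tendsto_eventually)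
  then show "(\<integral>t. indicator (torus_box I) t *\<^sub>R F t \<partial>LB I) = of_real (real (card X) * W * (2 * pi) ^ card I)"
    using conv LIMSEQ_unique by blast
qed

section \<open>Comparison with the Gaussian integral\<close>

lemma abs_sin_diff_le: "\<bar>sin (x - y)\<bar> \<le> \<bar>sin x\<bar> + \<bar>sin y\<bar>" for x y :: real
proof -
  have "\<bar>sin (x - y)\<bar> \<le> \<bar>sin x * cos y\<bar> + \<bar>cos x * sin y\<bar>" unfolding sin_diff by (rule abs_triangle_ineq4)
  also have "\<dots> \<le> \<bar>sin x\<bar> + \<bar>sin y\<bar>"
    unfolding abs_mult by (intro add_mono mult_left_le mult_left_le_one_le) auto
  finally show ?thesis .
qed

lemma one_minus_cos_le: "\<bar>cos x - 1\<bar> \<le> x\<^sup>2 / 2" for x :: real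
proof -
  have "cos x = 1 - 2 * (sin (x / 2))\<^sup>2" using cos_double_sin[of "x / 2"] by simp
  moreover have "(sin (x / 2))\<^sup>2 \<le> (x / 2)\<^sup>2"
    using abs_sin_x_le_abs_x[of "x / 2"] by (metis abs_ge_zero power2_abs power_mono)
  ultimately show ?thesis by (simp add: power_divide)
qed

text \<open>What the analysis needs from the array: the two leverage inequalities, the recovery of
  each coordinate from at most two forms, and bounded row sums. The last two translate between
  smallness of t and smallness of all \<lambda>_m.\<close>

locale gauss_core =
  fixes V :: "'m set" and I :: "nat set" and d :: nat and a :: "'m \<Rightarrow> nat \<Rightarrow> real"
    and z :: "'m \<Rightarrow> real" and r R L \<nu> :: real
  assumes fin_V: "finite V" and I_sub: "I \<subseteq> {..<d}"
    and z_nonneg: "\<And>m. m \<in> V \<Longrightarrow> 0 \<le> z m"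
    and r_pos: "0 < r" and R_ge: "1 \<le> R" and L_pos: "0 < L" and nu_nonneg: "0 \<le> \<nu>"
    and D_lower: "\<And>m. m \<in> V \<Longrightarrow> r \<le> z m + (z m)\<^sup>2"
    and D_upper: "\<And>m. m \<in> V \<Longrightarrow> z m + (z m)\<^sup>2 \<le> R"
    and leverage: "\<And>m t. m \<in> V \<Longrightarrow> (lin I (a m) t)\<^sup>2 \<le> L * (\<Sum>p\<in>V. (lin I (a p) t)\<^sup>2)"
    and leverage_sin: "\<And>m t. m \<in> V \<Longrightarrow>
      (sin (lin I (a m) t / 2))\<^sup>2 \<le> L * (\<Sum>p\<in>V. (sin (lin I (a p) t / 2))\<^sup>2)"
    and coordinate: "\<And>i. i \<in> I \<Longrightarrow>
      \<exists>m\<in>V. \<exists>p\<in>V. \<exists>e\<in>{0, 1}. \<forall>t. t i = lin I (a m) t - e * lin I (a p) t"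
    and row_sum: "\<And>m. m \<in> V \<Longrightarrow> (\<Sum>i\<in>I. \<bar>a m i\<bar>) \<le> \<nu>"
begin

lemma coordinate_abs_le:
  assumes i: "i \<in> I" and b: "\<And>m. m \<in> V \<Longrightarrow> \<bar>lin I (a m) t\<bar> \<le> b"
  shows "\<bar>t i\<bar> \<le> 2 * b"
proof -
  obtain m p e where m: "m \<in> V" "p \<in> V" "e \<in> {0, 1}" "t i = lin I (a m) t - e * lin I (a p) t"
    using coordinate[OF i] by blast
  then have "e = 0 \<or> e = 1" by simp
  then show ?thesis using m(4) b[OF m(1)] b[OF m(2)] by auto
qed

lemma coordinate_sq_le:
  assumes i: "i \<in> I"
  shows "(t i)\<^sup>2 \<le> 4 * (\<Sum>m\<in>V. (lin I (a m) t)\<^sup>2)"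
proof -
  let ?S = "\<Sum>m\<in>V. (lin I (a m) t)\<^sup>2"
  have "\<bar>lin I (a m) t\<bar> \<le> sqrt ?S" if "m \<in> V" for m
  proof -
    have "(lin I (a m) t)\<^sup>2 \<le> ?S" using that fin_V by (intro member_le_sum) auto
    then have "sqrt ((lin I (a m) t)\<^sup>2) \<le> sqrt ?S" by (rule real_sqrt_le_mono)
    then show ?thesis by simp
  qed
  then have "\<bar>t i\<bar> \<le> 2 * sqrt ?S" by (rule coordinate_abs_le[OF i])
  then have "(t i)\<^sup>2 \<le> (2 * sqrt ?S)\<^sup>2" by (metis abs_ge_zero power2_abs power_mono)
  also have "\<dots> = 4 * ?S" by (simp add: power_mult_distrib sum_nonneg)
  finally show ?thesis .
qed

lemma sum_sq_le: "r * (\<Sum>m\<in>V. (lin I (a m) t)\<^sup>2) \<le> (\<Sum>m\<in>V. (z m + (z m)\<^sup>2) * (lin I (a m) t)\<^sup>2)"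
  unfolding sum_distrib_left by (intro sum_mono mult_right_mono D_lower) auto

text \<open>Each (t i)^2 is at most 4 times the sum of all \<lambda>_m^2; summation over
  \<open>I\<close> yields the constant, and the added 1 keeps its denominator positive when
  \<open>I\<close> is empty.\<close>

sublocale gaussian_form V I d a "\<lambda>m. z m + (z m)\<^sup>2" "r / (4 * real (card I) + 1)"
proof
  show "finite V" by (rule fin_V)
  show "I \<subseteq> {..<d}" by (rule I_sub)
  show "z m + (z m)\<^sup>2 > 0" if "m \<in> V" for m using D_lower[OF that] r_pos by simp
  show "r / (4 * real (card I) + 1) > 0" using r_pos by (simp add: add_nonneg_pos)
  fix t
  let ?S = "\<Sum>m\<in>V. (lin I (a m) t)\<^sup>2"
  have S0: "?S \<ge> 0" by (intro sum_nonneg) auto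
  have "(\<Sum>i\<in>I. (t i)\<^sup>2) \<le> (\<Sum>i\<in>I. 4 * ?S)" by (intro sum_mono coordinate_sq_le)
  also have "\<dots> \<le> (4 * real (card I) + 1) * ?S" using S0 by (simp add: algebra_simps)
  finally have "r / (4 * real (card I) + 1) * (\<Sum>i\<in>I. (t i)\<^sup>2) \<le> r / (4 * real (card I) + 1) * ((4 * real (card I) + 1) * ?S)"
    using r_pos by (intro mult_left_mono) auto
  also have "\<dots> = r * ?S"
  proof -
    have "4 * real (card I) + 1 \<noteq> 0" by (simp add: add_nonneg_eq_0_iff)
    then show ?thesis by simp
  qed
  also have "\<dots> \<le> (\<Sum>m\<in>V. (z m + (z m)\<^sup>2) * (lin I (a m) t)\<^sup>2)" by (rule sum_sq_le)
  finally show "r / (4 * real (card I) + 1) * (\<Sum>i\<in>I. (t i)\<^sup>2) \<le> (\<Sum>m\<in>V. (z m + (z m)\<^sup>2) * (lin I (a m) t)\<^sup>2)" .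
qed

definition F :: "(nat \<Rightarrow> real) \<Rightarrow> complex" where
  "F t = (\<Prod>m\<in>V. geom_factor (z m) (lin I (a m) t))"

definition K4 :: real where "K4 = R * (1 + 6 * R) / 6"

definition cubic :: "(nat \<Rightarrow> real) \<Rightarrow> real" where
  "cubic t = (\<Sum>m\<in>V. - ((z m + (z m)\<^sup>2) * (1 + 2 * z m) / 6) * lin I (a m) t ^ 3)"

lemma F_measurable [measurable]: "F \<in> borel_measurable (LB I)"
  unfolding F_def by measurable

lemma K4_nonneg: "K4 \<ge> 0"
  using R_ge by (simp add: K4_def)

lemma K4_bound:
  assumes "m \<in> V"
  shows "(z m + (z m)\<^sup>2) * (1 + 6 * (z m + (z m)\<^sup>2)) / 6 * x ^ 4 \<le> K4 * x ^ 4"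
  unfolding K4_def using D_upper[OF assms] D_lower[OF assms] r_pos
  by (intro mult_right_mono divide_right_mono mult_mono) (auto simp: zero_le_even_power)

lemma F_taylor:
  obtains \<rho> where "F t = exp (of_real (- q t) + \<i> * of_real (cubic t) + \<rho>)"
    and "norm \<rho> \<le> K4 * (\<Sum>m\<in>V. lin I (a m) t ^ 4)"
proof -
  have "\<exists>\<rho>. \<forall>m\<in>V. geom_factor (z m) (lin I (a m) t) = exp (of_real (- (z m + (z m)\<^sup>2) * (lin I (a m) t)\<^sup>2 / 2)
      + \<i> * of_real (- ((z m + (z m)\<^sup>2) * (1 + 2 * z m) / 6) * lin I (a m) t ^ 3) + \<rho> m)
      \<and> norm (\<rho> m) \<le> K4 * lin I (a m) t ^ 4"
  proof (intro bchoice ballI)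
    fix m assume m: "m \<in> V"
    obtain \<rho> where "geom_factor (z m) (lin I (a m) t) = exp (of_real (- (z m + (z m)\<^sup>2) * (lin I (a m) t)\<^sup>2 / 2)
        + \<i> * of_real (- ((z m + (z m)\<^sup>2) * (1 + 2 * z m) / 6) * lin I (a m) t ^ 3) + \<rho>)"
      and "norm \<rho> \<le> (z m + (z m)\<^sup>2) * (1 + 6 * (z m + (z m)\<^sup>2)) / 6 * lin I (a m) t ^ 4"
      using geom_factor_taylor[OF z_nonneg[OF m], of "lin I (a m) t"] by blast
    then show "\<exists>\<rho>. geom_factor (z m) (lin I (a m) t) = exp (of_real (- (z m + (z m)\<^sup>2) * (lin I (a m) t)\<^sup>2 / 2)
        + \<i> * of_real (- ((z m + (z m)\<^sup>2) * (1 + 2 * z m) / 6) * lin I (a m) t ^ 3) + \<rho>)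
        \<and> norm \<rho> \<le> K4 * lin I (a m) t ^ 4"
      using K4_bound[OF m, of "lin I (a m) t"] by (intro exI[of _ \<rho>] conjI) (assumption, linarith)
  qed
  then obtain \<rho> where \<rho>: "\<And>m. m \<in> V \<Longrightarrow> geom_factor (z m) (lin I (a m) t) = exp (of_real (- (z m + (z m)\<^sup>2) * (lin I (a m) t)\<^sup>2 / 2)
      + \<i> * of_real (- ((z m + (z m)\<^sup>2) * (1 + 2 * z m) / 6) * lin I (a m) t ^ 3) + \<rho> m)"
      "\<And>m. m \<in> V \<Longrightarrow> norm (\<rho> m) \<le> K4 * lin I (a m) t ^ 4" by blast
  show thesis
  proof (rule that)
    have "F t = exp (\<Sum>m\<in>V. of_real (- (z m + (z m)\<^sup>2) * (lin I (a m) t)\<^sup>2 / 2)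
      + \<i> * of_real (- ((z m + (z m)\<^sup>2) * (1 + 2 * z m) / 6) * lin I (a m) t ^ 3) + \<rho> m)"
      unfolding F_def exp_sum[OF fin_V] by (intro prod.cong \<rho>(1)) auto
    also have "(\<Sum>m\<in>V. of_real (- (z m + (z m)\<^sup>2) * (lin I (a m) t)\<^sup>2 / 2)
      + \<i> * of_real (- ((z m + (z m)\<^sup>2) * (1 + 2 * z m) / 6) * lin I (a m) t ^ 3) + \<rho> m)
      = of_real (- q t) + \<i> * of_real (cubic t) + (\<Sum>m\<in>V. \<rho> m)"
    proof -
      have "- q t = (\<Sum>m\<in>V. - (z m + (z m)\<^sup>2) * (lin I (a m) t)\<^sup>2 / 2)"
        unfolding q_def bil_self by (simp only: mult_minus_left minus_divide_left[symmetric] sum_negf sum_divide_distrib)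
      then show ?thesis unfolding cubic_def by (simp only: sum.distrib sum_distrib_left of_real_sum)
    qed
    finally show "F t = exp (of_real (- q t) + \<i> * of_real (cubic t) + (\<Sum>m\<in>V. \<rho> m))" .
    show "norm (\<Sum>m\<in>V. \<rho> m) \<le> K4 * (\<Sum>m\<in>V. lin I (a m) t ^ 4)"
      unfolding sum_distrib_left by (rule sum_norm_le) (rule \<rho>(2))
  qed
qed

text \<open>The cubic term is imaginary. After taking real parts it enters only through
  \<open>1 - cos (cubic t)\<close>, hence quadratically.\<close>

lemma Re_F_near:
  assumes \<delta>: "\<And>m. m \<in> V \<Longrightarrow> \<bar>lin I (a m) t\<bar> \<le> \<delta>" and P: "K4 * real (card V) * \<delta> ^ 4 \<le> 1"
  shows "\<bar>Re (F t) - exp (- q t)\<bar> \<le> exp (- q t) * ((cubic t)\<^sup>2 / 2 + 3 * (K4 * real (card V) * \<delta> ^ 4))"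
proof -
  obtain \<rho> where \<rho>: "F t = exp (of_real (- q t) + \<i> * of_real (cubic t) + \<rho>)"
    "norm \<rho> \<le> K4 * (\<Sum>m\<in>V. lin I (a m) t ^ 4)" by (rule F_taylor)
  have "lin I (a m) t ^ 4 \<le> \<delta> ^ 4" if "m \<in> V" for m
    using power_mono[OF \<delta>[OF that], of 4] by (simp add: power_even_abs)
  then have "(\<Sum>m\<in>V. lin I (a m) t ^ 4) \<le> (\<Sum>m\<in>V. \<delta> ^ 4)" by (rule sum_mono)
  then have "K4 * (\<Sum>m\<in>V. lin I (a m) t ^ 4) \<le> K4 * (real (card V) * \<delta> ^ 4)"
    using K4_nonneg by (intro mult_left_mono) auto
  then have n\<rho>: "norm \<rho> \<le> K4 * real (card V) * \<delta> ^ 4" using \<rho>(2) by (simp add: mult.assoc)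
  have exp\<rho>: "norm (exp \<rho> - 1) \<le> 3 * (K4 * real (card V) * \<delta> ^ 4)"
    using norm_exp_minus_1_le[of \<rho>] n\<rho> P by linarith
  have "F t = of_real (exp (- q t)) * (cis (cubic t) * exp \<rho>)"
    unfolding \<rho>(1) exp_add cis_conv_exp exp_of_real by (simp only: mult.assoc)
  then have ReF: "Re (F t) = exp (- q t) * Re (cis (cubic t) * exp \<rho>)"
    by (simp only: Re_complex_of_real Im_complex_of_real times_complex.sel mult_zero_left diff_zero)
  have "cis (cubic t) * exp \<rho> = cis (cubic t) + cis (cubic t) * (exp \<rho> - 1)" by (simp add: algebra_simps)
  then have "Re (cis (cubic t) * exp \<rho>) - 1 = (cos (cubic t) - 1) + Re (cis (cubic t) * (exp \<rho> - 1))"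
    by (metis (no_types, lifting) add_diff_cancel_right' add_diff_eq cis.sel(1) diff_add_eq plus_complex.sel(1))
  moreover have "\<bar>Re (cis (cubic t) * (exp \<rho> - 1))\<bar> \<le> norm (exp \<rho> - 1)"
    using abs_Re_le_cmod[of "cis (cubic t) * (exp \<rho> - 1)"] by (simp add: norm_mult)
  ultimately have "\<bar>Re (cis (cubic t) * exp \<rho>) - 1\<bar> \<le> (cubic t)\<^sup>2 / 2 + 3 * (K4 * real (card V) * \<delta> ^ 4)"
    using one_minus_cos_le[of "cubic t"] exp\<rho> by linarith
  then have "exp (- q t) * \<bar>Re (cis (cubic t) * exp \<rho>) - 1\<bar> \<le> exp (- q t) * ((cubic t)\<^sup>2 / 2 + 3 * (K4 * real (card V) * \<delta> ^ 4))"
    by (intro mult_left_mono) auto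
  moreover have "Re (F t) - exp (- q t) = exp (- q t) * (Re (cis (cubic t) * exp \<rho>) - 1)"
    unfolding ReF by (simp add: algebra_simps)
  ultimately show ?thesis by (simp add: abs_mult)
qed

text \<open>Small sines control \<lambda>_m only modulo 2 pi. The coordinates, however, lie in
  [- pi, pi], where the sine of the half-angle controls them: |t i| \<le> 12 s1, with 12 = 2 * 6
  from two forms and \<open>sin_ge_third\<close>. The row sums then make \<lambda>_m itself small,
  and the quartic remainder is absorbed by a fraction of q.\<close>

lemma norm_F_middle:
  assumes s1: "\<And>m. m \<in> V \<Longrightarrow> \<bar>sin (lin I (a m) t / 2)\<bar> \<le> s1" and box: "\<And>i. i \<in> I \<Longrightarrow> \<bar>t i\<bar> \<le> pi" and s0: "0 \<le> s1"
  shows "norm (F t) \<le> exp (- (1 - 2 * K4 / r * (12 * \<nu> * s1)\<^sup>2) * q t)"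
proof -
  have ti: "\<bar>t i\<bar> \<le> 12 * s1" if i: "i \<in> I" for i
  proof -
    obtain m p e where m: "m \<in> V" "p \<in> V" "e \<in> {0, 1}" "t i = lin I (a m) t - e * lin I (a p) t"
      using coordinate[OF i] by blast
    have "\<bar>sin (t i / 2)\<bar> \<le> \<bar>sin (lin I (a m) t / 2)\<bar> + \<bar>sin (e * lin I (a p) t / 2)\<bar>"
      unfolding m(4) diff_divide_distrib by (rule abs_sin_diff_le)
    also have "\<dots> \<le> s1 + s1" using m(3) s1[OF m(1)] s1[OF m(2)] s0 by (intro add_mono) auto
    finally have "\<bar>sin (t i / 2)\<bar> \<le> 2 * s1" by simp
    moreover have "\<bar>sin (t i / 2)\<bar> = sin (\<bar>t i\<bar> / 2)"
    proof -
      have "sin (\<bar>t i\<bar> / 2) \<ge> 0" using box[OF i] by (intro sin_ge_zero) auto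
      then show ?thesis by (auto simp: abs_if)
    qed
    moreover have "\<bar>t i\<bar> / 2 / 3 \<le> sin (\<bar>t i\<bar> / 2)" using box[OF i] by (intro sin_ge_third) auto
    ultimately show ?thesis by simp
  qed
  have lam: "\<bar>lin I (a m) t\<bar> \<le> 12 * \<nu> * s1" if "m \<in> V" for m
  proof -
    have "\<bar>lin I (a m) t\<bar> \<le> (\<Sum>i\<in>I. \<bar>a m i\<bar> * \<bar>t i\<bar>)" unfolding lin_def abs_mult[symmetric] by (rule sum_abs)
    also have "\<dots> \<le> (\<Sum>i\<in>I. \<bar>a m i\<bar> * (12 * s1))" by (intro sum_mono mult_left_mono ti) auto
    also have "\<dots> = (\<Sum>i\<in>I. \<bar>a m i\<bar>) * (12 * s1)" by (simp add: sum_distrib_right)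
    also have "\<dots> \<le> \<nu> * (12 * s1)" using row_sum[OF that] s0 by (intro mult_right_mono) auto
    finally show ?thesis by (simp add: mult_ac)
  qed
  define \<epsilon> where "\<epsilon> = 12 * \<nu> * s1"
  obtain \<rho> where \<rho>: "F t = exp (of_real (- q t) + \<i> * of_real (cubic t) + \<rho>)"
    "norm \<rho> \<le> K4 * (\<Sum>m\<in>V. lin I (a m) t ^ 4)" by (rule F_taylor)
  have "lin I (a m) t ^ 4 \<le> \<epsilon>\<^sup>2 * (lin I (a m) t)\<^sup>2" if "m \<in> V" for m
  proof -
    have "(lin I (a m) t)\<^sup>2 \<le> \<epsilon>\<^sup>2" using lam[OF that] unfolding \<epsilon>_def by (metis abs_ge_zero power2_abs power_mono)
    then have "(lin I (a m) t)\<^sup>2 * (lin I (a m) t)\<^sup>2 \<le> \<epsilon>\<^sup>2 * (lin I (a m) t)\<^sup>2" by (intro mult_right_mono) auto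
    then show ?thesis by (simp add: power2_eq_square power4_eq_xxxx mult.assoc)
  qed
  then have "(\<Sum>m\<in>V. lin I (a m) t ^ 4) \<le> \<epsilon>\<^sup>2 * (\<Sum>m\<in>V. (lin I (a m) t)\<^sup>2)"
    unfolding sum_distrib_left by (rule sum_mono)
  also have "\<dots> \<le> \<epsilon>\<^sup>2 * (2 * q t / r)"
  proof (rule mult_left_mono)
    have "r * (\<Sum>m\<in>V. (lin I (a m) t)\<^sup>2) \<le> 2 * q t" using sum_sq_le[of t] unfolding q_def bil_self by simp
    then show "(\<Sum>m\<in>V. (lin I (a m) t)\<^sup>2) \<le> 2 * q t / r" using r_pos by (simp add: pos_le_divide_eq mult.commute)
  qed simp
  finally have "K4 * (\<Sum>m\<in>V. lin I (a m) t ^ 4) \<le> K4 * (\<epsilon>\<^sup>2 * (2 * q t / r))"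
    using K4_nonneg by (intro mult_left_mono)
  also have "\<dots> = 2 * K4 / r * \<epsilon>\<^sup>2 * q t" by simp
  finally have "norm \<rho> \<le> 2 * K4 / r * \<epsilon>\<^sup>2 * q t" using \<rho>(2) by linarith
  then have "Re \<rho> \<le> 2 * K4 / r * \<epsilon>\<^sup>2 * q t" using complex_Re_le_cmod[of \<rho>] by linarith
  then have "- q t + Re \<rho> \<le> - (1 - 2 * K4 / r * \<epsilon>\<^sup>2) * q t" by (simp add: left_diff_distrib)
  moreover have "norm (F t) = exp (- q t + Re \<rho>)" unfolding \<rho>(1) norm_exp_eq_Re by simp
  ultimately show ?thesis unfolding \<epsilon>_def by simp
qed

text \<open>By \<open>leverage_sin\<close> one large sine forces the sum of all sin^2 to be at least
  s1^2 / L. The cap at 1 is the one of \<open>norm_geom_factor_bound\<close>.\<close>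

lemma norm_F_far:
  assumes m: "m \<in> V" "s1 \<le> \<bar>sin (lin I (a m) t / 2)\<bar>" and s0: "0 \<le> s1"
  shows "norm (F t) \<le> exp (- (min (4 * r) 1 / 4) * (s1\<^sup>2 / L))"
proof -
  let ?c = "min (4 * r) 1"
  let ?S = "\<Sum>p\<in>V. (sin (lin I (a p) t / 2))\<^sup>2"
  have c0: "?c \<ge> 0" using r_pos by simp
  have "norm (F t) = (\<Prod>p\<in>V. norm (geom_factor (z p) (lin I (a p) t)))" unfolding F_def by (simp add: prod_norm)
  also have "\<dots> \<le> (\<Prod>p\<in>V. exp (- (?c / 4) * (sin (lin I (a p) t / 2))\<^sup>2))"
  proof (intro prod_mono conjI norm_ge_zero norm_geom_factor_bound)
    fix p assume p: "p \<in> V"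
    show "?c \<le> 4 * (z p + (z p)\<^sup>2)" by (rule order_trans[OF min.cobounded1]) (use D_lower[OF p] in simp)
  qed (use c0 in auto)
  also have "\<dots> = exp (- (?c / 4) * ?S)" by (simp only: exp_sum[OF fin_V, symmetric] sum_distrib_left)
  also have "\<dots> \<le> exp (- (?c / 4) * (s1\<^sup>2 / L))"
  proof -
    have "s1\<^sup>2 \<le> (sin (lin I (a m) t / 2))\<^sup>2" using m(2) s0 by (metis power2_abs power_mono)
    also have "\<dots> \<le> L * ?S" by (rule leverage_sin[OF m(1)])
    finally have "s1\<^sup>2 / L \<le> ?S" using L_pos by (simp add: pos_divide_le_eq mult.commute)
    then have "(?c / 4) * (s1\<^sup>2 / L) \<le> (?c / 4) * ?S" using c0 by (intro mult_left_mono) auto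
    then show ?thesis by simp
  qed
  finally show ?thesis .
qed

text \<open>Where some |\<lambda>_m| exceeds \<delta>, integrand and Gaussian are bounded
  separately, and a sum over m replaces the indicator of this union. Off the torus only the Gaussian
  remains, and the same sum covers it.\<close>

lemma pointwise_estimate:
  assumes \<delta>: "0 < \<delta>" "2 * \<delta> \<le> pi" and s1: "0 < s1"
    and P: "K4 * real (card V) * \<delta> ^ 4 \<le> 1"
    and t: "t \<in> space (LB I)"
  defines "\<kappa> \<equiv> 2 * K4 / r * (12 * \<nu> * s1)\<^sup>2"
    and "far \<equiv> \<lambda>m. if \<delta> < \<bar>lin I (a m) t\<bar> then 1 else (0::real)"
  shows "\<bar>indicator (torus_box I) t * Re (F t) - exp (- q t)\<bar>
    \<le> exp (- q t) * ((cubic t)\<^sup>2 / 2 + 3 * (K4 * real (card V) * \<delta> ^ 4))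
      + (\<Sum>m\<in>V. exp (- q t) * far m + exp (- (1 - \<kappa>) * q t) * far m)
      + indicator (torus_box I) t * exp (- (min (4 * r) 1 / 4) * (s1\<^sup>2 / L))" (is "_ \<le> ?A + ?B + ?C")
proof -
  have A0: "0 \<le> ?A" using K4_nonneg \<delta> by (auto intro!: mult_nonneg_nonneg add_nonneg_nonneg)
  have far0: "0 \<le> far m" for m by (simp add: far_def)
  have B0: "0 \<le> ?B" by (intro sum_nonneg add_nonneg_nonneg mult_nonneg_nonneg far0 exp_ge_zero)
  have C0: "0 \<le> ?C" by simp
  show ?thesis
  proof (cases "\<forall>m\<in>V. \<bar>lin I (a m) t\<bar> \<le> \<delta>")
    case True
    \<comment> \<open>The condition 2 \<delta> \<le> pi puts the inner region inside the torus box,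
      where the indicator is 1.\<close>
    then have "\<bar>t i\<bar> \<le> 2 * \<delta>" if "i \<in> I" for i using that by (intro coordinate_abs_le) auto
    then have "- pi \<le> t i \<and> t i \<le> pi" if "i \<in> I" for i using \<delta> that by (fastforce simp: abs_le_iff)
    then have "t \<in> torus_box I" using t by (simp add: space_PiM PiE_iff)
    then have "\<bar>indicator (torus_box I) t * Re (F t) - exp (- q t)\<bar> \<le> ?A"
      using Re_F_near[of t \<delta>] True P by simp
    then show ?thesis using B0 C0 by linarith
  next
    case False
    then obtain m where m: "m \<in> V" "\<delta> < \<bar>lin I (a m) t\<bar>" by force
    have "exp (- q t) + exp (- (1 - \<kappa>) * q t) = exp (- q t) * far m + exp (- (1 - \<kappa>) * q t) * far m"
      using m by (simp add: far_def)
    also have "\<dots> \<le> ?B" using m(1) fin_V far0 by (intro member_le_sum) auto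
    finally have B: "exp (- q t) + exp (- (1 - \<kappa>) * q t) \<le> ?B" .
    show ?thesis
    proof (cases "t \<in> torus_box I")
      case False
      then have "\<bar>indicator (torus_box I) t * Re (F t) - exp (- q t)\<bar> = exp (- q t)" by simp
      then show ?thesis using B A0 C0 exp_ge_zero[of "- (1 - \<kappa>) * q t"] by linarith
    next
      case True
      have "norm (F t) \<le> exp (- (1 - \<kappa>) * q t) + ?C"
      proof (cases "\<forall>p\<in>V. \<bar>sin (lin I (a p) t / 2)\<bar> \<le> s1")
        case True
        have "\<bar>t i\<bar> \<le> pi" if "i \<in> I" for i using \<open>t \<in> torus_box I\<close> that by (auto simp: PiE_iff abs_le_iff)
        then have "norm (F t) \<le> exp (- (1 - \<kappa>) * q t)"
          unfolding \<kappa>_def using True s1 by (intro norm_F_middle) auto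
        then show ?thesis using C0 by linarith
      next
        case False
        then obtain p where "p \<in> V" "s1 \<le> \<bar>sin (lin I (a p) t / 2)\<bar>" by force
        then have "norm (F t) \<le> ?C" using norm_F_far[of p s1 t] s1 True by simp
        then show ?thesis using exp_ge_zero[of "- (1 - \<kappa>) * q t"] by linarith
      qed
      moreover have "\<bar>indicator (torus_box I) t * Re (F t) - exp (- q t)\<bar> \<le> norm (F t) + exp (- q t)"
        using True abs_Re_le_cmod[of "F t"] abs_triangle_ineq4[of "Re (F t)" "exp (- q t)"] by simp
      ultimately show ?thesis using B A0 by linarith
    qed
  qed
qed

text \<open>The far region contributes an absolute error, the volume of the torus times a uniform
  bound; all other terms are proportional to \<open>Z\<close>. The comparison with \<open>Z\<close>
  is postponed until a lower bound for it is available.\<close>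

theorem core_estimate:
  assumes \<delta>: "0 < \<delta>" "2 * \<delta> \<le> pi" and s1: "0 < s1"
    and P: "K4 * real (card V) * \<delta> ^ 4 \<le> 1"
    and \<kappa>: "\<kappa> = 2 * K4 / r * (12 * \<nu> * s1)\<^sup>2" "\<kappa> < 1"
  shows "\<bar>Re (\<integral>t. indicator (torus_box I) t *\<^sub>R F t \<partial>LB I) - Z\<bar>
    \<le> Z * (15 / 2 * (real (card V) * (R\<^sup>2)\<^sup>2 * (L / r)\<^sup>2 / r) + 3 * (K4 * real (card V) * \<delta> ^ 4)
          + real (card V) * (2 * exp (- \<delta>\<^sup>2 / (2 * (L / r))))
          + real (card V) * (2 * (1 / sqrt (1 - \<kappa>)) ^ card I * exp (- (1 - \<kappa>) * \<delta>\<^sup>2 / (2 * (L / r)))))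
      + (2 * pi) ^ card I * exp (- (min (4 * r) 1 / 4) * (s1\<^sup>2 / L))"
proof -
  let ?n = "real (card V)" and ?S = "L / r"
  define P4 where "P4 = 3 * (K4 * ?n * \<delta> ^ 4)"
  define E where "E = exp (- (min (4 * r) 1 / 4) * (s1\<^sup>2 / L))"
  define far where "far m t = (if \<delta> < \<bar>lin I (a m) t\<bar> then 1 else (0::real))" for m t
  have [measurable]: "far m \<in> borel_measurable (LB I)" for m unfolding far_def by measurable
  have [measurable]: "cubic \<in> borel_measurable (LB I)" unfolding cubic_def by measurable
  have [measurable]: "torus_box I \<in> sets (LB I)" using finite_I by measurable
  have P40: "P4 \<ge> 0" using K4_nonneg \<delta> by (simp add: P4_def)
  have E0: "E \<ge> 0" by (simp add: E_def)
  have S: "bil (dual m) (dual m) \<le> ?S" if "m \<in> V" for m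
    using r_pos D_lower L_pos leverage[OF that] that by (intro variance_le) auto
  have S0: "?S > 0" using L_pos r_pos by simp
  have tail: "(\<integral>\<^sup>+t. ennreal (exp (- s * q t) * far m t) \<partial>LB I)
      \<le> ennreal (2 * (1 / sqrt s) ^ card I * exp (- s * \<delta>\<^sup>2 / (2 * ?S)) * Z)" if "m \<in> V" "s > 0" for m s
  proof -
    have "(\<integral>\<^sup>+t. ennreal (exp (- s * q t) * far m t) \<partial>LB I)
        = (\<integral>\<^sup>+t. ennreal (exp (- s * q t)) * indicator {t. \<delta> < \<bar>lin I (a m) t\<bar>} t \<partial>LB I)"
      by (intro nn_integral_cong) (simp add: far_def)
    also have "\<dots> \<le> ennreal (2 * (1 / sqrt s) ^ card I * exp (- s * \<delta>\<^sup>2 / (2 * ?S)) * Z)"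
      by (rule gaussian_tail[OF that(1) S[OF that(1)] S0 that(2)]) (use \<delta> in simp)
    finally show ?thesis .
  qed
  define c1 c2 c3 c4 where c: "c1 = 15 * (?n * (R\<^sup>2)\<^sup>2 * ?S\<^sup>2 / r)" "c2 = 2 * exp (- \<delta>\<^sup>2 / (2 * ?S))"
    "c3 = 2 * (1 / sqrt (1 - \<kappa>)) ^ card I * exp (- (1 - \<kappa>) * \<delta>\<^sup>2 / (2 * ?S))" "c4 = (2 * pi) ^ card I"
  have nn: "0 \<le> c1" "0 \<le> c2" "0 \<le> c3" "0 \<le> c4" "0 \<le> Z" "0 \<le> ?n"
    using r_pos Z_pos \<kappa>(2) by (auto simp: c)
  have tail1: "(\<integral>\<^sup>+t. ennreal (exp (- 1 * q t) * far m t) \<partial>LB I) \<le> ennreal (c2 * Z)" if "m \<in> V" for m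
    using tail[OF that, of 1] unfolding c by simp
  have tail2: "(\<integral>\<^sup>+t. ennreal (exp (- (1 - \<kappa>) * q t) * far m t) \<partial>LB I) \<le> ennreal (c3 * Z)" if "m \<in> V" for m
    unfolding c by (rule tail[OF that]) (use \<kappa>(2) in simp)
  have cub: "(\<integral>\<^sup>+t. ennreal (exp (- q t) * (cubic t)\<^sup>2) \<partial>LB I) \<le> ennreal (c1 * Z)"
  proof -
    \<comment> \<open>With D = z + z^2 one has (1 + 2 z)^2 = 1 + 4 D, so 1 + 2 z \<le> 3 R because R
      \<ge> 1.\<close>
    have G: "\<bar>- ((z m + (z m)\<^sup>2) * (1 + 2 * z m) / 6)\<bar> \<le> R\<^sup>2" if m: "m \<in> V" for m
    proof -
      have D: "0 \<le> z m + (z m)\<^sup>2" "z m + (z m)\<^sup>2 \<le> R" using z_nonneg[OF m] D_upper[OF m] by auto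
      have R2: "R \<le> R\<^sup>2" using R_ge by (simp add: power2_eq_square)
      have "(1 + 2 * z m)\<^sup>2 = 1 + 4 * (z m + (z m)\<^sup>2)" by (simp add: power2_eq_square algebra_simps)
      also have "\<dots> \<le> (3 * R)\<^sup>2" using D R2 R_ge by (simp add: power_mult_distrib)
      finally have "1 + 2 * z m \<le> 3 * R" by (rule power2_le_imp_le) (use R_ge in simp)
      then have "(z m + (z m)\<^sup>2) * (1 + 2 * z m) \<le> R * (3 * R)" using D z_nonneg[OF m] R_ge by (intro mult_mono) auto
      then have "(z m + (z m)\<^sup>2) * (1 + 2 * z m) / 6 \<le> R\<^sup>2"
        using zero_le_power2[of R] by (simp only: power2_eq_square[of R])
      moreover have "0 \<le> (z m + (z m)\<^sup>2) * (1 + 2 * z m) / 6" using D z_nonneg[OF m] by simp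
      ultimately show ?thesis by (simp add: abs_minus_cancel)
    qed
    have "(\<integral>\<^sup>+t. ennreal (exp (- q t) * (cubic t)\<^sup>2) \<partial>LB I) = (\<integral>\<^sup>+t. ennreal (exp (- q t)) * ennreal ((cubic t)\<^sup>2) \<partial>LB I)"
      by (intro nn_integral_cong) (simp add: ennreal_mult)
    also have "\<dots> \<le> ennreal (15 * (?n * (R\<^sup>2)\<^sup>2 * ?S\<^sup>2 / r) * Z)"
      unfolding cubic_def by (rule cubic_second_moment[OF r_pos D_lower S G])
    finally show ?thesis unfolding c .
  qed
  have intF: "integrable (LB I) (\<lambda>t. indicator (torus_box I) t *\<^sub>R F t)"
  proof (rule Bochner_Integration.integrable_bound)
    show "integrable (LB I) (indicator (torus_box I) :: _ \<Rightarrow> real)"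
      using finite_I by (simp add: emeasure_torus_box less_top[symmetric])
    have "norm (F t) \<le> (\<Prod>m\<in>V. 1)" for t
      unfolding F_def prod_norm[symmetric] by (intro prod_mono conjI norm_ge_zero norm_geom_factor_le_1 z_nonneg)
    then show "AE t in LB I. norm (indicator (torus_box I) t *\<^sub>R F t) \<le> norm (indicator (torus_box I) t :: real)"
      by (intro AE_I2) (simp add: indicator_def)
  qed measurable
  have intq: "has_bochner_integral (LB I) (\<lambda>t. exp (- q t)) Z"
    using Z_pos by (intro has_bochner_integral_nn_integral) (auto simp: nn_integral_exp_q)
  have intRe: "integrable (LB I) (\<lambda>t. indicator (torus_box I) t * Re (F t))"
    using integrable_Re[OF intF] by simp
  let ?g = "\<lambda>t. indicator (torus_box I) t * Re (F t) - exp (- q t)"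
  have "Re (\<integral>t. indicator (torus_box I) t *\<^sub>R F t \<partial>LB I) - Z = (\<integral>t. ?g t \<partial>LB I)"
    using intq intRe integral_Re[OF intF] by (simp add: has_bochner_integral_iff)
  then have "ennreal \<bar>Re (\<integral>t. indicator (torus_box I) t *\<^sub>R F t \<partial>LB I) - Z\<bar> \<le> (\<integral>\<^sup>+t. ennreal \<bar>?g t\<bar> \<partial>LB I)"
    using integral_norm_bound_ennreal[of "LB I" ?g] intq intRe by (simp add: has_bochner_integral_iff)
  also have "\<dots> \<le> (\<integral>\<^sup>+t. (ennreal (exp (- q t) * (cubic t)\<^sup>2) * ennreal (1 / 2) + ennreal (exp (- q t)) * ennreal P4)
      + ((\<Sum>m\<in>V. ennreal (exp (- 1 * q t) * far m t) + ennreal (exp (- (1 - \<kappa>) * q t) * far m t))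
      + ennreal E * indicator (torus_box I) t) \<partial>LB I)"
  proof (rule nn_integral_mono)
    fix t assume t: "t \<in> space (LB I)"
    have far0: "far m t \<ge> 0" for m by (simp add: far_def)
    have "\<bar>?g t\<bar> \<le> exp (- q t) * ((cubic t)\<^sup>2 / 2 + P4)
      + (\<Sum>m\<in>V. exp (- q t) * far m t + exp (- (1 - \<kappa>) * q t) * far m t) + indicator (torus_box I) t * E"
      using pointwise_estimate[OF \<delta> s1 P t] unfolding far_def P4_def E_def \<kappa>(1) .
    also have "\<dots> = (exp (- q t) * (cubic t)\<^sup>2 * (1 / 2) + exp (- q t) * P4)
      + ((\<Sum>m\<in>V. exp (- 1 * q t) * far m t + exp (- (1 - \<kappa>) * q t) * far m t) + E * indicator (torus_box I) t)"
    proof -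
      have "x * (c / 2 + p) + b + i * e = (x * c * (1 / 2) + x * p) + (b + e * i)" for x c p b i e :: real
        by (simp add: algebra_simps)
      then show ?thesis by (simp only: mult_minus1)
    qed
    finally have "ennreal \<bar>?g t\<bar> \<le> ennreal \<dots>" by (rule ennreal_leI)
    also have "\<dots> = (ennreal (exp (- q t) * (cubic t)\<^sup>2) * ennreal (1 / 2) + ennreal (exp (- q t)) * ennreal P4)
      + ((\<Sum>m\<in>V. ennreal (exp (- 1 * q t) * far m t) + ennreal (exp (- (1 - \<kappa>) * q t) * far m t))
      + ennreal E * indicator (torus_box I) t)"
    proof -
      have e1: "ennreal (exp (- q t) * (cubic t)\<^sup>2 * (1 / 2) + exp (- q t) * P4)
          = ennreal (exp (- q t) * (cubic t)\<^sup>2) * ennreal (1 / 2) + ennreal (exp (- q t)) * ennreal P4"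
        by (simp only: ennreal_plus ennreal_mult mult_nonneg_nonneg exp_ge_zero zero_le_power2 P40 zero_le_divide_1_iff zero_le_numeral)
      have e2: "ennreal (\<Sum>m\<in>V. exp (- 1 * q t) * far m t + exp (- (1 - \<kappa>) * q t) * far m t)
          = (\<Sum>m\<in>V. ennreal (exp (- 1 * q t) * far m t) + ennreal (exp (- (1 - \<kappa>) * q t) * far m t))"
        using far0 by (subst sum_ennreal[symmetric]) (auto intro!: sum.cong ennreal_plus)
      have e3: "ennreal (E * indicator (torus_box I) t) = ennreal E * indicator (torus_box I) t"
        by (simp add: indicator_def)
      have n1: "0 \<le> exp (- q t) * (cubic t)\<^sup>2 * (1 / 2) + exp (- q t) * P4" using P40 by simp
      have n2: "0 \<le> (\<Sum>m\<in>V. exp (- 1 * q t) * far m t + exp (- (1 - \<kappa>) * q t) * far m t)"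
        by (intro sum_nonneg add_nonneg_nonneg mult_nonneg_nonneg far0 exp_ge_zero)
      have n3: "0 \<le> E * indicator (torus_box I) t" using E0 by simp
      show ?thesis by (subst ennreal_plus[OF n1 add_nonneg_nonneg[OF n2 n3]], subst ennreal_plus[OF n2 n3]) (simp only: e1 e2 e3)
    qed
    finally show "ennreal \<bar>?g t\<bar> \<le> \<dots>" .
  qed
  also have "\<dots> = ((\<integral>\<^sup>+t. ennreal (exp (- q t) * (cubic t)\<^sup>2) \<partial>LB I) * ennreal (1 / 2) + ennreal Z * ennreal P4)
      + ((\<Sum>m\<in>V. (\<integral>\<^sup>+t. ennreal (exp (- 1 * q t) * far m t) \<partial>LB I) + (\<integral>\<^sup>+t. ennreal (exp (- (1 - \<kappa>) * q t) * far m t) \<partial>LB I))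
      + ennreal E * emeasure (LB I) (torus_box I))"
    by (simp add: nn_integral_add nn_integral_multc nn_integral_sum nn_integral_cmult_indicator nn_integral_exp_q)
  also have "\<dots> \<le> (ennreal (c1 * Z) * ennreal (1 / 2) + ennreal Z * ennreal P4)
      + ((\<Sum>m\<in>V. ennreal (c2 * Z) + ennreal (c3 * Z)) + ennreal E * ennreal c4)"
    by (intro add_mono mult_right_mono sum_mono cub tail1 tail2) (auto simp: emeasure_torus_box[OF finite_I] c(4))
  also have "\<dots> = ennreal ((c1 * Z * (1 / 2) + Z * P4) + (?n * (c2 * Z + c3 * Z) + E * c4))"
  proof -
    have e1: "ennreal (c1 * Z * (1 / 2) + Z * P4) = ennreal (c1 * Z) * ennreal (1 / 2) + ennreal Z * ennreal P4"
      using nn P40 by (simp only: ennreal_plus ennreal_mult mult_nonneg_nonneg zero_le_divide_1_iff zero_le_numeral)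
    have e2: "ennreal (?n * (c2 * Z + c3 * Z)) = (\<Sum>m\<in>V. ennreal (c2 * Z) + ennreal (c3 * Z))"
    proof -
      have "ennreal (?n * (c2 * Z + c3 * Z)) = ennreal ?n * ennreal (c2 * Z + c3 * Z)"
        using nn by (intro ennreal_mult) auto
      then show ?thesis using nn by (simp add: ennreal_of_nat_eq_real_of_nat)
    qed
    have e3: "ennreal (E * c4) = ennreal E * ennreal c4" using nn E0 by (intro ennreal_mult)
    have n1: "0 \<le> c1 * Z * (1 / 2) + Z * P4" using nn P40 by simp
    have n2: "0 \<le> ?n * (c2 * Z + c3 * Z)" using nn by simp
    have n3: "0 \<le> E * c4" using nn E0 by simp
    show ?thesis by (subst ennreal_plus[OF n1 add_nonneg_nonneg[OF n2 n3]], subst ennreal_plus[OF n2 n3]) (simp only: e1 e2 e3)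
  qed
  finally have "\<bar>Re (\<integral>t. indicator (torus_box I) t *\<^sub>R F t \<partial>LB I) - Z\<bar>
      \<le> (c1 * Z * (1 / 2) + Z * P4) + (?n * (c2 * Z + c3 * Z) + E * c4)"
    by (subst (asm) ennreal_le_iff) (use nn P40 E0 in auto)
  also have "\<dots> = Z * (1 / 2 * c1 + P4 + ?n * c2 + ?n * c3) + c4 * E"
    by (simp add: algebra_simps)
  also have "1 / 2 * c1 = 15 / 2 * (?n * (R\<^sup>2)\<^sup>2 * ?S\<^sup>2 / r)"
    unfolding c by simp
  finally show ?thesis unfolding c(2-4) P4_def E_def .
qed

end

section \<open>The constraint matrix of a transportation polytope\<close>

locale transport =
  fixes \<nu> :: nat and ks :: "nat \<Rightarrow> nat"
  assumes nu_pos: "1 \<le> \<nu>" and ks_pos: "\<And>j. j \<in> {1..\<nu>} \<Longrightarrow> 1 \<le> ks j"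
begin

abbreviation V :: "(nat \<Rightarrow> nat) set" where "V \<equiv> multi_indices \<nu> ks"

abbreviation dimension :: nat where "dimension \<equiv> total_size \<nu> ks"

definition rows :: "nat set" where
  "rows = {i. i < dimension \<and> (\<forall>j\<in>{2..\<nu>}. i \<noteq> row_index ks j (ks j))}"

definition inc :: "(nat \<Rightarrow> nat) \<Rightarrow> nat \<Rightarrow> real" where
  "inc m i = Defs.column \<nu> ks m $ i"

text \<open>The share of direction j in \<lambda>_m when the j-th index is l; for the removed rows
  it is 0. Thus \<lambda>_m is a sum of \<nu> such values, which is the additivity behind the
  leverage inequality.\<close>

definition potential :: "(nat \<Rightarrow> real) \<Rightarrow> nat \<Rightarrow> nat \<Rightarrow> real" where
  "potential t j l = (if row_index ks j l \<in> rows then t (row_index ks j l) else 0)"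

lemma finite_V: "finite V"
  unfolding multi_indices_def by (intro finite_PiE) auto

lemma V_mem: "m \<in> V \<Longrightarrow> j \<in> {1..\<nu>} \<Longrightarrow> m j \<in> {1..ks j}"
  by (auto simp: multi_indices_def)

lemma rows_subset: "rows \<subseteq> {..<dimension}"
  by (auto simp: rows_def)

lemma finite_rows: "finite rows"
  using rows_subset finite_subset by blast

lemma row_index_in_rows:
  assumes "j \<in> {1..\<nu>}" "l \<in> {1..ks j}"
  shows "row_index ks j l \<in> rows \<longleftrightarrow> j = 1 \<or> l \<noteq> ks j"
proof -
  have "row_index ks j l \<noteq> row_index ks j' (ks j') \<longleftrightarrow> j \<noteq> j' \<or> l \<noteq> ks j'" if "j' \<in> {2..\<nu>}" for j'
    using row_index_eq_iff[of j j' l ks "ks j'"] assms ks_pos[of j'] that by auto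
  then show ?thesis using assms row_index_bound[of j \<nu> l ks] by (auto simp: rows_def)
qed

lemma card_rows: "card rows = dimension - (\<nu> - 1)" and nu_le_dimension: "\<nu> - 1 \<le> dimension"
proof -
  let ?f = "\<lambda>j. row_index ks j (ks j)"
  have inj: "inj_on ?f {2..\<nu>}"
  proof (rule inj_onI)
    fix x y assume "x \<in> {2..\<nu>}" "y \<in> {2..\<nu>}" "?f x = ?f y"
    then show "x = y" using row_index_eq_iff[of x y "ks x" ks "ks y"] ks_pos[of x] ks_pos[of y] by auto
  qed
  have sub: "?f ` {2..\<nu>} \<subseteq> {..<dimension}"
    using row_index_bound ks_pos by auto
  have "rows = {..<dimension} - ?f ` {2..\<nu>}" by (auto simp: rows_def)
  then show "card rows = dimension - (\<nu> - 1)"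
    using sub inj by (simp add: card_Diff_subset card_image)
  show "\<nu> - 1 \<le> dimension"
    using card_mono[OF _ sub] card_image[OF inj] by simp
qed

text \<open>By counting: there are as many pairs (j, l) as positions, and \<open>row_index\<close>
  is injective on them.\<close>

lemma row_index_surj:
  assumes "i < dimension"
  obtains j l where "j \<in> {1..\<nu>}" "l \<in> {1..ks j}" "i = row_index ks j l"
proof -
  let ?S = "SIGMA j:{1..\<nu>}. {1..ks j}" and ?f = "\<lambda>(j, l). row_index ks j l"
  have inj: "inj_on ?f ?S"
  proof (rule inj_onI, clarify)
    fix j l j' l'
    assume "j \<in> {1..\<nu>}" "l \<in> {1..ks j}" "j' \<in> {1..\<nu>}" "l' \<in> {1..ks j'}" "row_index ks j l = row_index ks j' l'"
    then show "j = j' \<and> l = l'" using row_index_eq_iff[of j j' l ks l'] by auto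
  qed
  have sub: "?f ` ?S \<subseteq> {..<dimension}" using row_index_bound by auto
  have "card (?f ` ?S) = card {..<dimension}"
    using card_image[OF inj] by (simp add: total_size_def)
  then have "?f ` ?S = {..<dimension}" using sub by (intro card_subset_eq) auto
  then have "i \<in> ?f ` ?S" using assms by simp
  then show thesis using that by auto
qed

lemma inc_row_index:
  assumes "m \<in> V" "j \<in> {1..\<nu>}" "l \<in> {1..ks j}"
  shows "inc m (row_index ks j l) = (if m j = l then 1 else 0)"
  unfolding inc_def using column_index[OF assms] .

lemma inc_01: "i < dimension \<Longrightarrow> inc m i = 0 \<or> inc m i = 1"
  by (simp add: inc_def Defs.column_def)

lemma lin_inc:
  assumes m: "m \<in> V"
  shows "lin rows (inc m) t = (\<Sum>j=1..\<nu>. potential t j (m j))"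
proof -
  let ?f = "\<lambda>j. row_index ks j (m j)"
  have inj: "inj_on ?f {1..\<nu>}"
  proof (rule inj_onI)
    fix x y assume "x \<in> {1..\<nu>}" "y \<in> {1..\<nu>}" "?f x = ?f y"
    then show "x = y" using row_index_eq_iff[of x y "m x" ks "m y"] V_mem[OF m] by auto
  qed
  have inc_eq: "inc m i = (if i \<in> ?f ` {1..\<nu>} then 1 else 0)" if "i \<in> rows" for i
    using that by (auto simp: inc_def Defs.column_def rows_def)
  have "lin rows (inc m) t = (\<Sum>i\<in>rows. if i \<in> ?f ` {1..\<nu>} then t i else 0)"
    unfolding lin_def by (intro sum.cong) (auto simp: inc_eq)
  also have "\<dots> = (\<Sum>i\<in>rows \<inter> ?f ` {1..\<nu>}. t i)"
    using finite_rows by (simp add: sum.inter_restrict)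
  also have "\<dots> = (\<Sum>i\<in>?f ` {1..\<nu>}. if i \<in> rows then t i else 0)"
    by (subst Int_commute) (simp add: sum.inter_restrict)
  also have "\<dots> = (\<Sum>j=1..\<nu>. potential t j (m j))"
    by (subst sum.reindex[OF inj]) (simp add: potential_def)
  finally show ?thesis .
qed

lemma potential_last: "j \<in> {2..\<nu>} \<Longrightarrow> potential t j (ks j) = 0"
  using row_index_in_rows[of j "ks j"] ks_pos[of j] by (auto simp: potential_def)

text \<open>For the multi-index \<open>p\<close> whose entries are all last, \<lambda>_p is the
  coordinate of the row (1, k_1), since the other last rows are absent. Replacing one entry isolates
  t i; in direction 1 nothing has to be subtracted, whence e = 0.\<close>

lemma coordinate_inc:
  assumes i: "i \<in> rows"
  shows "\<exists>m\<in>V. \<exists>p\<in>V. \<exists>e\<in>{0, 1 :: real}. \<forall>t. t i = lin rows (inc m) t - e * lin rows (inc p) t"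
proof -
  obtain j l where jl: "j \<in> {1..\<nu>}" "l \<in> {1..ks j}" "i = row_index ks j l"
    using row_index_surj i rows_subset by blast
  define p where "p = (\<lambda>j'\<in>{1..\<nu>}. ks j')"
  define m where "m = p(j := l)"
  have p: "p \<in> V" using ks_pos by (auto simp: p_def multi_indices_def)
  have m: "m \<in> V" using p jl by (auto simp: m_def multi_indices_def PiE_iff extensional_def)
  define e :: real where "e = (if j = 1 then 0 else 1)"
  have "t i = lin rows (inc m) t - e * lin rows (inc p) t" for t
  proof -
    have pot: "potential t j l = t i" using i by (simp add: potential_def jl(3))
    have split: "(\<Sum>j'=1..\<nu>. potential t j' (x j')) = potential t 1 (x 1) + (\<Sum>j'=2..\<nu>. potential t j' (x j'))" for x
      using nu_pos by (simp add: sum.atLeast_Suc_atMost numeral_2_eq_2)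
    have p1: "lin rows (inc p) t = potential t 1 (ks 1)"
      unfolding lin_inc[OF p] split using nu_pos by (simp add: p_def potential_last)
    have "lin rows (inc m) t = (if j = 1 then t i else potential t 1 (ks 1) + t i)"
    proof (cases "j = 1")
      case True
      have "(\<Sum>j'=2..\<nu>. potential t j' (m j')) = 0"
        using True by (intro sum.neutral) (auto simp: m_def p_def potential_last)
      then show ?thesis unfolding lin_inc[OF m] split using True pot by (simp add: m_def)
    next
      case False
      have "(\<Sum>j'=2..\<nu>. potential t j' (m j')) = (\<Sum>j'=2..\<nu>. if j' = j then t i else 0)"
        using pot by (intro sum.cong) (auto simp: m_def p_def potential_last)
      also have "\<dots> = t i" using False jl by simp
      finally show ?thesis unfolding lin_inc[OF m] split using False nu_pos by (simp add: m_def p_def)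
    qed
    then show ?thesis by (simp add: p1 e_def)
  qed
  then show ?thesis using m p by (intro bexI[of _ m] bexI[of _ p] bexI[of _ e]) (auto simp: e_def)
qed

lemma row_sum_inc:
  assumes m: "m \<in> V"
  shows "(\<Sum>i\<in>rows. \<bar>inc m i\<bar>) \<le> real \<nu>"
proof -
  have "(\<Sum>i\<in>rows. \<bar>inc m i\<bar>) = lin rows (inc m) (\<lambda>_. 1)"
    unfolding lin_def
  proof (intro sum.cong refl)
    fix i assume "i \<in> rows"
    then have "i < dimension" using rows_subset by auto
    then show "\<bar>inc m i\<bar> = inc m i * 1" using inc_01[of i m] by auto
  qed
  also have "\<dots> = (\<Sum>j=1..\<nu>. potential (\<lambda>_. 1) j (m j))" by (rule lin_inc[OF m])
  also have "\<dots> \<le> (\<Sum>j=1..\<nu>. 1)" by (intro sum_mono) (simp add: potential_def)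
  finally show ?thesis by simp
qed

text \<open>Any additive array satisfies \<open>\<lambda>\<^sub>m = (\<Sum>j. \<lambda>(p with p\<^sub>j replaced by m\<^sub>j)) - (\<nu> - 1) \<lambda>\<^sub>p\<close> for
  every \<open>p\<close>; averaging over \<open>p\<close> shows that one large entry forces a large sum of squares.\<close>

lemma sum_update_le:
  fixes f :: "(nat \<Rightarrow> nat) \<Rightarrow> real"
  assumes j: "j \<in> {1..\<nu>}" and l: "l \<in> {1..ks j}" and f: "\<And>p. 0 \<le> f p"
  shows "(\<Sum>p\<in>V. f (p(j := l))) \<le> real (ks j) * (\<Sum>p\<in>V. f p)"
proof -
  let ?g = "\<lambda>p. p(j := l)"
  have gV: "?g ` V \<subseteq> V" using j l by (auto simp: multi_indices_def PiE_iff extensional_def)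
  have card: "card {p \<in> V. ?g p = y} \<le> ks j" for y
  proof -
    have "inj_on (\<lambda>p. p j) {p \<in> V. ?g p = y}"
    proof (rule inj_onI)
      fix p p' assume "p \<in> {p \<in> V. ?g p = y}" "p' \<in> {p \<in> V. ?g p = y}" "p j = p' j"
      then have "?g p = ?g p'" "p j = p' j" by auto
      then show "p = p'" by (metis fun_upd_triv fun_upd_upd)
    qed
    then have "card {p \<in> V. ?g p = y} = card ((\<lambda>p. p j) ` {p \<in> V. ?g p = y})" by (simp add: card_image)
    also have "\<dots> \<le> card {1..ks j}" using V_mem j by (intro card_mono) auto
    finally show ?thesis by simp
  qed
  have "(\<Sum>p\<in>V. f (?g p)) = (\<Sum>y\<in>?g ` V. \<Sum>p\<in>{p \<in> V. ?g p = y}. f (?g p))"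
    by (rule sum.image_gen[OF finite_V])
  also have "\<dots> = (\<Sum>y\<in>?g ` V. real (card {p \<in> V. ?g p = y}) * f y)"
    by (intro sum.cong refl) simp
  also have "\<dots> \<le> (\<Sum>y\<in>?g ` V. real (ks j) * f y)"
    by (intro sum_mono mult_right_mono f) (use card in simp)
  also have "\<dots> \<le> (\<Sum>y\<in>V. real (ks j) * f y)"
    using gV finite_V f by (intro sum_mono2) auto
  finally show ?thesis by (simp add: sum_distrib_left)
qed

text \<open>Besides nonnegativity only subadditivity, evenness and h 0 = 0 enter, so |x| and |sin (x
  / 2)| can be treated by one argument.\<close>

lemma leverage_subadditive:
  fixes h :: "real \<Rightarrow> real"
  assumes h: "\<And>x. 0 \<le> h x" "\<And>x y. h (x + y) \<le> h x + h y" "\<And>x. h (- x) = h x" "h 0 = 0"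
    and k: "1 \<le> k" "\<And>j. j \<in> {1..\<nu>} \<Longrightarrow> real (ks j) \<le> k" and m: "m \<in> V"
  shows "real (card V) * (h (lin rows (inc m) t))\<^sup>2 \<le> 4 * (real \<nu>)\<^sup>2 * k * (\<Sum>p\<in>V. (h (lin rows (inc p) t))\<^sup>2)"
proof -
  define lam where "lam m = lin rows (inc m) t" for m
  let ?S = "\<Sum>p\<in>V. (h (lam p))\<^sup>2"
  have S0: "0 \<le> ?S" by (intro sum_nonneg) auto
  have hsum: "h (sum x J) \<le> (\<Sum>j\<in>J. h (x j))" if "finite J" for x and J :: "nat set"
    using that by (induction J rule: finite_induct) (auto simp: h(4) intro: order_trans[OF h(2)])
  have hmult: "h (real n * x) \<le> real n * h x" for n x
  proof (induction n)
    case (Suc n)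
    have "h (real (Suc n) * x) = h (x + real n * x)" by (simp add: algebra_simps)
    also have "\<dots> \<le> h x + h (real n * x)" by (rule h(2))
    finally show ?case using Suc by (simp add: algebra_simps)
  qed (simp add: h(4))
  have upd: "p(j := m j) \<in> V" if "p \<in> V" "j \<in> {1..\<nu>}" for p j
    using V_mem[OF m that(2)] that by (auto simp: multi_indices_def PiE_iff extensional_def)
  have id: "lam m = (\<Sum>j=1..\<nu>. lam (p(j := m j))) - real (\<nu> - 1) * lam p" if p: "p \<in> V" for p
  proof -
    have "lam (p(j := m j)) = lam p + (potential t j (m j) - potential t j (p j))" if j: "j \<in> {1..\<nu>}" for j
    proof -
      have "lam (p(j := m j)) = (\<Sum>i=1..\<nu>. potential t i (p i) + (if i = j then potential t j (m j) - potential t j (p j) else 0))"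
        unfolding lam_def lin_inc[OF upd[OF p j]] by (intro sum.cong) auto
      then show ?thesis using j unfolding lam_def lin_inc[OF p] by (simp add: sum.distrib)
    qed
    then have "(\<Sum>j=1..\<nu>. lam (p(j := m j))) = (\<Sum>j=1..\<nu>. lam p + (potential t j (m j) - potential t j (p j)))"
      by (intro sum.cong) auto
    also have "\<dots> = real \<nu> * lam p + (lam m - lam p)"
      unfolding sum.distrib sum_subtractf lam_def lin_inc[OF m] lin_inc[OF p] by simp
    finally show ?thesis using nu_pos by (simp add: of_nat_diff algebra_simps)
  qed
  \<comment> \<open>The factor 2 comes from the square of a sum of two, the factor \<nu> from
    Cauchy-Schwarz over the directions. After summation over p both parts are at most 2 \<nu>^2 k
    times the sum of squares, hence the constant 4.\<close>
  have pt: "(h (lam m))\<^sup>2 \<le> 2 * real \<nu> * (\<Sum>j=1..\<nu>. (h (lam (p(j := m j))))\<^sup>2) + 2 * (real \<nu>)\<^sup>2 * (h (lam p))\<^sup>2"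
    if p: "p \<in> V" for p
  proof -
    let ?A = "\<Sum>j=1..\<nu>. h (lam (p(j := m j)))" and ?B = "real \<nu> * h (lam p)"
    have "h (lam m) = h ((\<Sum>j=1..\<nu>. lam (p(j := m j))) + - (real (\<nu> - 1) * lam p))" using id[OF p] by simp
    also have "\<dots> \<le> h (\<Sum>j=1..\<nu>. lam (p(j := m j))) + h (- (real (\<nu> - 1) * lam p))" by (rule h(2))
    also have "\<dots> \<le> ?A + real (\<nu> - 1) * h (lam p)" unfolding h(3) by (intro add_mono hsum hmult) auto
    also have "\<dots> \<le> ?A + ?B" using h(1) by (intro add_left_mono mult_right_mono) auto
    finally have "(h (lam m))\<^sup>2 \<le> (?A + ?B)\<^sup>2" using h(1) by (intro power_mono)
    also have "\<dots> \<le> 2 * ?A\<^sup>2 + 2 * ?B\<^sup>2"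
      using zero_le_power2[of "?A - ?B"] by (simp add: power2_eq_square algebra_simps)
    also have "?A\<^sup>2 \<le> real \<nu> * (\<Sum>j=1..\<nu>. (h (lam (p(j := m j))))\<^sup>2)"
      using sum_squared_le_sum_of_squares[of "\<lambda>j. h (lam (p(j := m j)))" "{1..\<nu>}"] by (simp add: mult.commute)
    finally show ?thesis by (simp add: power_mult_distrib)
  qed
  have "real (card V) * (h (lam m))\<^sup>2 = (\<Sum>p\<in>V. (h (lam m))\<^sup>2)" by simp
  also have "\<dots> \<le> (\<Sum>p\<in>V. 2 * real \<nu> * (\<Sum>j=1..\<nu>. (h (lam (p(j := m j))))\<^sup>2) + 2 * (real \<nu>)\<^sup>2 * (h (lam p))\<^sup>2)"
    by (intro sum_mono pt)
  also have "\<dots> = 2 * real \<nu> * (\<Sum>j=1..\<nu>. \<Sum>p\<in>V. (h (lam (p(j := m j))))\<^sup>2) + 2 * (real \<nu>)\<^sup>2 * ?S"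
    unfolding sum.distrib sum_distrib_left[symmetric] by (subst sum.swap) simp
  also have "\<dots> \<le> 2 * real \<nu> * (\<Sum>j=1..\<nu>. k * ?S) + 2 * (real \<nu>)\<^sup>2 * (k * ?S)"
  proof (intro add_mono mult_left_mono sum_mono)
    fix j assume j: "j \<in> {1..\<nu>}"
    have "(\<Sum>p\<in>V. (h (lam (p(j := m j))))\<^sup>2) \<le> real (ks j) * ?S"
      using sum_update_le[OF j V_mem[OF m j], of "\<lambda>p. (h (lam p))\<^sup>2"] by simp
    also have "\<dots> \<le> k * ?S" using k(2)[OF j] S0 by (intro mult_right_mono)
    finally show "(\<Sum>p\<in>V. (h (lam (p(j := m j))))\<^sup>2) \<le> k * ?S" .
  next
    show "?S \<le> k * ?S" using k(1) S0 by (simp add: mult_le_cancel_right1)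
  qed auto
  also have "\<dots> = 4 * (real \<nu>)\<^sup>2 * k * ?S" by (simp add: power2_eq_square)
  finally show ?thesis unfolding lam_def .
qed

lemma gauss_core_transport:
  assumes z: "\<And>m. m \<in> V \<Longrightarrow> 0 \<le> z m" and r: "0 < r" and R: "1 \<le> R"
    and D: "\<And>m. m \<in> V \<Longrightarrow> r \<le> z m + (z m)\<^sup>2" "\<And>m. m \<in> V \<Longrightarrow> z m + (z m)\<^sup>2 \<le> R"
    and k: "1 \<le> k" "\<And>j. j \<in> {1..\<nu>} \<Longrightarrow> real (ks j) \<le> k"
    and L: "4 * (real \<nu>)\<^sup>2 * k \<le> L * real (card V)"
  shows "gauss_core V rows dimension inc z r R L (real \<nu>)"
proof
  have ne: "V \<noteq> {}" using ks_pos by (auto simp: multi_indices_def PiE_eq_empty_iff)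
  then have n: "0 < real (card V)" using finite_V by (simp add: card_gt_0_iff)
  have "0 < 4 * (real \<nu>)\<^sup>2 * k" using nu_pos k by simp
  then have "0 < L * real (card V)" using L by linarith
  then show L0: "0 < L" using n by (simp add: zero_less_mult_iff)
  have lev: "(h (lin rows (inc m) t))\<^sup>2 \<le> L * (\<Sum>p\<in>V. (h (lin rows (inc p) t))\<^sup>2)"
    if "m \<in> V" "\<And>x. 0 \<le> h x" "\<And>x y. h (x + y) \<le> h x + h y" "\<And>x. h (- x) = h x" "h 0 = 0" for h :: "real \<Rightarrow> real" and m t
  proof -
    let ?S = "\<Sum>p\<in>V. (h (lin rows (inc p) t))\<^sup>2"
    have "real (card V) * (h (lin rows (inc m) t))\<^sup>2 \<le> 4 * (real \<nu>)\<^sup>2 * k * ?S"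
      using that k by (intro leverage_subadditive) auto
    also have "\<dots> \<le> L * real (card V) * ?S" using L by (intro mult_right_mono sum_nonneg) auto
    finally have "real (card V) * (h (lin rows (inc m) t))\<^sup>2 \<le> real (card V) * (L * ?S)" by (simp add: mult_ac)
    then show ?thesis using n by (simp add: mult_le_cancel_left)
  qed
  show "(lin rows (inc m) t)\<^sup>2 \<le> L * (\<Sum>p\<in>V. (lin rows (inc p) t)\<^sup>2)" if "m \<in> V" for m t
    using lev[OF that, of abs t] by simp
  show "(sin (lin rows (inc m) t / 2))\<^sup>2 \<le> L * (\<Sum>p\<in>V. (sin (lin rows (inc p) t / 2))\<^sup>2)" if "m \<in> V" for m t
  proof -
    have "\<bar>sin ((x + y) / 2)\<bar> \<le> \<bar>sin (x / 2)\<bar> + \<bar>sin (y / 2)\<bar>" for x y :: real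
      using abs_sin_diff_le[of "x / 2" "- y / 2"] by (simp add: add_divide_distrib)
    then show ?thesis using lev[OF that, of "\<lambda>x. \<bar>sin (x / 2)\<bar>" t] by simp
  qed
qed (use finite_V rows_subset z r R D coordinate_inc row_sum_inc in auto)

end

section \<open>Restricted determinant, integer points and stationarity of the entropy\<close>

context transport
begin

lemma slice_space_eq:
  "slice_space \<nu> ks = {t \<in> carrier_vec dimension. \<forall>i<dimension. i \<notin> rows \<longrightarrow> t $ i = 0}"
proof -
  have "row_index ks j (ks j) < dimension" if "j \<in> {2..\<nu>}" for j
    using row_index_bound[of j \<nu> "ks j" ks] ks_pos[of j] that by auto
  then have "(\<forall>j\<in>{2..\<nu>}. t $ row_index ks j (ks j) = 0) \<longleftrightarrow> (\<forall>i<dimension. i \<notin> rows \<longrightarrow> t $ i = 0)"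
    for t :: "real Matrix.vec"
    unfolding rows_def by blast
  then show ?thesis unfolding slice_space_def by simp
qed

text \<open>The projection is a diagonal 0-1 matrix, so conjugating with it merely erases the rows
  and columns outside \<open>rows\<close>; this is the situation of
  \<open>det_restrict_coordinates\<close>.\<close>

lemma det_restrict_gauss_form:
  "det_restrict dimension (Defs.gauss_form \<nu> ks z) (slice_space \<nu> ks)
    = Determinant.det (Matrix.mat dimension dimension (\<lambda>(i, j).
        if i \<in> rows \<and> j \<in> rows then \<Sum>m\<in>V. (z m + (z m)\<^sup>2) * (inc m i * inc m j) else if i = j then 1 else 0))"
proof -
  let ?d = dimension
  define Bf where "Bf i j = (\<Sum>m\<in>V. (z m + (z m)\<^sup>2) * (inc m i * inc m j))" for i j
  define Bm where "Bm = Matrix.mat ?d ?d (\<lambda>(i, j). Bf i j)"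
  define Q where "Q = Matrix.mat ?d ?d (\<lambda>(i, j). if i = j \<and> i \<in> rows then 1 else 0 :: real)"
  have Beq: "quad_form_matrix ?d (Defs.gauss_form \<nu> ks z) = Bm"
    unfolding quad_form_matrix_gauss_form Bm_def Bf_def inc_def ..
  have Qeq: "orth_projection ?d (slice_space \<nu> ks) = Q"
    by (subst orth_projection_slice_space, rule ks_pos, assumption) (auto simp: Q_def rows_def intro!: eq_matI)
  have QBQ: "Q * Bm * Q = Matrix.mat ?d ?d (\<lambda>(i, j). if i \<in> rows \<and> j \<in> rows then Bf i j else 0)"
  proof -
    have QB: "Q * Bm = Matrix.mat ?d ?d (\<lambda>(i, j). if i \<in> rows then Bf i j else 0)"
    proof (rule eq_matI)
      fix i j assume "i < dim_row (Matrix.mat ?d ?d (\<lambda>(i, j). if i \<in> rows then Bf i j else 0))"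
        "j < dim_col (Matrix.mat ?d ?d (\<lambda>(i, j). if i \<in> rows then Bf i j else 0))"
      then have ij: "i < ?d" "j < ?d" by auto
      have "(Q * Bm) $$ (i, j) = (\<Sum>l = 0..<?d. (if i = l \<and> i \<in> rows then 1 else 0) * Bf l j)"
        using ij by (simp add: Q_def Bm_def scalar_prod_def)
      also have "\<dots> = (\<Sum>l = 0..<?d. if i = l then (if i \<in> rows then Bf l j else 0) else 0)"
        by (intro sum.cong) auto
      finally show "(Q * Bm) $$ (i, j) = Matrix.mat ?d ?d (\<lambda>(i, j). if i \<in> rows then Bf i j else 0) $$ (i, j)"
        using ij by simp
    qed (simp_all add: Q_def Bm_def)
    show ?thesis unfolding QB
    proof (rule eq_matI)
      fix i j assume "i < dim_row (Matrix.mat ?d ?d (\<lambda>(i, j). if i \<in> rows \<and> j \<in> rows then Bf i j else 0))"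
        "j < dim_col (Matrix.mat ?d ?d (\<lambda>(i, j). if i \<in> rows \<and> j \<in> rows then Bf i j else 0))"
      then have ij: "i < ?d" "j < ?d" by auto
      have "(Matrix.mat ?d ?d (\<lambda>(i, j). if i \<in> rows then Bf i j else 0) * Q) $$ (i, j)
          = (\<Sum>l = 0..<?d. (if i \<in> rows then Bf i l else 0) * (if l = j \<and> l \<in> rows then 1 else 0))"
        using ij by (simp add: Q_def scalar_prod_def)
      also have "\<dots> = (\<Sum>l = 0..<?d. if l = j then (if i \<in> rows \<and> j \<in> rows then Bf i l else 0) else 0)"
        by (intro sum.cong) auto
      finally show "(Matrix.mat ?d ?d (\<lambda>(i, j). if i \<in> rows then Bf i j else 0) * Q) $$ (i, j)
          = Matrix.mat ?d ?d (\<lambda>(i, j). if i \<in> rows \<and> j \<in> rows then Bf i j else 0) $$ (i, j)"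
        using ij by simp
    qed (simp_all add: Q_def)
  qed
  have "Bf i j = Bf j i" for i j unfolding Bf_def by (simp add: mult.commute)
  from det_restrict_coordinates[of Bf ?d rows, OF this] show ?thesis
    unfolding det_restrict_def Let_def Beq slice_space_eq Qeq[unfolded slice_space_eq] QBQ Bf_def .
qed

lemma sum_inc_row_index:
  assumes "j \<in> {1..\<nu>}" "l \<in> {1..ks j}"
  shows "(\<Sum>m\<in>V. u m * inc m (row_index ks j l)) = (\<Sum>m | m \<in> V \<and> m j = l. u m)"
proof -
  have "(\<Sum>m\<in>V. u m * inc m (row_index ks j l)) = (\<Sum>m\<in>V. if m j = l then u m else 0)"
    using assms by (intro sum.cong) (auto simp: inc_row_index)
  then show ?thesis using finite_V by (simp add: sum.inter_filter)
qed

lemma sum_slices: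
  assumes j: "j \<in> {1..\<nu>}"
  shows "(\<Sum>l=1..ks j. \<Sum>m\<in>V. u m * inc m (row_index ks j l)) = (\<Sum>m\<in>V. u m)"
proof -
  have "(\<Sum>l=1..ks j. \<Sum>m\<in>V. u m * inc m (row_index ks j l)) = (\<Sum>l=1..ks j. \<Sum>m | m \<in> V \<and> m j = l. u m)"
    using j by (intro sum.cong refl sum_inc_row_index) auto
  also have "\<dots> = (\<Sum>m\<in>V. u m)"
    using V_mem j by (intro sum.group[OF finite_V]) auto
  finally show ?thesis .
qed

text \<open>The rows \<open>(j, k\<^sub>j)\<close> with \<open>j \<ge> 2\<close> are redundant: the total is determined by the slices in
  direction 1.\<close>

lemma redundant_rows:
  assumes u: "\<And>i. i \<in> rows \<Longrightarrow> (\<Sum>m\<in>V. u m * inc m i) = 0"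
    and jl: "j \<in> {1..\<nu>}" "l \<in> {1..ks j}"
  shows "(\<Sum>m\<in>V. u m * inc m (row_index ks j l)) = 0"
proof (cases "row_index ks j l \<in> rows")
  case False
  then have l: "l = ks j" "j \<noteq> 1" using row_index_in_rows[OF jl] by auto
  have "(\<Sum>m\<in>V. u m) = (\<Sum>l=1..ks 1. \<Sum>m\<in>V. u m * inc m (row_index ks 1 l))"
    using nu_pos by (intro sum_slices[symmetric]) auto
  also have "\<dots> = 0" using nu_pos row_index_in_rows[of 1] u by (intro sum.neutral) auto
  finally have "(\<Sum>m\<in>V. u m) = 0" .
  moreover have "(\<Sum>l=1..ks j. \<Sum>m\<in>V. u m * inc m (row_index ks j l))
      = (\<Sum>m\<in>V. u m * inc m (row_index ks j l)) + (\<Sum>l'\<in>{1..ks j} - {l}. \<Sum>m\<in>V. u m * inc m (row_index ks j l'))"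
    using jl by (intro sum.remove) auto
  moreover have "(\<Sum>l'\<in>{1..ks j} - {l}. \<Sum>m\<in>V. u m * inc m (row_index ks j l')) = 0"
    using row_index_in_rows[OF jl(1)] u l by (intro sum.neutral) auto
  ultimately show ?thesis using sum_slices[OF jl(1), of u] by simp
qed (use u in auto)

lemma margin_eq:
  assumes "x \<in> transportation_polytope \<nu> ks S" "j \<in> {1..\<nu>}" "l \<in> {1..ks j}"
  shows "(\<Sum>m\<in>V. x m * inc m (row_index ks j l)) = S j l"
  using assms unfolding transportation_polytope_linear_system inc_def by blast

text \<open>By \<open>redundant_rows\<close> the equations of \<open>rows\<close> imply all the
  others, so the solution set of Fourier inversion is the set of integer points.\<close>

lemma card_integer_points:
  assumes z: "z \<in> transportation_polytope \<nu> ks S"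
  defines "X \<equiv> {x \<in> V \<rightarrow>\<^sub>E (UNIV :: nat set). \<forall>i\<in>rows. (\<Sum>m\<in>V. real (x m) * inc m i) = (\<Sum>m\<in>V. z m * inc m i)}"
  shows "finite X" and "card (integer_points \<nu> ks S) = card X"
    and "x \<in> X \<Longrightarrow> (\<lambda>m\<in>V. real (x m)) \<in> transportation_polytope \<nu> ks S"
proof -
  let ?e = "\<lambda>x. \<lambda>m\<in>V. real (x m)"
  have e: "?e x \<in> transportation_polytope \<nu> ks S" if x: "x \<in> X" for x
  proof -
    have "(\<Sum>m\<in>V. ?e x m * inc m (row_index ks j l)) = S j l" if jl: "j \<in> {1..\<nu>}" "l \<in> {1..ks j}" for j l
    proof -
      have "(\<Sum>m\<in>V. (real (x m) - z m) * inc m (row_index ks j l)) = 0"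
        using x by (intro redundant_rows[OF _ jl]) (auto simp: X_def left_diff_distrib sum_subtractf)
      then have "(\<Sum>m\<in>V. real (x m) * inc m (row_index ks j l)) = S j l"
        using margin_eq[OF z jl] by (simp add: left_diff_distrib sum_subtractf)
      then show ?thesis by simp
    qed
    then show ?thesis unfolding transportation_polytope_linear_system inc_def by simp
  qed
  then show "x \<in> X \<Longrightarrow> ?e x \<in> transportation_polytope \<nu> ks S" by blast
  \<comment> \<open>All points of the polytope have the same total, which bounds every entry and
    makes \<open>X\<close> finite.\<close>
  define T where "T = (\<Sum>m\<in>V. z m)"
  have total: "(\<Sum>m\<in>V. y m) = T" if y: "y \<in> transportation_polytope \<nu> ks S" for y
  proof -
    have "(\<Sum>m\<in>V. y m) = (\<Sum>l=1..ks 1. S 1 l)" if y: "y \<in> transportation_polytope \<nu> ks S" for y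
      using margin_eq[OF y, of 1] nu_pos by (subst sum_slices[of 1, symmetric]) (auto intro!: sum.cong)
    then show ?thesis using y z by (simp add: T_def)
  qed
  have "X \<subseteq> V \<rightarrow>\<^sub>E {..nat \<lfloor>T\<rfloor>}"
  proof
    fix x assume x: "x \<in> X"
    have "x m \<le> nat \<lfloor>T\<rfloor>" if m: "m \<in> V" for m
    proof -
      have "real (x m) \<le> (\<Sum>m\<in>V. real (x m))" using m finite_V by (intro member_le_sum) auto
      also have "\<dots> = T" using total[OF e[OF x]] by simp
      finally show ?thesis by (simp add: le_nat_floor)
    qed
    then show "x \<in> V \<rightarrow>\<^sub>E {..nat \<lfloor>T\<rfloor>}" using x by (auto simp: X_def PiE_iff)
  qed
  then show "finite X" by (rule finite_subset) (use finite_V in \<open>auto intro: finite_PiE\<close>)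
  have inj: "inj_on ?e X"
  proof (rule inj_onI)
    fix x y assume xy: "x \<in> X" "y \<in> X" "?e x = ?e y"
    have "x m = y m" if "m \<in> V" for m using fun_cong[OF xy(3), of m] that by simp
    then show "x = y" using xy(1,2) by (intro PiE_ext[of x V "\<lambda>_. UNIV" y]) (auto simp: X_def)
  qed
  have "?e ` X = integer_points \<nu> ks S"
  proof (intro equalityI subsetI)
    fix y assume "y \<in> ?e ` X"
    then show "y \<in> integer_points \<nu> ks S" using e by (auto simp: integer_points_def)
  next
    fix y assume "y \<in> integer_points \<nu> ks S"
    then have y: "y \<in> transportation_polytope \<nu> ks S" "\<And>m. m \<in> V \<Longrightarrow> y m \<in> \<int>"
      by (auto simp: integer_points_def)
    then have ye: "y \<in> extensional V" "\<And>m. m \<in> V \<Longrightarrow> 0 \<le> y m" by (auto simp: transportation_polytope_def)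
    define x where "x = (\<lambda>m\<in>V. nat \<lfloor>y m\<rfloor>)"
    have xy: "real (x m) = y m" if "m \<in> V" for m
      using y(2)[OF that] ye(2)[OF that] that by (auto simp: x_def elim!: Ints_cases)
    have "y = ?e x" using ye(1) xy by (intro extensionalityI[of _ V]) auto
    moreover have "x \<in> X"
    proof -
      have "(\<Sum>m\<in>V. real (x m) * inc m i) = (\<Sum>m\<in>V. z m * inc m i)" if "i \<in> rows" for i
      proof -
        have "i < dimension" using that rows_subset by auto
        then obtain j l where jl: "j \<in> {1..\<nu>}" "l \<in> {1..ks j}" "i = row_index ks j l" by (rule row_index_surj)
        have "(\<Sum>m\<in>V. real (x m) * inc m i) = (\<Sum>m\<in>V. y m * inc m i)" by (intro sum.cong) (auto simp: xy)
        then show ?thesis using margin_eq[OF y(1) jl(1,2)] margin_eq[OF z jl(1,2)] jl(3) by simp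
      qed
      then show ?thesis by (simp add: X_def x_def)
    qed
    ultimately show "y \<in> ?e ` X" by blast
  qed
  then show "card (integer_points \<nu> ks S) = card X" using card_image[OF inj] by simp
qed

text \<open>Since z is strictly positive, the segment from x to z can be prolonged slightly beyond z
  inside the polytope. The directional derivative at the maximum therefore vanishes instead of
  merely having a sign.\<close>

lemma entropy_stationary:
  assumes arg: "is_arg_max (entropy \<nu> ks) (\<lambda>x. x \<in> transportation_polytope \<nu> ks S) z"
    and pos: "\<And>m. m \<in> V \<Longrightarrow> 0 < z m" and x: "x \<in> transportation_polytope \<nu> ks S"
  shows "(\<Sum>m\<in>V. x m * (ln (1 + z m) - ln (z m))) = (\<Sum>m\<in>V. z m * (ln (1 + z m) - ln (z m)))"
proof -
  have z: "z \<in> transportation_polytope \<nu> ks S" using arg by (simp add: is_arg_max_def)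
  define u where "u m = x m - z m" for m
  define y where "y s = (\<lambda>m\<in>V. z m + s * u m)" for s
  have "\<exists>\<epsilon>>0. \<forall>m\<in>V. \<forall>s. \<bar>s\<bar> < \<epsilon> \<longrightarrow> 0 \<le> z m + s * u m"
  proof -
    \<comment> \<open>The 1 in the denominators covers u m = 0; the inserted 1 keeps the minimum
      defined for an empty index set.\<close>
    define E where "E = insert 1 ((\<lambda>m. z m / (\<bar>u m\<bar> + 1)) ` V)"
    have fin: "finite E" using finite_V by (simp add: E_def)
    have "0 < Min E" using fin pos by (subst Min_gr_iff) (auto simp: E_def divide_pos_pos add_nonneg_pos)
    moreover have "0 \<le> z m + s * u m" if "m \<in> V" "\<bar>s\<bar> < Min E" for m s
    proof -
      have "\<bar>s\<bar> < z m / (\<bar>u m\<bar> + 1)" using that fin by (auto simp: E_def)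
      then have "\<bar>s\<bar> * (\<bar>u m\<bar> + 1) < z m" by (simp add: pos_less_divide_eq add_nonneg_pos)
      then have "\<bar>s * u m\<bar> \<le> z m" using abs_ge_zero[of s] by (simp add: abs_mult algebra_simps)
      then show ?thesis by linarith
    qed
    ultimately show ?thesis by blast
  qed
  then obtain \<epsilon> where \<epsilon>: "\<epsilon> > 0" "\<And>m s. m \<in> V \<Longrightarrow> \<bar>s\<bar> < \<epsilon> \<Longrightarrow> 0 \<le> z m + s * u m" by blast
  have yP: "y s \<in> transportation_polytope \<nu> ks S" if "\<bar>s\<bar> < \<epsilon>" for s
  proof -
    have "(\<Sum>m\<in>V. y s m * inc m (row_index ks j l)) = S j l" if jl: "j \<in> {1..\<nu>}" "l \<in> {1..ks j}" for j l
    proof -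
      have "(\<Sum>m\<in>V. y s m * inc m (row_index ks j l)) = (\<Sum>m\<in>V. z m * inc m (row_index ks j l) + s * (x m * inc m (row_index ks j l) - z m * inc m (row_index ks j l)))"
        by (intro sum.cong) (auto simp: y_def u_def algebra_simps)
      also have "\<dots> = S j l"
        using margin_eq[OF x jl] margin_eq[OF z jl] by (simp add: sum.distrib sum_distrib_left[symmetric] sum_subtractf)
      finally show ?thesis .
    qed
    then show ?thesis using \<epsilon>(2)[OF _ that] unfolding transportation_polytope_linear_system inc_def
      by (auto simp: y_def)
  qed
  define h where "h s = (\<Sum>m\<in>V. (z m + s * u m + 1) * ln (z m + s * u m + 1) - (z m + s * u m) * ln (z m + s * u m))" for s
  have h: "entropy \<nu> ks (y s) = h s" for s
    unfolding entropy_def h_def by (intro sum.cong) (auto simp: y_def)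
  have "z = y 0" using z by (intro extensionalityI[of _ V]) (auto simp: y_def transportation_polytope_def)
  then have ent: "entropy \<nu> ks z = h 0" using h[of 0] by simp
  have deriv: "(h has_field_derivative (\<Sum>m\<in>V. u m * (ln (1 + z m) - ln (z m)))) (at 0)"
    unfolding h_def
  proof (rule DERIV_sum)
    fix m assume m: "m \<in> V"
    have p: "0 < z m" by (rule pos[OF m])
    have "((\<lambda>s. (z m + s * u m + 1) * ln (z m + s * u m + 1) - (z m + s * u m) * ln (z m + s * u m)) has_field_derivative
       (u m * ln (z m + 0 * u m + 1) + (z m + 0 * u m + 1) * (u m / (z m + 0 * u m + 1))
        - (u m * ln (z m + 0 * u m) + (z m + 0 * u m) * (u m / (z m + 0 * u m))))) (at 0)"
      using p by (auto intro!: derivative_eq_intros)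
    moreover have "c * (y / c) = y" if "c > 0" for c y :: real using that by simp
    from this[of "z m + 0 * u m + 1" "u m"] this[of "z m + 0 * u m" "u m"]
    have "(u m * ln (z m + 0 * u m + 1) + (z m + 0 * u m + 1) * (u m / (z m + 0 * u m + 1))
        - (u m * ln (z m + 0 * u m) + (z m + 0 * u m) * (u m / (z m + 0 * u m)))) = u m * (ln (1 + z m) - ln (z m))"
      using p by (simp add: add.commute right_diff_distrib)
    ultimately show "((\<lambda>s. (z m + s * u m + 1) * ln (z m + s * u m + 1) - (z m + s * u m) * ln (z m + s * u m)) has_field_derivative
       u m * (ln (1 + z m) - ln (z m))) (at 0)" by (simp only:)
  qed
  have "(\<Sum>m\<in>V. u m * (ln (1 + z m) - ln (z m))) = 0"
  proof (rule DERIV_local_max[OF deriv \<epsilon>(1)], intro allI impI)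
    fix s assume "\<bar>0 - s\<bar> < \<epsilon>"
    then have "y s \<in> transportation_polytope \<nu> ks S" by (intro yP) simp
    then have "\<not> entropy \<nu> ks (y s) > entropy \<nu> ks z" using arg by (auto simp: is_arg_max_def)
    then show "h s \<le> h 0" using h ent by simp
  qed
  then show ?thesis by (simp add: u_def left_diff_distrib sum_subtractf)
qed

text \<open>The logarithm of the weight is affine in x, and its linear part is, up to sign, the
  gradient of the entropy at z. By \<open>entropy_stationary\<close> it takes the same value at x
  and at z, where it gives the entropy.\<close>

lemma geom_weight_product:
  assumes arg: "is_arg_max (entropy \<nu> ks) (\<lambda>x. x \<in> transportation_polytope \<nu> ks S) z"
    and pos: "\<And>m. m \<in> V \<Longrightarrow> 0 < z m" and x: "(\<lambda>m\<in>V. real (x m)) \<in> transportation_polytope \<nu> ks S"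
  shows "(\<Prod>m\<in>V. geom_weight (z m) (x m)) = exp (- entropy \<nu> ks z)"
proof -
  have gw: "geom_weight (z m) (x m) = exp (- ln (1 + z m) - real (x m) * (ln (1 + z m) - ln (z m)))" if "m \<in> V" for m
  proof -
    have p: "0 < z m" by (rule pos[OF that])
    have "z m / (1 + z m) = exp (ln (z m) - ln (1 + z m))" using p by (simp add: exp_diff)
    then have "(z m / (1 + z m)) ^ x m = exp (real (x m) * (ln (z m) - ln (1 + z m)))"
      by (simp only: exp_of_nat_mult)
    moreover have "1 / (1 + z m) = exp (- ln (1 + z m))" using p by (simp add: exp_minus divide_inverse)
    ultimately show ?thesis unfolding geom_weight_def by (simp only: exp_add[symmetric]) (simp add: algebra_simps)
  qed
  have "(\<Prod>m\<in>V. geom_weight (z m) (x m)) = exp (\<Sum>m\<in>V. - ln (1 + z m) - real (x m) * (ln (1 + z m) - ln (z m)))"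
    unfolding exp_sum[OF finite_V] by (intro prod.cong gw) auto
  also have "(\<Sum>m\<in>V. - ln (1 + z m) - real (x m) * (ln (1 + z m) - ln (z m)))
      = (\<Sum>m\<in>V. - ln (1 + z m)) - (\<Sum>m\<in>V. z m * (ln (1 + z m) - ln (z m)))"
    using entropy_stationary[OF arg pos x] by (simp add: sum_subtractf)
  also have "\<dots> = - entropy \<nu> ks z"
    unfolding entropy_def by (simp add: sum_subtractf[symmetric] sum_negf[symmetric] algebra_simps)
  finally show ?thesis .
qed

end

section \<open>Explicit bounds for the relative error\<close>

lemma (in gauss_core) Z_lower:
  assumes "V \<noteq> {}"
  shows "(2 / sqrt (real (card V))) ^ card I * exp (- (R * \<nu>\<^sup>2 / 2)) \<le> Z"
proof -
  \<comment> \<open>This half-width makes n h^2 = 1, so that q \<le> R \<nu>^2 / 2 on the cube,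
    independently of n.\<close>
  define h where "h = 1 / sqrt (real (card V))"
  have n: "real (card V) > 0" using assms fin_V by (simp add: card_gt_0_iff)
  then have h: "h > 0" "real (card V) * h\<^sup>2 = 1" by (simp_all add: h_def power_divide)
  have "(2 * h) ^ card I * exp (- (R * \<nu>\<^sup>2 / 2)) \<le> Z"
  proof (rule Z_lower_bound[OF h(1)])
    fix t :: "nat \<Rightarrow> real" assume t: "\<And>i. i \<in> I \<Longrightarrow> \<bar>t i\<bar> \<le> h"
    have "(z m + (z m)\<^sup>2) * (lin I (a m) t)\<^sup>2 \<le> R * (\<nu> * h)\<^sup>2" if m: "m \<in> V" for m
    proof -
      have "\<bar>lin I (a m) t\<bar> \<le> (\<Sum>i\<in>I. \<bar>a m i\<bar> * \<bar>t i\<bar>)" unfolding lin_def abs_mult[symmetric] by (rule sum_abs)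
      also have "\<dots> \<le> (\<Sum>i\<in>I. \<bar>a m i\<bar> * h)" by (intro sum_mono mult_left_mono t) auto
      also have "\<dots> = (\<Sum>i\<in>I. \<bar>a m i\<bar>) * h" by (simp add: sum_distrib_right)
      also have "\<dots> \<le> \<nu> * h" using row_sum[OF m] h by (intro mult_right_mono) auto
      finally have "(lin I (a m) t)\<^sup>2 \<le> (\<nu> * h)\<^sup>2" by (metis abs_ge_zero power2_abs power_mono)
      then show ?thesis using D_upper[OF m] R_ge by (intro mult_mono) auto
    qed
    then have "(\<Sum>m\<in>V. (z m + (z m)\<^sup>2) * (lin I (a m) t)\<^sup>2) \<le> (\<Sum>m\<in>V. R * (\<nu> * h)\<^sup>2)" by (rule sum_mono)
    also have "\<dots> = R * \<nu>\<^sup>2 * (real (card V) * h\<^sup>2)" by (simp add: power_mult_distrib)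
    finally show "q t \<le> R * \<nu>\<^sup>2 / 2" unfolding q_def bil_self h(2) by simp
  qed
  then show ?thesis by (simp add: h_def)
qed

text \<open>The fraction of q that the quartic remainder can consume: 12 \<nu> s bounds
  |\<lambda>_m| when all |sin (\<lambda>_m / 2)| are at most s, and the coefficient is
  \<open>2 * K4 / r\<close>.\<close>

definition middle_loss :: "nat \<Rightarrow> real \<Rightarrow> real \<Rightarrow> real \<Rightarrow> real" where
  "middle_loss \<nu> r R s = R * (1 + 6 * R) / 3 / r * (12 * real \<nu> * s)\<^sup>2"

definition admissible_scales :: "nat \<Rightarrow> real \<Rightarrow> real \<Rightarrow> real \<Rightarrow> real \<Rightarrow> real \<Rightarrow> bool" where
  "admissible_scales \<nu> r R n \<delta> s \<longleftrightarrow> 0 < \<delta> \<and> 2 * \<delta> \<le> pi \<and> 0 < s \<and>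
     R * (1 + 6 * R) / 6 * n * \<delta> ^ 4 \<le> 1 \<and> middle_loss \<nu> r R s < 1"

text \<open>The summands come, in this order, from the variance of the cubic Taylor term, from the quartic
  remainder, from the Gaussian mass outside the region \<open>\<bar>\<lambda>\<^sub>m\<bar> \<le> \<delta>\<close>, from the same mass for the
  slightly wider Gaussian that dominates the integrand while all \<open>\<bar>sin (\<lambda>\<^sub>m / 2)\<bar> \<le> s\<close>, and from
  the uniform bound on the rest of the torus divided by a lower bound for the Gaussian integral.\<close>

definition estimate_error ::
    "nat \<Rightarrow> real \<Rightarrow> real \<Rightarrow> real \<Rightarrow> real \<Rightarrow> nat \<Rightarrow> real \<Rightarrow> real \<Rightarrow> real" where
  "estimate_error \<nu> r R L n c \<delta> s =
     15 / 2 * (n * (R\<^sup>2)\<^sup>2 * (L / r)\<^sup>2 / r) + 3 * (R * (1 + 6 * R) / 6 * n * \<delta> ^ 4)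
     + n * (2 * exp (- \<delta>\<^sup>2 / (2 * (L / r))))
     + n * (2 * (1 / sqrt (1 - middle_loss \<nu> r R s)) ^ c *
         exp (- (1 - middle_loss \<nu> r R s) * \<delta>\<^sup>2 / (2 * (L / r))))
     + (pi * sqrt n) ^ c * exp (R * (real \<nu>)\<^sup>2 / 2) * exp (- (min (4 * r) 1 / 4) * (s\<^sup>2 / L))"

text \<open>Count and estimate are the same factor exp (g(z)) / (2 pi)^c times an integral, over the
  torus and over the whole space respectively; the relative error is therefore that of the
  integrals. The crude bound asks for no scales and serves bounded k.\<close>

lemma transport_approximation:
  assumes nu: "1 \<le> \<nu>" and ks: "\<And>j. j \<in> {1..\<nu>} \<Longrightarrow> 1 \<le> ks j"
    and S: "\<And>j l. j \<in> {1..\<nu>} \<Longrightarrow> l \<in> {1..ks j} \<Longrightarrow> S j l \<in> \<int>"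
    and arg: "is_arg_max (entropy \<nu> ks) (\<lambda>x. x \<in> transportation_polytope \<nu> ks S) z"
    and r: "0 < r" and R: "1 \<le> R"
    and D: "\<And>m. m \<in> multi_indices \<nu> ks \<Longrightarrow> r \<le> z m + (z m)\<^sup>2"
      "\<And>m. m \<in> multi_indices \<nu> ks \<Longrightarrow> z m + (z m)\<^sup>2 \<le> R"
    and k: "1 \<le> k" "\<And>j. j \<in> {1..\<nu>} \<Longrightarrow> real (ks j) \<le> k"
    and n: "n = real (card (multi_indices \<nu> ks))"
    and L: "4 * (real \<nu>)\<^sup>2 * k \<le> L * n"
    and c: "c = total_size \<nu> ks - (\<nu> - 1)"
  shows "approximated_within (real (card (integer_points \<nu> ks S))) (gauss_estimate \<nu> ks z)
      (1 + (pi * sqrt n) ^ c * exp (R * (real \<nu>)\<^sup>2 / 2))" (is ?crude)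
    and "admissible_scales \<nu> r R n \<delta> s1 \<Longrightarrow>
      approximated_within (real (card (integer_points \<nu> ks S))) (gauss_estimate \<nu> ks z)
        (estimate_error \<nu> r R L n c \<delta> s1)" (is "_ \<Longrightarrow> ?fine")
proof -
  interpret transport \<nu> ks by unfold_locales (use nu ks in auto)
  have zP: "z \<in> transportation_polytope \<nu> ks S" using arg by (simp add: is_arg_max_def)
  have z0: "0 \<le> z m" if "m \<in> V" for m using zP that by (simp add: transportation_polytope_def)
  have zpos: "0 < z m" if "m \<in> V" for m
    using z0[OF that] D(1)[OF that] r by (cases "z m = 0") auto
  interpret core: gauss_core V rows dimension inc z r R L "real \<nu>"
    by (rule gauss_core_transport) (use z0 r R D k L n in auto)
  let ?M = "real (card (integer_points \<nu> ks S))" and ?E = "gauss_estimate \<nu> ks z"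
  let ?g = "exp (entropy \<nu> ks z)"
  have c': "c = card rows" using c card_rows by simp
  have ne: "V \<noteq> {}" using ks_pos by (auto simp: multi_indices_def PiE_eq_empty_iff)
  have npos: "0 < n" using ne finite_V n by (simp add: card_gt_0_iff)
  define J where "J = Re (\<integral>t. indicator (torus_box rows) t *\<^sub>R core.F t \<partial>LB rows)"
  have Zpos: "core.Z > 0" by (rule core.Z_pos)
  have M: "?M * (2 * pi) ^ c = ?g * J"
  proof -
    let ?X = "{x \<in> V \<rightarrow>\<^sub>E (UNIV :: nat set). \<forall>i\<in>rows. (\<Sum>m\<in>V. real (x m) * inc m i) = (\<Sum>m\<in>V. z m * inc m i)}"
    have inc_int: "inc m i \<in> \<int>" if "i \<in> rows" for m i
    proof -
      have "i < dimension" using that rows_subset by auto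
      then show ?thesis using inc_01[of i m] by auto
    qed
    have b_int: "(\<Sum>m\<in>V. z m * inc m i) \<in> \<int>" if "i \<in> rows" for i
    proof -
      have "i < dimension" using that rows_subset by auto
      then obtain j l where jl: "j \<in> {1..\<nu>}" "l \<in> {1..ks j}" "i = row_index ks j l" by (rule row_index_surj)
      then show ?thesis using margin_eq[OF zP jl(1,2)] S by simp
    qed
    have eq: "(\<integral>t. indicator (torus_box rows) t *\<^sub>R (\<Prod>m\<in>V. geom_factor (z m) (lin rows (inc m) t)) \<partial>LB rows)
        = of_real (real (card ?X) * exp (- entropy \<nu> ks z) * (2 * pi) ^ card rows)"
      by (rule fourier_count(1))
         (use finite_V finite_rows z0 inc_int b_int card_integer_points[OF zP] geom_weight_product[OF arg zpos] in auto)
    have "J = real (card ?X) * exp (- entropy \<nu> ks z) * (2 * pi) ^ card rows"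
      unfolding J_def core.F_def eq by (rule Re_complex_of_real)
    then have "J = ?M * exp (- entropy \<nu> ks z) * (2 * pi) ^ c"
      unfolding c' card_integer_points(2)[OF zP] .
    then show ?thesis by (simp add: exp_minus)
  qed
  have E: "?E * (2 * pi) ^ c = ?g * core.Z"
  proof -
    let ?det = "det_restrict dimension (Defs.gauss_form \<nu> ks z) (slice_space \<nu> ks)"
    have "Matrix.mat dimension dimension (\<lambda>(i, j). core.B i j) = Matrix.mat dimension dimension (\<lambda>(i, j).
        if i \<in> rows \<and> j \<in> rows then \<Sum>m\<in>V. (z m + (z m)\<^sup>2) * (inc m i * inc m j) else if i = j then 1 else 0)"
      by (rule arg_cong[of _ _ "Matrix.mat dimension dimension"]) (auto simp: fun_eq_iff core.B_def)
    then have det: "?det = Determinant.det (Matrix.mat dimension dimension (\<lambda>(i, j). core.B i j))"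
      using det_restrict_gauss_form by simp
    have dpos: "?det > 0" unfolding det by (rule core.det_B_pos)
    have cd: "c \<le> dimension" unfolding c by simp
    have "core.Z * sqrt (2 * pi) ^ (dimension - c) = sqrt (2 * pi) ^ dimension / sqrt ?det"
      using core.Z_eq unfolding det c' .
    also have "sqrt (2 * pi) ^ dimension = sqrt (2 * pi) ^ c * sqrt (2 * pi) ^ (dimension - c)"
      using cd by (simp add: power_add[symmetric])
    finally have "core.Z * sqrt (2 * pi) ^ (dimension - c) = sqrt (2 * pi) ^ c / sqrt ?det * sqrt (2 * pi) ^ (dimension - c)"
      by simp
    moreover have "sqrt (2 * pi) ^ (dimension - c) \<noteq> 0" by simp
    moreover have "x = y" if "x * w = y * w" "w \<noteq> 0" for x y w :: real using that by simp
    ultimately have Z: "core.Z = sqrt (2 * pi) ^ c / sqrt ?det" by blast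
    \<comment> \<open>The truncated subtractions in c are genuine because 1 \<le> \<nu> and \<nu> -
      1 \<le> dimension.\<close>
    have "real dimension - real \<nu> + 1 = real c"
      using nu_pos nu_le_dimension unfolding c by (simp add: of_nat_diff)
    moreover have "(2 * pi) powr (real c / 2) = sqrt (2 * pi) ^ c"
      by (simp add: powr_half_sqrt[symmetric] powr_realpow[symmetric] powr_powr)
    moreover have "?det powr (- 1 / 2) = 1 / sqrt ?det"
      using dpos by (simp add: powr_minus_divide powr_half_sqrt)
    ultimately have "?E = ?g / sqrt (2 * pi) ^ c * (1 / sqrt ?det)" unfolding gauss_estimate_def by simp
    moreover have "(2 * pi) ^ c = sqrt (2 * pi) ^ c * sqrt (2 * pi) ^ c"
    proof -
      have "sqrt (2 * pi) * sqrt (2 * pi) = 2 * pi" by simp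
      then show ?thesis by (simp only: power_mult_distrib[symmetric])
    qed
    moreover have "g / s * (1 / w) * (s * s) = g * (s / w)" if "s > 0" for g s w :: real using that by simp
    ultimately show ?thesis unfolding Z by simp
  qed
  have reduce: "approximated_within ?M ?E \<epsilon>" if "\<bar>J - core.Z\<bar> \<le> \<epsilon> * core.Z" for \<epsilon>
  proof -
    have p: "(2 * pi) ^ c > 0" by simp
    have "\<bar>?M - ?E\<bar> * (2 * pi) ^ c = \<bar>?M * (2 * pi) ^ c - ?E * (2 * pi) ^ c\<bar>"
      by (simp add: abs_mult left_diff_distrib[symmetric])
    also have "\<dots> = ?g * \<bar>J - core.Z\<bar>" unfolding M E by (simp add: abs_mult right_diff_distrib[symmetric])
    also have "\<dots> \<le> ?g * (\<epsilon> * core.Z)" by (intro mult_left_mono that) auto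
    also have "\<dots> = \<epsilon> * (?E * (2 * pi) ^ c)" unfolding E by simp
    finally have "\<bar>?M - ?E\<bar> * (2 * pi) ^ c \<le> (\<epsilon> * ?E) * (2 * pi) ^ c" by (simp only: mult.assoc)
    then show ?thesis unfolding approximated_within_def using p by (rule mult_right_le_imp_le)
  qed
  \<comment> \<open>The volume of the torus is split as (pi sqrt n)^c (2 / sqrt n)^c to match the
    lower bound of \<open>Z\<close>.\<close>
  have Zlow: "(2 * pi) ^ c \<le> (pi * sqrt n) ^ c * exp (R * (real \<nu>)\<^sup>2 / 2) * core.Z"
  proof -
    have "(2 / sqrt n) ^ c * exp (- (R * (real \<nu>)\<^sup>2 / 2)) \<le> core.Z"
      using core.Z_lower[OF ne] unfolding n c' .
    then have "(pi * sqrt n) ^ c * exp (R * (real \<nu>)\<^sup>2 / 2) * ((2 / sqrt n) ^ c * exp (- (R * (real \<nu>)\<^sup>2 / 2)))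
        \<le> (pi * sqrt n) ^ c * exp (R * (real \<nu>)\<^sup>2 / 2) * core.Z"
      using npos by (intro mult_left_mono) auto
    moreover have "(pi * sqrt n) ^ c * (2 / sqrt n) ^ c = (2 * pi) ^ c"
    proof -
      have "pi * sqrt n * (2 / sqrt n) = 2 * pi" using npos by simp
      then show ?thesis by (simp only: power_mult_distrib[symmetric])
    qed
    moreover have "exp (R * (real \<nu>)\<^sup>2 / 2) * exp (- (R * (real \<nu>)\<^sup>2 / 2)) = 1" by (simp add: exp_add[symmetric])
    moreover have "A * B * (C * D') = (A * C) * (B * D')" for A B C D' :: real by (simp only: mult_ac)
    ultimately show ?thesis by (simp only: mult_1_right)
  qed
  show ?crude
  proof (rule reduce)
    have [measurable]: "torus_box rows \<in> sets (LB rows)" using finite_rows by measurable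
    have int1: "integrable (LB rows) (indicator (torus_box rows) :: _ \<Rightarrow> real)"
      using finite_rows by (simp add: emeasure_torus_box less_top[symmetric])
    have "norm (core.F t) \<le> (\<Prod>m\<in>V. 1)" for t
      unfolding core.F_def prod_norm[symmetric] by (intro prod_mono conjI norm_ge_zero norm_geom_factor_le_1 z0)
    then have F1: "norm (indicator (torus_box rows) t *\<^sub>R core.F t) \<le> indicator (torus_box rows) t" for t
      by (simp add: indicator_def)
    have "integrable (LB rows) (\<lambda>t. indicator (torus_box rows) t *\<^sub>R core.F t)"
      by (rule Bochner_Integration.integrable_bound[OF int1]) (measurable, use F1 in auto)
    then have "norm (\<integral>t. indicator (torus_box rows) t *\<^sub>R core.F t \<partial>LB rows) \<le> (\<integral>t. indicator (torus_box rows) t \<partial>LB rows)"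
      using int1 F1 by (intro order_trans[OF integral_norm_bound] integral_mono integrable_norm)
    also have "\<dots> = (2 * pi) ^ c" using finite_rows by (simp add: c' measure_def emeasure_torus_box)
    \<comment> \<open>All factors have norm at most 1, so the integral is bounded by the volume of
      the torus.\<close>
    finally have "\<bar>J\<bar> \<le> (2 * pi) ^ c" unfolding J_def by (rule order_trans[OF abs_Re_le_cmod])
    then show "\<bar>J - core.Z\<bar> \<le> (1 + (pi * sqrt n) ^ c * exp (R * (real \<nu>)\<^sup>2 / 2)) * core.Z"
      using Zlow Zpos by (simp add: distrib_right)
  qed
  define \<kappa> where "\<kappa> = middle_loss \<nu> r R s1"
  assume "admissible_scales \<nu> r R n \<delta> s1"
  then have \<delta>: "0 < \<delta>" "2 * \<delta> \<le> pi" "0 < s1" and P: "R * (1 + 6 * R) / 6 * n * \<delta> ^ 4 \<le> 1"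
    and \<kappa>1: "\<kappa> < 1"
    unfolding admissible_scales_def \<kappa>_def by auto
  define E5 where "E5 = exp (- (min (4 * r) 1 / 4) * (s1\<^sup>2 / L))"
  define T where "T = 15 / 2 * (n * (R\<^sup>2)\<^sup>2 * (L / r)\<^sup>2 / r) + 3 * (R * (1 + 6 * R) / 6 * n * \<delta> ^ 4)
          + n * (2 * exp (- \<delta>\<^sup>2 / (2 * (L / r))))
          + n * (2 * (1 / sqrt (1 - \<kappa>)) ^ c * exp (- (1 - \<kappa>) * \<delta>\<^sup>2 / (2 * (L / r))))"
  have "\<kappa> = 2 * core.K4 / r * (12 * real \<nu> * s1)\<^sup>2" unfolding \<kappa>_def middle_loss_def core.K4_def by simp
  moreover have "core.K4 * real (card V) * \<delta> ^ 4 \<le> 1" using P unfolding core.K4_def n .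
  ultimately have "\<bar>J - core.Z\<bar> \<le> core.Z * T + (2 * pi) ^ c * E5"
    using core.core_estimate[OF \<delta>, of \<kappa>] \<kappa>1 unfolding J_def T_def E5_def n c' core.K4_def by simp
  also have "(2 * pi) ^ c * E5 \<le> (pi * sqrt n) ^ c * exp (R * (real \<nu>)\<^sup>2 / 2) * core.Z * E5"
    by (intro mult_right_mono Zlow) (simp add: E5_def)
  finally have "\<bar>J - core.Z\<bar> \<le> (T + (pi * sqrt n) ^ c * exp (R * (real \<nu>)\<^sup>2 / 2) * E5) * core.Z"
    by (simp add: algebra_simps)
  then show ?fine unfolding T_def E5_def \<kappa>_def estimate_error_def by (rule reduce)
qed

section \<open>Asymptotics\<close>

text \<open>Bounds the price of widening a Gaussian in c variables, from (1 - \<kappa>) (1 +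
  \<kappa>)^2 \<ge> 1 for \<kappa> in [0, 1/2].\<close>

lemma inverse_sqrt_power_le:
  assumes "0 \<le> \<kappa>" "\<kappa> \<le> 1 / 2"
  shows "(1 / sqrt (1 - \<kappa>)) ^ c \<le> exp (\<kappa> * real c)"
proof -
  have "1 \<le> (1 - \<kappa>) * (1 + \<kappa>)\<^sup>2"
  proof -
    have "(1 - \<kappa>) * (1 + \<kappa>)\<^sup>2 = 1 + \<kappa> * (1 - \<kappa> - \<kappa> * \<kappa>)" by (simp add: power2_eq_square algebra_simps)
    moreover have "\<kappa> * \<kappa> \<le> 1 / 2 * (1 / 2)" using assms by (intro mult_mono) auto
    ultimately show ?thesis using assms by simp
  qed
  then have "sqrt 1 \<le> sqrt ((1 - \<kappa>) * (1 + \<kappa>)\<^sup>2)" by (rule real_sqrt_le_mono)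
  then have "1 \<le> sqrt (1 - \<kappa>) * (1 + \<kappa>)" using assms by (simp add: real_sqrt_mult)
  moreover have "0 < sqrt (1 - \<kappa>)" using assms by simp
  ultimately have "1 / sqrt (1 - \<kappa>) \<le> 1 + \<kappa>" by (simp add: pos_divide_le_eq mult.commute)
  also have "\<dots> \<le> exp \<kappa>" by (rule exp_ge_add_one_self)
  finally have "(1 / sqrt (1 - \<kappa>)) ^ c \<le> exp \<kappa> ^ c" using assms by (intro power_mono) auto
  then show ?thesis by (simp add: exp_of_nat_mult[symmetric] mult.commute)
qed

text \<open>The scales satisfy \<delta>^2 = C0 k^(1-\<nu>) ln k and s^2 = C1 k^(2-\<nu>) ln k. Their
  constants are chosen backwards: the far region dictates \<open>C1\<close>, this fixes the loss
  \<kappa>, the loss dictates \<open>e0\<close>, and \<open>e0\<close> dictates \<open>C0\<close>.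
  An arbitrary \<open>C\<close> then costs only a larger N.\<close>

lemma asymptotic_error:
  fixes \<nu> :: nat and r R K C :: real
  assumes nu: "3 \<le> \<nu>" and r: "0 < r" and R: "1 \<le> R" and K: "0 < K" and C: "0 < C"
  shows "\<exists>N\<ge>1. \<forall>k\<ge>N. \<forall>n c L. 1 \<le> n \<longrightarrow> n \<le> k ^ \<nu> \<longrightarrow> real c \<le> real \<nu> * k \<longrightarrow>
    L = K * k powr (1 - real \<nu>) \<longrightarrow>
    (\<exists>\<delta> s. admissible_scales \<nu> r R n \<delta> s \<and> estimate_error \<nu> r R L n c \<delta> s \<le> C * k powr (- real \<nu> + 5 / 2))"
proof -
  define K4 where "K4 = R * (1 + 6 * R) / 6"
  define c' where "c' = min (4 * r) 1"
  \<comment> \<open>Makes the far exponent equal to (\<nu>^2 + 1) k ln k, ahead of the leading term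
    (\<nu>^2 / 2) k ln k of the logarithm of (pi sqrt n)^c.\<close>
  define C1 where "C1 = 4 * K / c' * ((real \<nu>)\<^sup>2 + 1)"
  define C2 where "C2 = R * (1 + 6 * R) / 3 / r * (144 * (real \<nu>)\<^sup>2)"
  \<comment> \<open>As \<kappa> \<le> 1/2, at least half of the tail exponent 2 e0 ln k survives the
    widening. It has to pay \<nu> ln k for the number of forms and C1 C2 \<nu> ln k for the
    widening, and to leave a gain of \<nu> ln k.\<close>
  define e0 where "e0 = 2 * real \<nu> + C1 * C2 * real \<nu>"
  define C0 where "C0 = 4 * K / r * e0"
  define A1 where "A1 = 15 / 2 * ((R\<^sup>2)\<^sup>2 * K\<^sup>2 / r ^ 3)"
  define A2 where "A2 = 3 * (K4 * C0\<^sup>2)"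
  define B where "B = exp (R * (real \<nu>)\<^sup>2 / 2)"
  define A where "A = A1 + A2 + 4 + B"
  have pos: "K4 > 0" "c' > 0" "C1 > 0" "C2 > 0" "e0 > 0" "C0 > 0" "A1 \<ge> 0" "A2 \<ge> 0" "B > 0" "A > 0"
  proof -
    show 1: "K4 > 0" using R by (simp add: K4_def)
    show 2: "c' > 0" using r by (simp add: c'_def)
    show 3: "C1 > 0" using 2 K unfolding C1_def by (intro mult_pos_pos divide_pos_pos add_nonneg_pos) auto
    show 4: "C2 > 0" using R r nu unfolding C2_def by (intro mult_pos_pos divide_pos_pos) auto
    show 5: "e0 > 0" using 3 4 nu unfolding e0_def by (intro add_pos_nonneg mult_nonneg_nonneg) auto
    show "C0 > 0" using 5 K r by (simp add: C0_def)
    show 6: "A1 \<ge> 0" using r by (simp add: A1_def)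
    show 7: "A2 \<ge> 0" using 1 by (simp add: A2_def)
    show 8: "B > 0" by (simp add: B_def)
    show "A > 0" using 6 7 8 by (simp add: A_def)
  qed
  have lim1: "((\<lambda>k. M * (ln k / k)) \<longlongrightarrow> 0) at_top" for M :: real
  proof -
    have "((\<lambda>k::real. ln k / k) \<longlongrightarrow> 0) at_top" by real_asymp
    then show ?thesis using tendsto_mult_right_zero by blast
  qed
  have lim2: "((\<lambda>k. M * ((ln k)\<^sup>2 / k)) \<longlongrightarrow> 0) at_top" for M :: real
  proof -
    have "((\<lambda>k::real. (ln k)\<^sup>2 / k) \<longlongrightarrow> 0) at_top" by real_asymp
    then show ?thesis using tendsto_mult_right_zero by blast
  qed
  have lim3: "((\<lambda>k. M * ((1 + (ln k)\<^sup>2) / sqrt k)) \<longlongrightarrow> 0) at_top" for M :: real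
  proof -
    have "((\<lambda>k::real. (1 + (ln k)\<^sup>2) / sqrt k) \<longlongrightarrow> 0) at_top" by real_asymp
    then show ?thesis using tendsto_mult_right_zero by blast
  qed
  have "eventually (\<lambda>k. k \<ge> 1 \<and> k \<ge> exp 4 \<and> k \<ge> real \<nu> \<and> C0 * (ln k / k) < 1 \<and> K4 * C0\<^sup>2 * ((ln k)\<^sup>2 / k) < 1
     \<and> C1 * C2 * (ln k / k) < 1 / 2 \<and> A * ((1 + (ln k)\<^sup>2) / sqrt k) < C) at_top"
    using C by (intro eventually_conj eventually_ge_at_top order_tendstoD[OF lim1] order_tendstoD[OF lim2] order_tendstoD[OF lim3]) auto
  then obtain N where N: "\<And>k. k \<ge> N \<Longrightarrow> k \<ge> 1 \<and> k \<ge> exp 4 \<and> k \<ge> real \<nu> \<and> C0 * (ln k / k) < 1 \<and> K4 * C0\<^sup>2 * ((ln k)\<^sup>2 / k) < 1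
     \<and> C1 * C2 * (ln k / k) < 1 / 2 \<and> A * ((1 + (ln k)\<^sup>2) / sqrt k) < C"
    unfolding eventually_at_top_linorder by blast
  show ?thesis
  proof (rule exI[of _ "max N 1"], intro conjI allI impI)
    show "1 \<le> max N 1" by simp
    fix k n :: real and c :: nat and L :: real
    assume kN: "max N 1 \<le> k" and n1: "1 \<le> n" and nk: "n \<le> k ^ \<nu>" and ck: "real c \<le> real \<nu> * k"
      and L: "L = K * k powr (1 - real \<nu>)"
    from kN N[of k] have k: "k \<ge> 1" "k \<ge> exp 4" "k \<ge> real \<nu>" "C0 * (ln k / k) < 1" "K4 * C0\<^sup>2 * ((ln k)\<^sup>2 / k) < 1"
      "C1 * C2 * (ln k / k) < 1 / 2" "A * ((1 + (ln k)\<^sup>2) / sqrt k) < C" by auto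
    define l where "l = ln k"
    have k0: "k > 0" using k by simp
    have l4: "l \<ge> 4" using k(2) k0 by (simp add: l_def ln_ge_iff)
    have kl: "k powr x = exp (x * l)" for x using k0 by (simp add: powr_def l_def)
    \<comment> \<open>\<open>P\<close> is the order of \<open>L\<close>, hence of the variances;
      \<open>y\<close> = k P is the order of the error before logarithms.\<close>
    define P where "P = k powr (1 - real \<nu>)"
    define y where "y = k powr (2 - real \<nu>)"
    have Pp: "P > 0" and yp: "y > 0" using k0 by (auto simp: P_def y_def)
    have ek: "exp l = k" using k0 by (simp add: l_def)
    have yP: "y = k * P"
    proof -
      have "y = exp (l + (1 - real \<nu>) * l)" unfolding y_def kl by (simp add: algebra_simps)
      then show ?thesis unfolding exp_add P_def kl ek .
    qed
    \<comment> \<open>Here 3 \<le> \<nu> is essential: it makes the widening cost \<kappa> c a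
      bounded multiple of ln k.\<close>
    have y1: "y * k \<le> 1"
    proof -
      have "y * k = exp ((2 - real \<nu>) * l + l)" unfolding exp_add y_def kl ek ..
      also have "(2 - real \<nu>) * l + l = (3 - real \<nu>) * l" by (simp add: algebra_simps)
      also have "exp ((3 - real \<nu>) * l) \<le> exp 0" using nu l4 by (subst exp_le_cancel_iff) (auto intro: mult_nonpos_nonneg)
      finally show ?thesis by simp
    qed
    have nl: "n \<le> exp (real \<nu> * l)"
    proof -
      have "k ^ \<nu> = exp (real \<nu> * l)" using k0 by (simp add: powr_realpow[symmetric] kl)
      then show ?thesis using nk by simp
    qed
    have nP2: "n * P\<^sup>2 \<le> y"
    proof -
      have "n * P\<^sup>2 \<le> exp (real \<nu> * l) * P\<^sup>2" using nl by (intro mult_right_mono) auto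
      also have "\<dots> = exp (real \<nu> * l) * (exp ((1 - real \<nu>) * l) * exp ((1 - real \<nu>) * l))"
        by (simp add: P_def kl power2_eq_square)
      also have "\<dots> = exp (real \<nu> * l + ((1 - real \<nu>) * l + (1 - real \<nu>) * l))" by (simp only: exp_add)
      also have "\<dots> = y" unfolding y_def kl by (rule arg_cong[of _ _ exp]) (simp add: algebra_simps)
      finally show ?thesis .
    qed
    have y_exp: "exp (- (real \<nu> * l)) \<le> y"
      unfolding y_def kl using l4 by (subst exp_le_cancel_iff) (simp add: algebra_simps)
    have yk: "y \<le> 1 / k" using y1 k0 by (simp add: pos_le_divide_eq)
    have Py: "P \<le> y" using yP k(1) Pp by simp
    define \<delta> where "\<delta> = sqrt (C0 * P * l)"
    define s1 where "s1 = sqrt (C1 * y * l)"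
    define \<kappa> where "\<kappa> = middle_loss \<nu> r R s1"
    have \<delta>2: "\<delta>\<^sup>2 = C0 * P * l" using pos Pp l4 by (simp add: \<delta>_def)
    have s2: "s1\<^sup>2 = C1 * y * l" using pos yp l4 by (simp add: s1_def)
    have \<delta>4: "\<delta> ^ 4 = C0\<^sup>2 * P\<^sup>2 * l\<^sup>2"
    proof -
      have "\<delta> ^ 4 = (\<delta>\<^sup>2)\<^sup>2" by simp
      then show ?thesis unfolding \<delta>2 by (simp add: power_mult_distrib)
    qed
    have \<kappa>: "\<kappa> = C1 * C2 * (y * l)"
      unfolding \<kappa>_def middle_loss_def power_mult_distrib s2 C2_def by (simp add: mult_ac)
    have \<kappa>0: "0 \<le> \<kappa>" unfolding \<kappa> using pos yp l4 by simp
    have \<kappa>h: "\<kappa> \<le> 1 / 2"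
    proof -
      have "y * l \<le> l / k" using yk l4 mult_right_mono[of y "1 / k" l] by simp
      then have "\<kappa> \<le> C1 * C2 * (l / k)" unfolding \<kappa> using pos by (intro mult_left_mono) auto
      then show ?thesis using k(6) unfolding l_def by linarith
    qed
    have g1: "0 < \<delta>" using pos Pp l4 by (simp add: \<delta>_def)
    have g2: "2 * \<delta> \<le> pi"
    proof -
      have "C0 * P * l \<le> C0 * (l / k)"
      proof -
        have "P * l \<le> 1 / k * l" using Py yk l4 by (intro mult_right_mono) auto
        then have "C0 * (P * l) \<le> C0 * (l / k)" using pos by (intro mult_left_mono) auto
        then show ?thesis by (simp add: mult.assoc)
      qed
      then have "\<delta>\<^sup>2 \<le> 1\<^sup>2" using k(4) unfolding \<delta>2 l_def by simp
      then have "\<delta> \<le> 1" by (rule power2_le_imp_le) simp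
      then show ?thesis using pi_ge_two by simp
    qed
    have g3: "0 < s1" using pos yp l4 by (simp add: s1_def)
    have t2: "K4 * n * \<delta> ^ 4 \<le> K4 * C0\<^sup>2 * l\<^sup>2 * y"
    proof -
      have "K4 * n * \<delta> ^ 4 = K4 * C0\<^sup>2 * l\<^sup>2 * (n * P\<^sup>2)" unfolding \<delta>4 by (simp add: mult_ac)
      also have "\<dots> \<le> K4 * C0\<^sup>2 * l\<^sup>2 * y" using pos by (intro mult_left_mono nP2) auto
      finally show ?thesis .
    qed
    have g4: "K4 * n * \<delta> ^ 4 \<le> 1"
    proof -
      have "K4 * C0\<^sup>2 * l\<^sup>2 * y \<le> K4 * C0\<^sup>2 * l\<^sup>2 * (1 / k)" using pos yk by (intro mult_left_mono) auto
      then show ?thesis using t2 k(5) unfolding l_def by simp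
    qed
    have ratio: "\<delta>\<^sup>2 / (2 * (L / r)) = 2 * e0 * l"
    proof -
      have "\<delta>\<^sup>2 / (2 * (L / r)) = (4 * K / r * e0 * P * l) / (2 * (K * P / r))"
        unfolding \<delta>2 C0_def L P_def ..
      also have "\<dots> = 2 * e0 * l" using K r Pp by (simp add: field_simps)
      finally show ?thesis .
    qed
    have T1: "15 / 2 * (n * (R\<^sup>2)\<^sup>2 * (L / r)\<^sup>2 / r) \<le> A1 * y"
    proof -
      have "15 / 2 * (n * (R\<^sup>2)\<^sup>2 * (L / r)\<^sup>2 / r) = A1 * (n * P\<^sup>2)"
      proof -
        have "(K * P / r)\<^sup>2 = K\<^sup>2 * P\<^sup>2 / r\<^sup>2" by (simp add: power_mult_distrib power_divide)
        moreover have "15 / 2 * (n * Q * (K2 * P2 / r\<^sup>2) / r) = 15 / 2 * (Q * K2 / r ^ 3) * (n * P2)" for Q K2 P2 :: real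
          by (simp add: power2_eq_square power3_eq_cube)
        ultimately show ?thesis unfolding L P_def[symmetric] A1_def by (simp only:)
      qed
      also have "\<dots> \<le> A1 * y" using pos by (intro mult_left_mono nP2)
      finally show ?thesis .
    qed
    have T2: "3 * (K4 * n * \<delta> ^ 4) \<le> A2 * l\<^sup>2 * y" using t2 by (simp add: A2_def mult_ac)
    have T3: "n * (2 * exp (- \<delta>\<^sup>2 / (2 * (L / r)))) \<le> 2 * y"
    proof -
      have "- \<delta>\<^sup>2 / (2 * (L / r)) = - (2 * e0 * l)" unfolding minus_divide_left[symmetric] ratio ..
      then have "n * (2 * exp (- \<delta>\<^sup>2 / (2 * (L / r)))) = 2 * (n * exp (- (2 * e0 * l)))" by simp
      also have "\<dots> \<le> 2 * (exp (real \<nu> * l) * exp (- (2 * e0 * l)))" using nl by (intro mult_left_mono mult_right_mono) auto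
      also have "\<dots> = 2 * exp (real \<nu> * l - 2 * e0 * l)" by (simp add: exp_add[symmetric])
      also have "\<dots> \<le> 2 * exp (- (real \<nu> * l))"
      proof -
        have "real \<nu> \<le> e0" using pos nu unfolding e0_def by simp
        then have "real \<nu> * l \<le> e0 * l" using l4 by (intro mult_right_mono) auto
        then have "real \<nu> * l - 2 * e0 * l \<le> - (real \<nu> * l)" by linarith
        then show ?thesis by simp
      qed
      also have "\<dots> \<le> 2 * y" using y_exp by simp
      finally show ?thesis .
    qed
    have T4: "n * (2 * (1 / sqrt (1 - \<kappa>)) ^ c * exp (- (1 - \<kappa>) * \<delta>\<^sup>2 / (2 * (L / r)))) \<le> 2 * y"
    proof -
      have "\<kappa> * real c \<le> \<kappa> * (real \<nu> * k)" using ck \<kappa>0 by (intro mult_left_mono)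
      also have "\<dots> = C1 * C2 * real \<nu> * l * (y * k)" unfolding \<kappa> by (simp add: mult_ac)
      also have "\<dots> \<le> C1 * C2 * real \<nu> * l" using y1 pos l4 by (intro mult_left_le) auto
      finally have \<kappa>c: "\<kappa> * real c \<le> C1 * C2 * real \<nu> * l" .
      have "(1 / sqrt (1 - \<kappa>)) ^ c \<le> exp (C1 * C2 * real \<nu> * l)"
        by (rule order_trans[OF inverse_sqrt_power_le[OF \<kappa>0 \<kappa>h]]) (use \<kappa>c in simp)
      moreover have "exp (- (1 - \<kappa>) * \<delta>\<^sup>2 / (2 * (L / r))) \<le> exp (- (e0 * l))"
      proof -
        have "- a * b / c = - (a * (b / c))" for a b c :: real by simp
        from this[of "1 - \<kappa>" "\<delta>\<^sup>2" "2 * (L / r)"]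
        have "- (1 - \<kappa>) * \<delta>\<^sup>2 / (2 * (L / r)) = - ((1 - \<kappa>) * (2 * e0 * l))" unfolding ratio .
        moreover have "1 / 2 * (2 * e0 * l) \<le> (1 - \<kappa>) * (2 * e0 * l)" using \<kappa>h pos l4 by (intro mult_right_mono) auto
        ultimately show ?thesis by simp
      qed
      ultimately have "n * (2 * (1 / sqrt (1 - \<kappa>)) ^ c * exp (- (1 - \<kappa>) * \<delta>\<^sup>2 / (2 * (L / r))))
          \<le> exp (real \<nu> * l) * (2 * exp (C1 * C2 * real \<nu> * l) * exp (- (e0 * l)))"
        using nl n1 \<kappa>h by (intro mult_mono) auto
      also have "\<dots> = 2 * exp (real \<nu> * l + (C1 * C2 * real \<nu> * l + - (e0 * l)))" by (simp only: exp_add mult_ac)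
      also have "real \<nu> * l + (C1 * C2 * real \<nu> * l + - (e0 * l)) = - (real \<nu> * l)" by (simp add: e0_def algebra_simps)
      also have "2 * exp (- (real \<nu> * l)) \<le> 2 * y" using y_exp by simp
      finally show ?thesis .
    qed
    have T5: "(pi * sqrt n) ^ c * exp (R * (real \<nu>)\<^sup>2 / 2) * exp (- (min (4 * r) 1 / 4) * (s1\<^sup>2 / L)) \<le> B * y"
    proof -
      have "pi * sqrt n \<le> exp 2 * exp (real \<nu> * l / 2)"
      proof (intro mult_mono)
        have "2 * 2 \<le> exp 1 * exp (1::real)" using exp_ge_add_one_self[of "1::real"] by (intro mult_mono) auto
        also have "\<dots> = exp 2" by (simp add: exp_add[symmetric])
        finally show "pi \<le> exp 2" using pi_less_4 by simp
        have "sqrt n \<le> sqrt (exp (real \<nu> * l))" using nl by simp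
        also have "\<dots> = exp (real \<nu> * l / 2)" by (rule real_sqrt_unique) (simp_all add: power2_eq_square exp_add[symmetric])
        finally show "sqrt n \<le> exp (real \<nu> * l / 2)" .
      qed (use n1 in auto)
      then have "(pi * sqrt n) ^ c \<le> exp (2 + real \<nu> * l / 2) ^ c" using n1 by (intro power_mono) (auto simp: exp_add)
      also have "\<dots> = exp (real c * (2 + real \<nu> * l / 2))" by (rule exp_of_nat_mult[symmetric])
      also have "\<dots> \<le> exp (real \<nu> * k * (2 + real \<nu> * l / 2))" using ck l4 by (subst exp_le_cancel_iff) (intro mult_right_mono, auto)
      finally have p1: "(pi * sqrt n) ^ c \<le> exp (real \<nu> * k * (2 + real \<nu> * l / 2))" .
      have p2: "- (min (4 * r) 1 / 4) * (s1\<^sup>2 / L) = - (((real \<nu>)\<^sup>2 + 1) * k * l)"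
      proof -
        have "(c' / 4) * (s1\<^sup>2 / L) = (c' / 4) * ((4 * K / c' * ((real \<nu>)\<^sup>2 + 1)) * (k * P) * l / (K * P))"
          unfolding s2 C1_def L yP P_def ..
        also have "\<dots> = ((real \<nu>)\<^sup>2 + 1) * k * l"
        proof -
          have "c / 4 * ((4 * K / c * M) * (k * P) * l / (K * P)) = M * k * l" if "c > 0" for c M :: real
            using that K Pp k0 by (simp add: field_simps)
          from this[OF pos(2)] show ?thesis .
        qed
        finally show ?thesis unfolding c'_def by simp
      qed
      \<comment> \<open>As ln k \<ge> 4, the term 2 \<nu> k is at most half of \<nu>^2 k ln k. What
        remains is at most - k ln k, and k \<ge> \<nu>.\<close>
      have "real \<nu> * k * (2 + real \<nu> * l / 2) + - (((real \<nu>)\<^sup>2 + 1) * k * l) \<le> - (real \<nu> * l)"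
      proof -
        have "4 * (real \<nu> * k) \<le> l * (real \<nu> * k)" using l4 k0 by (intro mult_right_mono) auto
        also have "\<dots> = 1 * (l * (real \<nu> * k))" by simp
        also have "\<dots> \<le> real \<nu> * (l * (real \<nu> * k))" using nu l4 k0 by (intro mult_right_mono) auto
        finally have "2 * (real \<nu> * k) \<le> (real \<nu>)\<^sup>2 * k * l / 2" by (simp add: power2_eq_square mult_ac)
        moreover have "real \<nu> * l \<le> k * l" using k(3) l4 by (intro mult_right_mono) auto
        moreover have "real \<nu> * k * (2 + real \<nu> * l / 2) + - (((real \<nu>)\<^sup>2 + 1) * k * l)
            = 2 * (real \<nu> * k) + (real \<nu>)\<^sup>2 * k * l / 2 - (real \<nu>)\<^sup>2 * k * l - k * l"
          by (simp add: power2_eq_square algebra_simps)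
        ultimately show ?thesis by linarith
      qed
      then have "exp (real \<nu> * k * (2 + real \<nu> * l / 2)) * exp (- (((real \<nu>)\<^sup>2 + 1) * k * l)) \<le> y"
        unfolding exp_add[symmetric] by (intro order_trans[OF _ y_exp]) simp
      then have "B * (exp (real \<nu> * k * (2 + real \<nu> * l / 2)) * exp (- (((real \<nu>)\<^sup>2 + 1) * k * l))) \<le> B * y"
        using pos by (intro mult_left_mono) auto
      moreover have "(pi * sqrt n) ^ c * B * exp (- (((real \<nu>)\<^sup>2 + 1) * k * l))
          \<le> exp (real \<nu> * k * (2 + real \<nu> * l / 2)) * B * exp (- (((real \<nu>)\<^sup>2 + 1) * k * l))"
        using p1 pos by (intro mult_right_mono) auto
      ultimately show ?thesis unfolding p2 B_def[symmetric] by (simp add: mult_ac)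
    qed
    have final: "A1 * y + A2 * l\<^sup>2 * y + 2 * y + 2 * y + B * y \<le> C * k powr (- real \<nu> + 5 / 2)"
    proof -
      have "A1 * y + A2 * l\<^sup>2 * y + 2 * y + 2 * y + B * y = (A1 + 4 + B) * (1 * y) + A2 * (l\<^sup>2 * y)" by (simp add: algebra_simps)
      also have "\<dots> \<le> (A1 + 4 + B) * ((1 + l\<^sup>2) * y) + A2 * ((1 + l\<^sup>2) * y)"
        using pos yp by (intro add_mono mult_left_mono mult_right_mono) auto
      also have "\<dots> = A * (1 + l\<^sup>2) * y" by (simp add: A_def algebra_simps)
      \<comment> \<open>The half power of k between k^(2-\<nu>) and k^(5/2-\<nu>) absorbs ln^2 k
        together with all constants.\<close>
      also have "\<dots> \<le> C * sqrt k * y"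
      proof -
        have "A * (1 + l\<^sup>2) \<le> C * sqrt k" using k(7) k0 unfolding l_def by (simp add: pos_divide_less_eq less_imp_le)
        then show ?thesis using yp by (intro mult_right_mono) auto
      qed
      also have "\<dots> = C * k powr (- real \<nu> + 5 / 2)"
      proof -
        have "sqrt k * y = k powr (1 / 2 + (2 - real \<nu>))" using k0 unfolding y_def powr_add by (simp add: powr_half_sqrt)
        then show ?thesis by (simp add: algebra_simps)
      qed
      finally show ?thesis .
    qed
    show "\<exists>\<delta> s. admissible_scales \<nu> r R n \<delta> s \<and> estimate_error \<nu> r R L n c \<delta> s \<le> C * k powr (- real \<nu> + 5 / 2)"
    proof (intro exI conjI)
      show "admissible_scales \<nu> r R n \<delta> s1"
        unfolding admissible_scales_def \<kappa>_def[symmetric] using g1 g2 g3 g4 \<kappa>h unfolding K4_def by simp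
      show "estimate_error \<nu> r R L n c \<delta> s1 \<le> C * k powr (- real \<nu> + 5 / 2)"
        unfolding estimate_error_def \<kappa>_def[symmetric] using T1 T2 T3 T4 T5 final unfolding K4_def by linarith
    qed
  qed
qed

section \<open>Constants uniform in the polytope\<close>

lemma admissible_bounds:
  assumes adm: "admissible \<nu> r R \<omega> k ks S z" and \<omega>: "0 < \<omega>" "\<omega> < 1"
  defines "n \<equiv> real (card (multi_indices \<nu> ks))"
  shows "2 \<le> k" and "\<And>j. j \<in> {1..\<nu>} \<Longrightarrow> 1 \<le> ks j" and "1 \<le> n" and "n \<le> k ^ \<nu>" and "\<omega> ^ \<nu> * k ^ \<nu> \<le> n"
    and "real (total_size \<nu> ks - (\<nu> - 1)) \<le> real \<nu> * k"
proof -
  have k: "k > 0" "\<omega> * k \<ge> 2" and ks: "\<And>j. j \<in> {1..\<nu>} \<Longrightarrow> \<omega> * k \<le> real (ks j) \<and> real (ks j) \<le> k"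
    using adm by (auto simp: admissible_def)
  have "\<omega> * k \<le> 1 * k" using k \<omega> by (intro mult_right_mono) auto
  then show "2 \<le> k" using k by linarith
  show ks1: "1 \<le> ks j" if "j \<in> {1..\<nu>}" for j using ks[OF that] k by linarith
  have n: "n = (\<Prod>j=1..\<nu>. real (ks j))"
    unfolding n_def multi_indices_def by (subst card_PiE) auto
  have "(\<Prod>j=1..\<nu>. 1) \<le> (\<Prod>j=1..\<nu>. real (ks j))" using ks1 by (intro prod_mono) force
  then show "1 \<le> n" by (simp add: n)
  have "(\<Prod>j=1..\<nu>. real (ks j)) \<le> (\<Prod>j=1..\<nu>. k)" using ks by (intro prod_mono) auto
  then show "n \<le> k ^ \<nu>" by (simp add: n)
  have "(\<Prod>j=1..\<nu>. \<omega> * k) \<le> (\<Prod>j=1..\<nu>. real (ks j))" using ks k by (intro prod_mono) auto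
  then show "\<omega> ^ \<nu> * k ^ \<nu> \<le> n" by (simp add: n power_mult_distrib)
  have "real (total_size \<nu> ks - (\<nu> - 1)) \<le> real (total_size \<nu> ks)" by simp
  also have "\<dots> = (\<Sum>j=1..\<nu>. real (ks j))" by (simp add: total_size_def)
  also have "\<dots> \<le> (\<Sum>j=1..\<nu>. k)" using ks by (intro sum_mono) auto
  finally show "real (total_size \<nu> ks - (\<nu> - 1)) \<le> real \<nu> * k" by simp
qed

lemma gauss_estimate_nonneg: "0 \<le> gauss_estimate \<nu> ks z"
  by (simp add: gauss_estimate_def)

lemma approximated_within_mono:
  "approximated_within M E \<epsilon> \<Longrightarrow> \<epsilon> \<le> \<epsilon>' \<Longrightarrow> 0 \<le> E \<Longrightarrow> approximated_within M E \<epsilon>'"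
  unfolding approximated_within_def by (meson mult_right_mono order_trans)

lemma admissible_approximation:
  assumes nu: "1 \<le> \<nu>" and r: "0 < r" and R: "1 \<le> R" and \<omega>: "0 < \<omega>" "\<omega> < 1"
    and adm: "admissible \<nu> r R \<omega> k ks S z"
  defines "n \<equiv> real (card (multi_indices \<nu> ks))" and "c \<equiv> total_size \<nu> ks - (\<nu> - 1)"
  shows "approximated_within (real (card (integer_points \<nu> ks S))) (gauss_estimate \<nu> ks z)
      (1 + (pi * sqrt n) ^ c * exp (R * (real \<nu>)\<^sup>2 / 2))"
    and "admissible_scales \<nu> r R n \<delta> s \<Longrightarrow>
      approximated_within (real (card (integer_points \<nu> ks S))) (gauss_estimate \<nu> ks z)
        (estimate_error \<nu> r R (4 * (real \<nu>)\<^sup>2 / \<omega> ^ \<nu> * k powr (1 - real \<nu>)) n c \<delta> s)"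
proof -
  note b = admissible_bounds[OF adm \<omega>]
  \<comment> \<open>Since n \<ge> (\<omega> k)^\<nu>, the leverage constant 4 \<nu>^2 k / n is at
    most \<open>?K\<close> times k^(1-\<nu>).\<close>
  let ?K = "4 * (real \<nu>)\<^sup>2 / \<omega> ^ \<nu>"
  have kpos: "k > 0" and k1: "1 \<le> k" using b(1) by auto
  have L: "4 * (real \<nu>)\<^sup>2 * k \<le> ?K * k powr (1 - real \<nu>) * n"
  proof -
    have kp: "k powr (1 - real \<nu>) * k ^ \<nu> = k"
      using kpos by (simp add: powr_realpow[symmetric] powr_add[symmetric])
    have "?K * k powr (1 - real \<nu>) * (\<omega> ^ \<nu> * k ^ \<nu>) = ?K * \<omega> ^ \<nu> * (k powr (1 - real \<nu>) * k ^ \<nu>)"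
      by (simp only: mult_ac)
    also have "?K * \<omega> ^ \<nu> = 4 * (real \<nu>)\<^sup>2" using \<omega> by simp
    finally have "4 * (real \<nu>)\<^sup>2 * k = ?K * k powr (1 - real \<nu>) * (\<omega> ^ \<nu> * k ^ \<nu>)" unfolding kp by simp
    also have "\<dots> \<le> ?K * k powr (1 - real \<nu>) * n"
      using \<omega> b(5) unfolding n_def by (intro mult_left_mono) auto
    finally show ?thesis .
  qed
  have int: "\<And>j l. j \<in> {1..\<nu>} \<Longrightarrow> l \<in> {1..ks j} \<Longrightarrow> S j l \<in> \<int>"
    and arg: "is_arg_max (entropy \<nu> ks) (\<lambda>x. x \<in> transportation_polytope \<nu> ks S) z"
    and D: "\<And>m. m \<in> multi_indices \<nu> ks \<Longrightarrow> r \<le> z m + (z m)\<^sup>2" "\<And>m. m \<in> multi_indices \<nu> ks \<Longrightarrow> z m + (z m)\<^sup>2 \<le> R"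
    and kle: "\<And>j. j \<in> {1..\<nu>} \<Longrightarrow> real (ks j) \<le> k"
    using adm unfolding admissible_def by (auto simp: add.commute)
  note ta = transport_approximation[OF nu b(2) int arg r R D k1 kle n_def[THEN meta_eq_to_obj_eq] L c_def[THEN meta_eq_to_obj_eq]]
  show "approximated_within (real (card (integer_points \<nu> ks S))) (gauss_estimate \<nu> ks z)
      (1 + (pi * sqrt n) ^ c * exp (R * (real \<nu>)\<^sup>2 / 2))"
    by (rule ta(1))
  show "approximated_within (real (card (integer_points \<nu> ks S))) (gauss_estimate \<nu> ks z)
        (estimate_error \<nu> r R (?K * k powr (1 - real \<nu>)) n c \<delta> s)" if "admissible_scales \<nu> r R n \<delta> s"
    by (rule ta(2)[OF _ _ _ _ _ _ that])
qed

theorem theorem1p1: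
  fixes \<nu> :: nat and r R \<omega> :: real
  assumes "\<nu> \<ge> 3" and "R > r" and "r > 0" and "R > 1" and "0 < \<omega>" and "\<omega> < 1"
  shows "(\<exists>\<Gamma>::real. \<forall>k ks S z. admissible \<nu> r R \<omega> k ks S z \<longrightarrow>
            approximated_within (real (card (integer_points \<nu> ks S))) (gauss_estimate \<nu> ks z)
              (\<Gamma> * k powr (- real \<nu> + 5 / 2))) \<and>
         (\<exists>N::real. \<forall>k\<ge>N. \<forall>ks S z. admissible \<nu> r R \<omega> k ks S z \<longrightarrow>
            approximated_within (real (card (integer_points \<nu> ks S))) (gauss_estimate \<nu> ks z)
              (256 * R\<^sup>2 * pi ^ 4 * 4 ^ \<nu> * real \<nu> ^ 8 / \<omega> ^ (2 * \<nu>) *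
                 k powr (- real \<nu> + 5 / 2)))"
proof -
  define C where "C = 256 * R\<^sup>2 * pi ^ 4 * 4 ^ \<nu> * real \<nu> ^ 8 / \<omega> ^ (2 * \<nu>)"
  define K where "K = 4 * (real \<nu>)\<^sup>2 / \<omega> ^ \<nu>"
  have C: "C > 0" using assms by (simp add: C_def)
  have K: "K > 0" using assms by (simp add: K_def)
  have R1: "1 \<le> R" and nu1: "1 \<le> \<nu>" using assms by auto
  note approx = admissible_approximation[OF nu1 assms(3) R1 assms(5,6)]
  \<comment> \<open>The asymptotic estimate admits any positive constant, so it is invoked with the
    explicit one.\<close>
  obtain N where N1: "N \<ge> 1" and N: "\<And>k n c L. k \<ge> N \<Longrightarrow> 1 \<le> n \<Longrightarrow> n \<le> k ^ \<nu> \<Longrightarrow> real c \<le> real \<nu> * k \<Longrightarrow>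
      L = K * k powr (1 - real \<nu>) \<Longrightarrow>
      \<exists>\<delta> s. admissible_scales \<nu> r R n \<delta> s \<and> estimate_error \<nu> r R L n c \<delta> s \<le> C * k powr (- real \<nu> + 5 / 2)"
    using asymptotic_error[OF assms(1,3) R1 K C] by blast
  have large: "approximated_within (real (card (integer_points \<nu> ks S))) (gauss_estimate \<nu> ks z) (C * k powr (- real \<nu> + 5 / 2))"
    if adm: "admissible \<nu> r R \<omega> k ks S z" and k: "k \<ge> N" for k ks S z
  proof -
    note b = admissible_bounds[OF adm assms(5,6)]
    obtain \<delta> s where d: "admissible_scales \<nu> r R (real (card (multi_indices \<nu> ks))) \<delta> s"
      and le: "estimate_error \<nu> r R (K * k powr (1 - real \<nu>)) (real (card (multi_indices \<nu> ks))) (total_size \<nu> ks - (\<nu> - 1)) \<delta> s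
        \<le> C * k powr (- real \<nu> + 5 / 2)"
      using N[OF k b(3,4,6) refl] by blast
    show ?thesis
      by (rule approximated_within_mono[OF approx(2)[OF adm d] le[unfolded K_def] gauss_estimate_nonneg])
  qed
  \<comment> \<open>For k < N one has n \<le> N^\<nu> and c \<le> \<nu> N; as the enlarged base is
    at least 1, \<open>M\<close> bounds the crude error.\<close>
  define M where "M = 1 + (pi * sqrt (N ^ \<nu>)) ^ nat \<lceil>real \<nu> * N\<rceil> * exp (R * (real \<nu>)\<^sup>2 / 2)"
  define \<Gamma> where "\<Gamma> = max C (M / N powr (- real \<nu> + 5 / 2))"
  have all: "approximated_within (real (card (integer_points \<nu> ks S))) (gauss_estimate \<nu> ks z) (\<Gamma> * k powr (- real \<nu> + 5 / 2))"
    if adm: "admissible \<nu> r R \<omega> k ks S z" for k ks S z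
  proof (cases "k \<ge> N")
    case True
    have "C * k powr (- real \<nu> + 5 / 2) \<le> \<Gamma> * k powr (- real \<nu> + 5 / 2)"
      by (intro mult_right_mono) (auto simp: \<Gamma>_def)
    then show ?thesis by (rule approximated_within_mono[OF large[OF adm True] _ gauss_estimate_nonneg])
  next
    case False
    note b = admissible_bounds[OF adm assms(5,6)]
    let ?n = "real (card (multi_indices \<nu> ks))" and ?c = "total_size \<nu> ks - (\<nu> - 1)"
    have kN: "k \<le> N" "k > 0" using False b(1) by auto
    have "?n \<le> N ^ \<nu>" using b(4) power_mono[OF kN(1), of \<nu>] kN by linarith
    then have base: "pi * sqrt ?n \<le> pi * sqrt (N ^ \<nu>)" by simp
    have "1 \<le> N ^ \<nu>" using N1 by simp
    then have "1 * 1 \<le> pi * sqrt (N ^ \<nu>)" using pi_ge_two by (intro mult_mono) auto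
    then have one: "1 \<le> pi * sqrt (N ^ \<nu>)" by simp
    have "real ?c \<le> real \<nu> * N" using b(6) mult_left_mono[OF kN(1), of "real \<nu>"] by simp
    then have c: "?c \<le> nat \<lceil>real \<nu> * N\<rceil>" by linarith
    have "(pi * sqrt ?n) ^ ?c \<le> (pi * sqrt (N ^ \<nu>)) ^ ?c" using base b(3) by (intro power_mono) auto
    also have "\<dots> \<le> (pi * sqrt (N ^ \<nu>)) ^ nat \<lceil>real \<nu> * N\<rceil>" by (rule power_increasing[OF c one])
    finally have "1 + (pi * sqrt ?n) ^ ?c * exp (R * (real \<nu>)\<^sup>2 / 2) \<le> M" unfolding M_def by simp
    also have "\<dots> \<le> \<Gamma> * k powr (- real \<nu> + 5 / 2)"
    proof -
      \<comment> \<open>The exponent is negative because \<nu> \<ge> 3, so for k \<le> N the power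
        is smallest at k = N.\<close>
      have "N powr (- real \<nu> + 5 / 2) \<le> k powr (- real \<nu> + 5 / 2)" using kN assms(1) by (intro powr_mono2') auto
      moreover have "N powr (- real \<nu> + 5 / 2) > 0" using N1 by simp
      moreover have "M / N powr (- real \<nu> + 5 / 2) \<le> \<Gamma>" by (simp add: \<Gamma>_def)
      moreover have "0 \<le> \<Gamma>" using C by (simp add: \<Gamma>_def)
      ultimately have "M / N powr (- real \<nu> + 5 / 2) * N powr (- real \<nu> + 5 / 2) \<le> \<Gamma> * k powr (- real \<nu> + 5 / 2)"
        by (intro mult_mono) auto
      then show ?thesis using \<open>N powr (- real \<nu> + 5 / 2) > 0\<close> by simp
    qed
    finally show ?thesis by (rule approximated_within_mono[OF approx(1)[OF adm] _ gauss_estimate_nonneg])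
  qed
  show ?thesis
    using all large unfolding C_def by blast
qed

end
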